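(* Let Assumption (A) below hold, and suppose in addition that $P(M_{0,i}>0)=1$ for all $i\in\mathcal D$. Then for every $i\in\mathcal D$, $$P(R>t\mid X_0=i)\sim K_i\,t^{-\alpha}L(t)\qquad (t\to\infty),$$ where $\mathbf K=(K_i)_{i\in\mathcal D}\in B_b$ is given by $\mathbf K=(I-G)^{-1}\mathbf q^{(1)}$ with $\mathbf q^{(1)}=(q^{(1)}_i)_{i\in\mathcal D}$. (Here $I-G$ is invertible on $B_b$ since the spectral radius of $G$ is less than $1$ by (A3).)
   Context: Let $\mathcal D$ be a countable set and $(X_n)_{n\in\mathbb Z}$ a stationary irreducible Markov chain on $\mathcal D$. Let $(Q_{n,i},M_{n,i})_{n\in\mathbb Z,i\in\mathcal D}$ be independent $\mathbb R^2$-valued random pairs, independent of $(X_n)$, such that for each fixed $i$ the pairs $(Q_{n,i},M_{n,i})_{n\in\mathbb Z}$ are i.i.d. Set $Q_n=Q_{n,X_n}$, $M_n=M_{n,X_n}$ (coefficients "induced" by $(X_n)$), and let $R=Q_0+\sum_{n\ge1}Q_{-n}\prod_{i=0}^{n-1}M_{-i}$ be the stationary solution of $R_n=Q_n+M_nR_{n-1}$. A function $L$ is slowly varying if $L(\lambda t)\sim L(t)$ for all $\lambda>0$; $f\sim g$ means $f(t)/g(t)\to1$ as $t\to\infty$. Assumption (A): there is $\alpha>0$ such that (A1) there is a slowly varying $L$ and constants $q_i^{(\eta)}\ge0$, $i\in\mathcal D$, $\eta\in\{-1,1\}$, with $P(\eta Q_{n,i}>t)/(t^{-\alpha}L(t))\to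 q_i^{(\eta)}$ uniformly in $i$; moreover $\sum_j q^{(1)}_j>0$ and $\sup_j\max\{q^{(1)}_j,q^{(-1)}_j\}<\infty$; (A2) there is $\beta>\alpha$ with $\sup_i E|M_{0,i}|^\beta<\infty$; (A3) with $m_i^{(\eta)}=E(|M_{0,i}|^\alpha\mathbf 1_{\{\eta M_{0,i}>0\}})$ and $m_i=m_i^{(1)}+m_i^{(-1)}$, $\sup_i m_i<1$; (A4) $\lim_{\varepsilon\to0+}P(M_{1,i}\le\varepsilon)=P(M_{1,i}\le0)$ uniformly in $i$. $B_b$ is the space of bounded real sequences indexed by $\mathcal D$ with the sup norm. $H(i,j)=P(X_n=j\mid X_{n+1}=i)$ is the transition matrix of the reversed chain; $G_\eta(i,j)=m_i^{(\eta)}H(i,j)$ for $\eta\in\{-1,1\}$, and $G(i,j)=m_iH(i,j)$. *)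

theory Defs
  imports "HOL-Probability.Probability" "HOL-Library.Landau_Symbols"
begin

definition slowly_varying :: "(real \<Rightarrow> real) \<Rightarrow> bool" where
  "slowly_varying L \<longleftrightarrow> (\<forall>c>0. (\<lambda>t. L (c * t)) \<sim>[at_top] L)"

definition stochastic_matrix :: "('d \<Rightarrow> 'd \<Rightarrow> real) \<Rightarrow> bool" where
  "stochastic_matrix p \<longleftrightarrow> (\<forall>i j. p i j \<ge> 0) \<and> (\<forall>i. (p i has_sum 1) UNIV)"

definition irreducible_matrix :: "('d \<Rightarrow> 'd \<Rightarrow> real) \<Rightarrow> bool" where
  "irreducible_matrix p \<longleftrightarrow>
     (\<forall>i j. \<exists>path. path \<noteq> [] \<and> hd path = i \<and> last path = j \<and>
        (\<forall>l. Suc l < length path \<longrightarrow> p (path ! l) (path ! Suc l) > 0))"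

definition stationary_irreducible_MC ::
  "'a measure \<Rightarrow> (int \<Rightarrow> 'a \<Rightarrow> 'd) \<Rightarrow> bool" where
  "stationary_irreducible_MC P X \<longleftrightarrow>
     (\<forall>n. X n \<in> measurable P (count_space UNIV)) \<and>
     (\<exists>(\<pi>::'d \<Rightarrow> real) (p::'d \<Rightarrow> 'd \<Rightarrow> real).
        stochastic_matrix p \<and> irreducible_matrix p \<and>
        (\<forall>(n::int) (path::'d list). path \<noteq> [] \<longrightarrow>
           measure P {\<omega> \<in> space P. \<forall>l < length path. X (n + int l) \<omega> = path ! l}
             = \<pi> (hd path) * (\<Prod>l < length path - 1. p (path ! l) (path ! Suc l))))"

text \<open>Stationary solution R = Q_0 + sum_{n>=1} Q_{-n} M_0 M_{-1} ... M_{-n+1},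
  with induced coefficients Q_n = Q_{n,X_n}, M_n = M_{n,X_n}.\<close>
definition perpetuity ::
  "(int \<Rightarrow> 'a \<Rightarrow> 'd) \<Rightarrow> (int \<Rightarrow> 'd \<Rightarrow> 'a \<Rightarrow> real) \<Rightarrow> (int \<Rightarrow> 'd \<Rightarrow> 'a \<Rightarrow> real) \<Rightarrow> 'a \<Rightarrow> real"
  where
  "perpetuity X Q M \<omega> =
     (\<Sum>n. Q (- int n) (X (- int n) \<omega>) \<omega> * (\<Prod>k<n. M (- int k) (X (- int k) \<omega>) \<omega>))"

definition rev_trans :: "'a measure \<Rightarrow> (int \<Rightarrow> 'a \<Rightarrow> 'd) \<Rightarrow> 'd \<Rightarrow> 'd \<Rightarrow> real" where
  "rev_trans P X i j =
     measure P {\<omega> \<in> space P. X 0 \<omega> = j \<and> X 1 \<omega> = i} / measure P {\<omega> \<in> space P. X 1 \<omega> = i}"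

definition Bb :: "('d \<Rightarrow> real) set" where
  "Bb = {f. bounded (range f)}"

end

theory Submission
  imports Defs
begin

text \<open>
  Fix \<open>j\<close> with \<open>q1 j > 0\<close>. The tail function \<open>F t = P(Q\<^sub>j > t) / q1 j\<close> is monotone, regularly
  varying of index \<open>-\<alpha>\<close> and asymptotic to \<open>t powr (-\<alpha>) * L t\<close>.
  Conditionally on \<open>X\<^sub>0 = i\<close> the perpetuity satisfies \<open>R = Q\<^sub>0 + M\<^sub>0 R'\<close>, where \<open>R'\<close> is independent of
  \<open>(Q\<^sub>0, M\<^sub>0)\<close> and its law is the mixture over \<open>j\<close>, with weights \<open>H(i,j)\<close>, of the laws of \<open>R\<close> given
  \<open>X\<^sub>0 = j\<close>.

  First, \<open>sup m\<^sub>i < 1\<close> and a uniform Breiman estimate give, by induction on the partial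
  sums of absolute values, a bound \<open>P(\<bar>R\<bar> > t | X\<^sub>0 = i) \<le> C * F t\<close> uniform in \<open>i\<close>; this also yields the
  almost sure convergence of the series. Second, the principle of a single big jump for \<open>Q + M Y\<close>
  shows that asymptotic upper (lower) bounds \<open>b\<^sub>i\<close> for \<open>P(R > t | X\<^sub>0 = i) / F t\<close> improve to \<open>q1 + G b\<close>.
  Since \<open>G\<close> is a contraction on bounded sequences, iterating from the crude bounds squeezes
  the limit to the fixed point \<open>K\<close>, which is positive by irreducibility.
\<close>

section \<open>Monotone regularly varying functions\<close>

text \<open>The functions \<open>L (c * t) / L t\<close> converge only pointwise in
  \<open>c\<close>, and \<open>L\<close> is an arbitrary real function, so uniform convergence and
  Potter bounds cannot be read off from it. For the monotone \<open>F\<close> both follow from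
  convergence at finitely many points. The second obstacle is the possibly infinite state space:
  eventual bounds for single states do not by themselves survive the average over
  \<open>H(i,j)\<close>. The crude bound, with constants free of \<open>i\<close>, provides the
  majorants, both for the law of the multiplier and for the sum over \<open>j\<close>. It has to
  reproduce itself with the same \<open>C\<close> and threshold; \<alpha>-moments below 1 make this
  possible, while the \<beta>-moments pay for multipliers so large that \<open>t\<close> divided by
  them falls below the threshold. Existence of a limit is not known in advance, hence upper and
  lower bounds are improved separately. As multipliers are positive, only the right tail of the
  previous value feeds the right tail of the product, which is why the single operator
  \<open>G\<close> governs the limit. Positivity of \<open>K\<close> matters because asymptotic
  equivalence to 0 would mean a tail that vanishes eventually.\<close>

locale regularly_varying_tail =
  fixes F :: "real \<Rightarrow> real" and \<alpha> B :: real
  assumes antimono_F: "antimono F"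
    and F_pos: "\<And>t. 0 < F t"
    and F_le: "\<And>t. F t \<le> B"
    and F_rv: "\<And>c. 0 < c \<Longrightarrow> ((\<lambda>t. F (c * t) / F t) \<longlongrightarrow> c powr - \<alpha>) at_top"
    and alpha_pos: "0 < \<alpha>"
begin

lemma F_mono: "s \<le> t \<Longrightarrow> F t \<le> F s"
  using antimono_F by (rule antimonoD)

lemma F_nonneg [simp]: "0 \<le> F t"
  using F_pos less_imp_le by blast

lemma F_borel [measurable]: "F \<in> borel_measurable borel"
proof -
  have "mono (\<lambda>x. - F x)"
    using F_mono by (auto intro: monoI)
  then have "(\<lambda>x. - (- F x)) \<in> borel_measurable borel"
    by (intro borel_measurable_uminus borel_measurable_mono)
  then show ?thesis by simp
qed

lemma rv_div:
  assumes "0 < \<theta>"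
  shows "((\<lambda>t. F (t / \<theta>) / F t) \<longlongrightarrow> \<theta> powr \<alpha>) at_top"
proof -
  have "(1 / \<theta>) powr - \<alpha> = \<theta> powr \<alpha>"
    using assms by (simp add: powr_minus powr_divide)
  with F_rv[of "1 / \<theta>"] assms show ?thesis by simp
qed

text \<open>Halving a large argument costs at most \<open>2 powr \<beta>\<close>, because the
  limiting factor \<open>2 powr \<alpha>\<close> is smaller. Iteration covers the powers of two and
  monotonicity the ratios in between; the leading \<open>2 powr \<beta>\<close> pays for rounding
  \<theta> up to the next power.\<close>

lemma potter:
  assumes "\<alpha> < \<beta>"
  obtains T where "0 < T"
    "\<And>t \<theta>. 1 \<le> \<theta> \<Longrightarrow> T \<le> t / \<theta> \<Longrightarrow> F (t / \<theta>) \<le> 2 powr \<beta> * \<theta> powr \<beta> * F t"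
proof -
  have "eventually (\<lambda>t. F (t / 2) / F t < 2 powr \<beta>) at_top"
    using assms by (intro order_tendstoD(2)[OF rv_div]) auto
  then obtain T0 where T0: "\<And>t. t \<ge> T0 \<Longrightarrow> F (t / 2) / F t < 2 powr \<beta>"
    by (auto simp: eventually_at_top_linorder)
  define T where "T = max T0 1"
  have T: "1 \<le> T" by (simp add: T_def)
  have half: "F (t / 2) \<le> 2 powr \<beta> * F t" if "t \<ge> T" for t
    using T0[of t] that F_pos[of t] by (simp add: T_def field_simps)
  have iter: "F (t / 2 ^ Suc k) \<le> (2 powr \<beta>) ^ Suc k * F t" if "T * 2 ^ k \<le> t" for t k
    using that
  proof (induction k arbitrary: t)
    case 0
    then show ?case using half[of t] by simp
  next
    case (Suc k)
    have *: "T * 2 ^ k \<le> t / 2" using Suc.prems by simp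
    have "T * 1 \<le> T * 2 ^ Suc k" using T by (intro mult_left_mono) (auto simp del: power_Suc)
    then have "T \<le> t" using Suc.prems by simp
    have "F (t / 2 ^ Suc (Suc k)) \<le> (2 powr \<beta>) ^ Suc k * F (t / 2)"
      using Suc.IH[OF *] by (simp add: field_simps)
    also have "\<dots> \<le> (2 powr \<beta>) ^ Suc k * (2 powr \<beta> * F t)"
      using half[OF \<open>T \<le> t\<close>] by (intro mult_left_mono) auto
    finally show ?case by (simp add: mult_ac)
  qed
  show ?thesis
  proof (rule that[of T])
    show "0 < T" using T by simp
    fix t \<theta> :: real assume l: "1 \<le> \<theta>" and t: "T \<le> t / \<theta>"
    define k where "k = nat \<lfloor>log 2 \<theta>\<rfloor>"
    have log0: "0 \<le> log 2 \<theta>" using l by simp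
    have k1: "real k \<le> log 2 \<theta>" and k2: "log 2 \<theta> \<le> real (Suc k)"
      using log0 unfolding k_def by linarith+
    have "2 powr real k \<le> \<theta>" using k1 l by (simp add: le_log_iff)
    then have le1: "2 ^ k \<le> \<theta>" by (simp add: powr_realpow)
    have "\<theta> \<le> 2 powr real (Suc k)" using k2 l by (simp add: log_le_iff)
    then have le2: "\<theta> \<le> 2 ^ Suc k" by (simp add: powr_realpow del: of_nat_Suc)
    have Tl: "T * \<theta> \<le> t" using t l by (simp add: field_simps)
    have "T * 2 ^ k \<le> T * \<theta>" using le1 T by (intro mult_left_mono) auto
    then have Tk: "T * 2 ^ k \<le> t" using Tl by simp
    have "0 \<le> T * \<theta>" using T l by simp
    then have "0 \<le> t" using Tl by linarith
    then have "t / 2 ^ Suc k \<le> t / \<theta>" using le2 l by (intro divide_left_mono) auto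
    then have "F (t / \<theta>) \<le> F (t / 2 ^ Suc k)" by (rule F_mono)
    also have "\<dots> \<le> (2 powr \<beta>) ^ Suc k * F t" by (rule iter[OF Tk])
    also have "(2 powr \<beta>) ^ Suc k = 2 powr \<beta> * (2 ^ k) powr \<beta>"
      by (simp add: powr_realpow[symmetric] powr_powr powr_powr_swap mult.commute)
    also have "\<dots> * F t \<le> 2 powr \<beta> * \<theta> powr \<beta> * F t"
      using le1 l assms alpha_pos by (intro mult_right_mono mult_left_mono powr_mono2) auto
    finally show "F (t / \<theta>) \<le> 2 powr \<beta> * \<theta> powr \<beta> * F t" .
  qed
qed

text \<open>When \<theta> is so large that \<open>t / \<theta>\<close> lies below the threshold, a
  tail can only be bounded by 1. Even 1 is then of order \<open>\<theta> powr \<beta> * F t\<close>: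
  \<open>potter\<close> compares \<open>F T\<close> with \<open>F t\<close> at the ratio
  \<open>t / T\<close>, which is at most \<theta>.\<close>

lemma lower_power_bound:
  assumes "\<alpha> < \<beta>"
  obtains T0 where "0 < T0"
    "\<And>T. T0 \<le> T \<Longrightarrow> \<exists>C\<ge>0. \<forall>t\<ge>T. \<forall>\<theta>>0. t / \<theta> \<le> T \<longrightarrow> 1 \<le> C * \<theta> powr \<beta> * F t"
proof -
  obtain T0 where T0: "0 < T0"
    and P: "\<And>t \<theta>. 1 \<le> \<theta> \<Longrightarrow> T0 \<le> t / \<theta> \<Longrightarrow> F (t / \<theta>) \<le> 2 powr \<beta> * \<theta> powr \<beta> * F t"
    using potter[OF assms] by metis
  show ?thesis
  proof (rule that[OF T0])
    fix T assume T: "T0 \<le> T"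
    show "\<exists>C\<ge>0. \<forall>t\<ge>T. \<forall>\<theta>>0. t / \<theta> \<le> T \<longrightarrow> 1 \<le> C * \<theta> powr \<beta> * F t"
    proof (intro exI[of _ "2 powr \<beta> / F T"] conjI allI impI)
      show "0 \<le> 2 powr \<beta> / F T" by simp
      fix t \<theta> :: real assume t: "T \<le> t" and l: "0 < \<theta>" and tl: "t / \<theta> \<le> T"
      have "F T = F (t / (t / T))" using T T0 t by simp
      also have "\<dots> \<le> 2 powr \<beta> * (t / T) powr \<beta> * F t"
        using T T0 t by (intro P) (auto simp: field_simps)
      also have "\<dots> \<le> 2 powr \<beta> * \<theta> powr \<beta> * F t"
        using tl l T T0 t assms alpha_pos
        by (intro mult_right_mono mult_left_mono powr_mono2) (auto simp: field_simps)
      finally show "1 \<le> 2 powr \<beta> / F T * \<theta> powr \<beta> * F t"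
        using F_pos[of T] by (simp add: field_simps)
    qed
  qed
qed

text \<open>The error terms are chosen so that they stay small after integration against a law with
  finite \<beta>-moment. Bounded \<theta> need uniform convergence; beyond a cut-off, a Potter bound
  with an exponent strictly between \<alpha> and \<beta> is already below
  \<open>\<delta> * \<theta> powr \<beta>\<close>.\<close>

lemma uniform_rv:
  assumes "\<alpha> < \<beta>" and "0 < \<delta>"
  obtains T0 where "0 < T0"
    "\<And>t \<theta>. 0 < \<theta> \<Longrightarrow> T0 \<le> t \<Longrightarrow> T0 \<le> t / \<theta> \<Longrightarrow>
       F (t / \<theta>) \<le> F t * (\<theta> powr \<alpha> + \<delta> + \<delta> * \<theta> powr \<beta>)"
proof -
  define \<gamma> where "\<gamma> = (\<alpha> + \<beta>) / 2"
  have g: "\<alpha> < \<gamma>" "\<gamma> < \<beta>" using assms by (auto simp: \<gamma>_def)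
  obtain T1 where T1: "0 < T1"
    and P: "\<And>t \<theta>. 1 \<le> \<theta> \<Longrightarrow> T1 \<le> t / \<theta> \<Longrightarrow> F (t / \<theta>) \<le> 2 powr \<gamma> * \<theta> powr \<gamma> * F t"
    using potter[OF g(1)] by metis
  \<comment> \<open>The second entry solves \<open>2 powr \<gamma> * K powr \<gamma> = \<delta> * K
    powr \<beta>\<close>; the maximum with 1 puts every \<open>\<theta> \<ge> K\<close> in the range
    of the Potter bound.\<close>
  define K where "K = max 1 ((2 powr \<gamma> / \<delta>) powr (1 / (\<beta> - \<gamma>)))"
  have K1: "1 \<le> K" by (simp add: K_def)
  have large: "2 powr \<gamma> * \<theta> powr \<gamma> \<le> \<delta> * \<theta> powr \<beta>" if "K \<le> \<theta>" for \<theta>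
  proof -
    have l: "1 \<le> \<theta>" using K1 that by simp
    have "2 powr \<gamma> / \<delta> = ((2 powr \<gamma> / \<delta>) powr (1 / (\<beta> - \<gamma>))) powr (\<beta> - \<gamma>)"
      using g assms by (simp add: powr_powr)
    also have "\<dots> \<le> \<theta> powr (\<beta> - \<gamma>)"
      using g that by (intro powr_mono2) (auto simp: K_def)
    finally have "2 powr \<gamma> \<le> \<delta> * \<theta> powr (\<beta> - \<gamma>)"
      using assms by (simp add: field_simps)
    then have "2 powr \<gamma> * \<theta> powr \<gamma> \<le> \<delta> * \<theta> powr (\<beta> - \<gamma>) * \<theta> powr \<gamma>"
      by (intro mult_right_mono) auto
    also have "\<dots> = \<delta> * \<theta> powr \<beta>"
      by (simp add: powr_add[symmetric])
    finally show ?thesis .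
  qed
  \<comment> \<open>As \<open>\<theta> \<mapsto> F (t / \<theta>)\<close> is monotone, for \<open>\<theta> \<le> K\<close> pointwise convergence at the
    finitely many points \<open>grid k\<close>, whose \<open>\<alpha>\<close>-th powers are \<open>d\<close> apart, is enough.\<close>
  define d where "d = \<delta> / 2"
  have d: "0 < d" using assms by (simp add: d_def)
  define n where "n = nat \<lceil>K powr \<alpha> / d\<rceil>"
  define grid where "grid k = (real (Suc k) * d) powr (1 / \<alpha>)" for k
  have grid: "0 < grid k" "grid k powr \<alpha> = real (Suc k) * d" for k
  proof -
    have "0 < real (Suc k) * d" using d by simp
    then show "0 < grid k" "grid k powr \<alpha> = real (Suc k) * d"
      using alpha_pos d unfolding grid_def by (simp_all add: powr_powr)
  qed
  have "\<forall>k\<in>{..n}. eventually (\<lambda>t. F (t / grid k) / F t < real (Suc k) * d + d) at_top"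
  proof
    fix k
    show "eventually (\<lambda>t. F (t / grid k) / F t < real (Suc k) * d + d) at_top"
      using grid[of k] d by (intro order_tendstoD(2)[OF rv_div]) auto
  qed
  then have "eventually (\<lambda>t. \<forall>k\<in>{..n}. F (t / grid k) / F t < real (Suc k) * d + d) at_top"
    by (intro eventually_ball_finite) auto
  then obtain T2 where T2:
    "\<And>t k. T2 \<le> t \<Longrightarrow> k \<le> n \<Longrightarrow> F (t / grid k) / F t < real (Suc k) * d + d"
    by (auto simp: eventually_at_top_linorder)
  show ?thesis
  proof (rule that[of "max T1 T2"])
    show "0 < max T1 T2" using T1 by simp
    fix t \<theta> :: real
    assume l: "0 < \<theta>" and t: "max T1 T2 \<le> t" and tl: "max T1 T2 \<le> t / \<theta>"
    show "F (t / \<theta>) \<le> F t * (\<theta> powr \<alpha> + \<delta> + \<delta> * \<theta> powr \<beta>)"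
    proof (cases "\<theta> \<le> K")
      case True
      define k where "k = nat \<lfloor>\<theta> powr \<alpha> / d\<rfloor>"
      have q0: "0 \<le> \<theta> powr \<alpha> / d" using d by simp
      have k1: "real k \<le> \<theta> powr \<alpha> / d" and k2: "\<theta> powr \<alpha> / d \<le> real (Suc k)"
        using q0 unfolding k_def by linarith+
      have "\<theta> powr \<alpha> / d \<le> K powr \<alpha> / d"
        using True l alpha_pos d by (intro divide_right_mono powr_mono2) auto
      then have "k \<le> n" using k1 unfolding n_def by linarith
      have "\<theta> = (\<theta> powr \<alpha>) powr (1 / \<alpha>)" using l alpha_pos by (simp add: powr_powr)
      also have "\<dots> \<le> grid k"
        unfolding grid_def using k2 d alpha_pos by (intro powr_mono2) (auto simp: field_simps)
      finally have "\<theta> \<le> grid k" .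
      then have "t / grid k \<le> t / \<theta>"
        using l t T1 grid[of k] by (intro divide_left_mono) auto
      then have "F (t / \<theta>) \<le> F (t / grid k)" by (rule F_mono)
      also have "\<dots> \<le> F t * (real (Suc k) * d + d)"
        using T2[of t k] t \<open>k \<le> n\<close> F_pos[of t] by (simp add: field_simps)
      also have "\<dots> \<le> F t * (\<theta> powr \<alpha> + \<delta> + \<delta> * \<theta> powr \<beta>)"
      proof (rule mult_left_mono)
        have "real k * d \<le> \<theta> powr \<alpha>" using k1 d by (simp add: field_simps)
        moreover have "0 \<le> \<delta> * \<theta> powr \<beta>" using assms by simp
        \<comment> \<open>Two allowances of size \<open>d\<close> are spent, one for rounding
          \<theta> up to the grid and one for the convergence at the grid point; this is why
          \<open>d\<close> is half of \<delta>.\<close>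
        moreover have "real (Suc k) * d + d = real k * d + \<delta>"
          by (simp add: d_def field_simps)
        ultimately show "real (Suc k) * d + d \<le> \<theta> powr \<alpha> + \<delta> + \<delta> * \<theta> powr \<beta>" by linarith
      qed simp
      finally show ?thesis .
    next
      case False
      then have "F (t / \<theta>) \<le> 2 powr \<gamma> * \<theta> powr \<gamma> * F t"
        using K1 tl by (intro P) auto
      also have "\<dots> \<le> (\<delta> * \<theta> powr \<beta>) * F t"
        using large False by (intro mult_right_mono) auto
      also have "\<dots> \<le> (\<theta> powr \<alpha> + \<delta> + \<delta> * \<theta> powr \<beta>) * F t"
        using assms by (intro mult_right_mono) auto
      finally show ?thesis by (simp add: mult.commute)
    qed
  qed
qed

text \<open>This is the majorant for all later dominated convergence arguments. Three ranges are
  treated: \<open>t / \<theta>\<close> below the threshold by \<open>lower_power_bound\<close>,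
  \<theta> at least 1 by \<open>potter\<close>, and \<theta> below 1 by monotonicity of
  \<open>F\<close>.\<close>

lemma dominate:
  assumes "\<alpha> < \<beta>" and g_le: "\<And>s. g s \<le> D" and g_F: "\<And>s. T1 \<le> s \<Longrightarrow> g s \<le> C * F s"
    and C: "0 \<le> C" and D: "0 \<le> D"
  obtains T E where "0 < T" "0 \<le> E"
    "\<And>t \<theta>. T \<le> t \<Longrightarrow> 0 < \<theta> \<Longrightarrow> g (t / \<theta>) \<le> E * (1 + \<theta> powr \<beta>) * F t"
proof -
  obtain T0 where T0: "0 < T0"
    and P: "\<And>t \<theta>. 1 \<le> \<theta> \<Longrightarrow> T0 \<le> t / \<theta> \<Longrightarrow> F (t / \<theta>) \<le> 2 powr \<beta> * \<theta> powr \<beta> * F t"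
    using potter[OF assms(1)] by metis
  obtain T2 where T2: "0 < T2"
    and *: "\<And>T. T2 \<le> T \<Longrightarrow> \<exists>C\<ge>0. \<forall>t\<ge>T. \<forall>\<theta>>0. t / \<theta> \<le> T \<longrightarrow> 1 \<le> C * \<theta> powr \<beta> * F t"
    using lower_power_bound[OF assms(1)] by metis
  define T where "T = max T0 (max T1 T2)"
  have T: "T0 \<le> T" "T1 \<le> T" "T2 \<le> T" by (auto simp: T_def)
  obtain c where c: "0 \<le> c"
    and low: "\<And>t \<theta>. T \<le> t \<Longrightarrow> 0 < \<theta> \<Longrightarrow> t / \<theta> \<le> T \<Longrightarrow> 1 \<le> c * \<theta> powr \<beta> * F t"
    using *[OF T(3)] by auto
  define E where "E = C + C * 2 powr \<beta> + D * c"
  have E: "0 \<le> E" "C \<le> E" "C * 2 powr \<beta> \<le> E" "D * c \<le> E" using C D c by (auto simp: E_def)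
  show ?thesis
  proof (rule that[of T E])
    show "0 < T" using T T0 by simp
    show "0 \<le> E" by fact
    fix t \<theta> :: real assume t: "T \<le> t" and l: "0 < \<theta>"
    have R: "x * F t \<le> E * (1 + \<theta> powr \<beta>) * F t" if "x \<le> E \<or> x \<le> E * \<theta> powr \<beta>" for x
    proof (rule mult_right_mono)
      have "0 \<le> E * \<theta> powr \<beta>" using E by simp
      then show "x \<le> E * (1 + \<theta> powr \<beta>)" using that E(1) unfolding distrib_left by linarith
    qed simp
    show "g (t / \<theta>) \<le> E * (1 + \<theta> powr \<beta>) * F t"
    proof (cases "t / \<theta> \<le> T")
      case True
      have "g (t / \<theta>) \<le> D * 1" using g_le by simp
      also have "\<dots> \<le> D * (c * \<theta> powr \<beta> * F t)"
        using low[OF t l True] D by (rule mult_left_mono)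
      also have "\<dots> = (D * c * \<theta> powr \<beta>) * F t" by simp
      also have "\<dots> \<le> E * (1 + \<theta> powr \<beta>) * F t"
        using E by (intro R disjI2 mult_right_mono) auto
      finally show ?thesis .
    next
      case False
      then have g: "g (t / \<theta>) \<le> C * F (t / \<theta>)" using T by (intro g_F) auto
      show ?thesis
      proof (cases "1 \<le> \<theta>")
        case True
        have "C * F (t / \<theta>) \<le> C * (2 powr \<beta> * \<theta> powr \<beta> * F t)"
          using False T True by (intro mult_left_mono[OF _ C] P) auto
        also have "\<dots> = (C * 2 powr \<beta> * \<theta> powr \<beta>) * F t" by simp
        also have "\<dots> \<le> E * (1 + \<theta> powr \<beta>) * F t"
          using E by (intro R disjI2 mult_right_mono) auto
        finally show ?thesis using g by simp
      next
        case False
        have "0 < T" using T T0 by simp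
        then have "0 < t" using t by simp
        then have "t \<le> t / \<theta>" using False l by (simp add: field_simps)
        then have "C * F (t / \<theta>) \<le> C * F t" using C by (intro mult_left_mono F_mono)
        also have "\<dots> \<le> E * (1 + \<theta> powr \<beta>) * F t" using E by (intro R disjI1) auto
        finally show ?thesis using g by simp
      qed
    qed
  qed
qed

end

section \<open>Tails of products and of affine transforms\<close>

lemma antimono_borel_measurable:
  fixes g :: "real \<Rightarrow> real"
  assumes "\<And>s t. s \<le> t \<Longrightarrow> g t \<le> g s"
  shows "g \<in> borel_measurable borel"
proof -
  have "mono (\<lambda>x. - g x)"
    using assms by (auto intro: monoI)
  then have "(\<lambda>x. - (- g x)) \<in> borel_measurable borel"
    by (intro borel_measurable_uminus borel_measurable_mono)
  then show ?thesis by simp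
qed

text \<open>The laws of the coefficient pairs live on \<open>borel\<close> of the product type,
  which \<open>borel_prod\<close> identifies with the product of the two Borel algebras.\<close>

lemma measurable_fst_borel [measurable]: "fst \<in> borel_measurable (borel :: (real \<times> real) measure)"
  unfolding borel_prod[symmetric] by simp

lemma measurable_snd_borel [measurable]: "snd \<in> borel_measurable (borel :: (real \<times> real) measure)"
  unfolding borel_prod[symmetric] by simp

lemma measure_pair_slice:
  assumes "prob_space M" "prob_space N" and S: "S \<in> sets (M \<Otimes>\<^sub>M N)"
  shows "integrable M (\<lambda>x. measure N (Pair x -` S))"
    and "measure (M \<Otimes>\<^sub>M N) S = (\<integral>x. measure N (Pair x -` S) \<partial>M)"
proof -
  interpret M: prob_space M by fact
  interpret N: prob_space N by fact
  have m: "(\<lambda>x. measure N (Pair x -` S)) \<in> borel_measurable M"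
    unfolding measure_def using N.measurable_emeasure_Pair[OF S] by measurable
  show int: "integrable M (\<lambda>x. measure N (Pair x -` S))"
    by (rule M.integrable_const_bound[where B = 1]) (use m in auto)
  have "emeasure (M \<Otimes>\<^sub>M N) S = (\<integral>\<^sup>+x. ennreal (measure N (Pair x -` S)) \<partial>M)"
    by (simp add: N.emeasure_pair_measure_alt[OF S] N.emeasure_eq_measure)
  also have "\<dots> = ennreal (\<integral>x. measure N (Pair x -` S) \<partial>M)"
    by (rule nn_integral_eq_integral[OF int]) auto
  finally show "measure (M \<Otimes>\<^sub>M N) S = (\<integral>x. measure N (Pair x -` S) \<partial>M)"
    unfolding measure_def[of "M \<Otimes>\<^sub>M N"] by (simp add: integral_nonneg_AE)
qed

lemma eventually_le_scale:
  fixes f g :: "'x \<Rightarrow> real"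
  assumes "((\<lambda>t. f t / g t) \<longlongrightarrow> l) F" "l < b" "\<And>t. 0 < g t"
  shows "eventually (\<lambda>t. f t \<le> b * g t) F"
  using order_tendstoD(2)[OF assms(1,2)]
  by eventually_elim (use assms(3) in \<open>simp add: divide_less_eq less_imp_le\<close>)

lemma eventually_ge_scale:
  fixes f g :: "'x \<Rightarrow> real"
  assumes "((\<lambda>t. f t / g t) \<longlongrightarrow> l) F" "b < l" "\<And>t. 0 < g t"
  shows "eventually (\<lambda>t. b * g t \<le> f t) F"
  using order_tendstoD(1)[OF assms(1,2)]
  by eventually_elim (use assms(3) in \<open>simp add: less_divide_eq less_imp_le\<close>)

section \<open>Breiman's lemma: a regularly varying tail averaged over a random scale\<close>

locale breiman = regularly_varying_tail F \<alpha> B + prob_space N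
  for F :: "real \<Rightarrow> real" and \<alpha> B :: real and N :: "'c measure" +
  fixes \<Theta> :: "'c \<Rightarrow> real" and \<beta> :: real
  assumes \<Theta>_measurable [measurable]: "\<Theta> \<in> borel_measurable N"
    and \<Theta>_pos: "AE x in N. 0 < \<Theta> x"
    and \<Theta>_int: "integrable N (\<lambda>x. \<Theta> x powr \<beta>)"
    and beta: "\<alpha> < \<beta>"
begin

text \<open>Dominated convergence with the integrable majorant
  \<open>E * (1 + \<Theta> x powr \<beta>)\<close> from \<open>dominate\<close>. It is applied with
  \<open>g\<close> a tail function or a multiple of \<open>F\<close>.\<close>

lemma limit:
  assumes g_le: "\<And>s. g s \<le> D" and g_F: "\<And>s. T1 \<le> s \<Longrightarrow> g s \<le> C * F s"
    and C: "0 \<le> C" and D: "0 \<le> D"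
    and [measurable]: "\<And>t. h t \<in> borel_measurable N" "h' \<in> borel_measurable N"
    and lim: "AE x in N. ((\<lambda>t. h t x) \<longlongrightarrow> h' x) at_top"
    and bound: "\<And>t x. \<bar>h t x\<bar> \<le> g (t / \<Theta> x) / F t"
  shows "((\<lambda>t. \<integral>x. h t x \<partial>N) \<longlongrightarrow> (\<integral>x. h' x \<partial>N)) at_top"
proof -
  obtain T E where T: "0 < T" "0 \<le> E"
    and dom: "\<And>t \<theta>. T \<le> t \<Longrightarrow> 0 < \<theta> \<Longrightarrow> g (t / \<theta>) \<le> E * (1 + \<theta> powr \<beta>) * F t"
    using dominate[OF beta g_le g_F C D] by metis
  show ?thesis
  proof (rule integral_dominated_convergence_at_top[where w = "\<lambda>x. E * (1 + \<Theta> x powr \<beta>)"])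
    show "integrable N (\<lambda>x. E * (1 + \<Theta> x powr \<beta>))"
      using \<Theta>_int by auto
    show "\<forall>\<^sub>F t in at_top. AE x in N. norm (h t x) \<le> E * (1 + \<Theta> x powr \<beta>)"
      using eventually_ge_at_top[of T]
    proof eventually_elim
      case (elim t)
      show ?case
        using \<Theta>_pos
      proof eventually_elim
        case x: (elim x)
        have "norm (h t x) \<le> g (t / \<Theta> x) / F t" using bound by simp
        also have "\<dots> \<le> (E * (1 + \<Theta> x powr \<beta>) * F t) / F t"
          by (intro divide_right_mono dom elim x) auto
        also have "\<dots> = E * (1 + \<Theta> x powr \<beta>)" using F_pos[of t] by simp
        finally show ?case .
      qed
    qed
  qed (use lim in auto)
qed

lemma limit_F: "((\<lambda>t. \<integral>x. F (t / \<Theta> x) / F t \<partial>N) \<longlongrightarrow> (\<integral>x. \<Theta> x powr \<alpha> \<partial>N)) at_top"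
proof (rule limit[where g = F and C = 1 and D = B and ?T1.0 = 0])
  show "0 \<le> B" using F_le[of 0] F_nonneg[of 0] by linarith
  show "AE x in N. ((\<lambda>t. F (t / \<Theta> x) / F t) \<longlongrightarrow> \<Theta> x powr \<alpha>) at_top"
    using \<Theta>_pos by eventually_elim (rule rv_div)
qed (auto simp: F_le)

lemma filterlim_div:
  assumes "0 < \<theta>" shows "filterlim (\<lambda>t. t / \<theta>) at_top (at_top :: real filter)"
  using assms filterlim_tendsto_pos_mult_at_top[OF tendsto_const, of "1 / \<theta>" "\<lambda>t. t" at_top]
  by (auto simp: filterlim_ident)

lemma integrable_bounded:
  assumes [measurable]: "g \<in> borel_measurable borel" and "\<And>s. 0 \<le> g s" "\<And>s. g s \<le> D"
  shows "integrable N (\<lambda>x. g (t / \<Theta> x) / F t)"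
proof (rule integrable_const_bound[where B = "D / F t"])
  show "AE x in N. norm (g (t / \<Theta> x) / F t) \<le> D / F t"
    using assms by (auto intro!: divide_right_mono)
qed measurable

text \<open>Write \<open>g\<close> as at most \<open>a * F\<close> plus the positive part of
  \<open>g - a * F\<close>. The first term is handled by \<open>limit_F\<close>. For fixed
  \<open>x\<close> the second vanishes at \<open>t / \<Theta> x\<close> as soon as \<open>t\<close>
  is large, so its integral is negligible against \<open>F t\<close>.\<close>

lemma upper:
  assumes [measurable]: "g \<in> borel_measurable borel" and g: "\<And>s. 0 \<le> g s" "\<And>s. g s \<le> 1"
    and ev: "eventually (\<lambda>s. g s \<le> a * F s) at_top" and a: "0 \<le> a"
    and b: "a * (\<integral>x. \<Theta> x powr \<alpha> \<partial>N) < b"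
  shows "eventually (\<lambda>t. (\<integral>x. g (t / \<Theta> x) \<partial>N) \<le> b * F t) at_top"
proof -
  obtain T1 where T1: "\<And>s. T1 \<le> s \<Longrightarrow> g s \<le> a * F s"
    using ev by (auto simp: eventually_at_top_linorder)
  define h where "h t x = max 0 (g (t / \<Theta> x) - a * F (t / \<Theta> x)) / F t" for t x
  have hb: "0 \<le> h t x" "h t x \<le> g (t / \<Theta> x) / F t" for t x
    using g a unfolding h_def by (auto intro!: divide_right_mono)
  have [measurable]: "h t \<in> borel_measurable N" for t unfolding h_def by measurable
  have "((\<lambda>t. \<integral>x. h t x \<partial>N) \<longlongrightarrow> (\<integral>x. 0 \<partial>N)) at_top"
  proof (rule limit[where g = g and C = a and D = 1 and ?T1.0 = T1])
    show "AE x in N. ((\<lambda>t. h t x) \<longlongrightarrow> 0) at_top"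
      using \<Theta>_pos
    proof eventually_elim
      case (elim x)
      have "eventually (\<lambda>t. g (t / \<Theta> x) \<le> a * F (t / \<Theta> x)) at_top"
        by (rule eventually_compose_filterlim[OF ev filterlim_div[OF elim]])
      then show ?case
        by (intro tendsto_eventually) (auto elim!: eventually_mono simp: h_def)
    qed
    show "\<bar>h t x\<bar> \<le> g (t / \<Theta> x) / F t" for t x using hb[of t x] by linarith
  qed (use a g T1 in auto)
  then have "((\<lambda>t. a * (\<integral>x. F (t / \<Theta> x) / F t \<partial>N) + (\<integral>x. h t x \<partial>N)) \<longlongrightarrow>
      a * (\<integral>x. \<Theta> x powr \<alpha> \<partial>N) + 0) at_top"
    by (intro tendsto_intros limit_F) simp
  from order_tendstoD(2)[OF this, of b] b
  have "eventually (\<lambda>t. a * (\<integral>x. F (t / \<Theta> x) / F t \<partial>N) + (\<integral>x. h t x \<partial>N) < b) at_top" by simp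
  then show ?thesis
  proof eventually_elim
    case (elim t)
    have intg: "integrable N (\<lambda>x. g (t / \<Theta> x) / F t)"
      using g by (intro integrable_bounded) auto
    have intF: "integrable N (\<lambda>x. F (t / \<Theta> x) / F t)"
      by (rule integrable_bounded[where D = B]) (auto simp: F_le)
    note intaF = integrable_mult_right[OF intF, of a]
    have inth: "integrable N (h t)"
      proof (rule Bochner_Integration.integrable_bound[OF intg])
      have "norm (h t x) \<le> norm (g (t / \<Theta> x) / F t)" for x
        using hb[of t x] unfolding real_norm_def by linarith
      then show "AE x in N. norm (h t x) \<le> norm (g (t / \<Theta> x) / F t)" by simp
    qed simp
    have "(\<integral>x. g (t / \<Theta> x) \<partial>N) / F t = (\<integral>x. g (t / \<Theta> x) / F t \<partial>N)" by simp
    also have "\<dots> \<le> (\<integral>x. a * (F (t / \<Theta> x) / F t) + h t x \<partial>N)"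
    proof (rule integral_mono)
      show "integrable N (\<lambda>x. a * (F (t / \<Theta> x) / F t) + h t x)"
        using Bochner_Integration.integrable_add[OF intaF inth] .
      show "g (t / \<Theta> x) / F t \<le> a * (F (t / \<Theta> x) / F t) + h t x" for x
        unfolding h_def using F_pos[of t] by (simp add: field_simps)
    qed fact
    also have "\<dots> = a * (\<integral>x. F (t / \<Theta> x) / F t \<partial>N) + (\<integral>x. h t x \<partial>N)"
      using Bochner_Integration.integral_add[OF intaF inth] by simp
    finally have "(\<integral>x. g (t / \<Theta> x) \<partial>N) / F t \<le> b" using elim by simp
    then show ?case using F_pos[of t] by (simp add: divide_le_eq)
  qed
qed

text \<open>Mirror image of \<open>upper\<close>: here the negligible correction is the positive
  part of \<open>a * F - g\<close>, and its majorant comes from \<open>a * F\<close> instead of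
  \<open>g\<close>.\<close>

lemma lower:
  assumes [measurable]: "g \<in> borel_measurable borel" and g: "\<And>s. 0 \<le> g s" "\<And>s. g s \<le> 1"
    and ev: "eventually (\<lambda>s. a * F s \<le> g s) at_top" and a: "0 \<le> a"
    and b: "b < a * (\<integral>x. \<Theta> x powr \<alpha> \<partial>N)"
  shows "eventually (\<lambda>t. b * F t \<le> (\<integral>x. g (t / \<Theta> x) \<partial>N)) at_top"
proof -
  have B0: "0 \<le> B" using F_le[of 0] F_nonneg[of 0] by linarith
  define h where "h t x = max 0 (a * F (t / \<Theta> x) - g (t / \<Theta> x)) / F t" for t x
  have hb: "0 \<le> h t x" "h t x \<le> a * F (t / \<Theta> x) / F t" for t x
    using g a unfolding h_def by (auto intro!: divide_right_mono)
  have [measurable]: "h t \<in> borel_measurable N" for t unfolding h_def by measurable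
  have "((\<lambda>t. \<integral>x. h t x \<partial>N) \<longlongrightarrow> (\<integral>x. 0 \<partial>N)) at_top"
  proof (rule limit[where g = "\<lambda>s. a * F s" and C = a and D = "a * B" and ?T1.0 = 0])
    show "AE x in N. ((\<lambda>t. h t x) \<longlongrightarrow> 0) at_top"
      using \<Theta>_pos
    proof eventually_elim
      case (elim x)
      have "eventually (\<lambda>t. a * F (t / \<Theta> x) \<le> g (t / \<Theta> x)) at_top"
        by (rule eventually_compose_filterlim[OF ev filterlim_div[OF elim]])
      then show ?case
        by (intro tendsto_eventually) (auto elim!: eventually_mono simp: h_def)
    qed
    show "\<bar>h t x\<bar> \<le> a * F (t / \<Theta> x) / F t" for t x using hb[of t x] by linarith
  qed (use a B0 in \<open>auto intro!: mult_left_mono F_le\<close>)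
  then have "((\<lambda>t. a * (\<integral>x. F (t / \<Theta> x) / F t \<partial>N) - (\<integral>x. h t x \<partial>N)) \<longlongrightarrow>
      a * (\<integral>x. \<Theta> x powr \<alpha> \<partial>N) - 0) at_top"
    by (intro tendsto_intros limit_F) simp
  from order_tendstoD(1)[OF this, of b] b
  have "eventually (\<lambda>t. b < a * (\<integral>x. F (t / \<Theta> x) / F t \<partial>N) - (\<integral>x. h t x \<partial>N)) at_top" by simp
  then show ?thesis
  proof eventually_elim
    case (elim t)
    have intg: "integrable N (\<lambda>x. g (t / \<Theta> x) / F t)"
      using g by (intro integrable_bounded) auto
    have intF: "integrable N (\<lambda>x. F (t / \<Theta> x) / F t)"
      by (rule integrable_bounded[where D = B]) (auto simp: F_le)
    have intF': "integrable N (\<lambda>x. a * F (t / \<Theta> x) / F t)"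
      using integrable_mult_right[OF intF, of a] by simp
    note intaF = integrable_mult_right[OF intF, of a]
    have inth: "integrable N (h t)"
      proof (rule Bochner_Integration.integrable_bound[OF intF'])
      have "norm (h t x) \<le> norm (a * F (t / \<Theta> x) / F t)" for x
        using hb[of t x] unfolding real_norm_def by linarith
      then show "AE x in N. norm (h t x) \<le> norm (a * F (t / \<Theta> x) / F t)" by simp
    qed simp
    have "a * (\<integral>x. F (t / \<Theta> x) / F t \<partial>N) - (\<integral>x. h t x \<partial>N)
        = (\<integral>x. a * (F (t / \<Theta> x) / F t) - h t x \<partial>N)"
      using Bochner_Integration.integral_diff[OF intaF inth] by simp
    also have "\<dots> \<le> (\<integral>x. g (t / \<Theta> x) / F t \<partial>N)"
    proof (rule integral_mono)
      show "integrable N (\<lambda>x. a * (F (t / \<Theta> x) / F t) - h t x)"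
        using Bochner_Integration.integrable_diff[OF intaF inth] .
      show "a * (F (t / \<Theta> x) / F t) - h t x \<le> g (t / \<Theta> x) / F t" for x
      proof -
        have "a * F (t / \<Theta> x) - max 0 (a * F (t / \<Theta> x) - g (t / \<Theta> x)) \<le> g (t / \<Theta> x)"
          by simp
        from divide_right_mono[OF this, of "F t"] show ?thesis
          by (simp add: h_def diff_divide_distrib)
      qed
    qed fact
    also have "\<dots> = (\<integral>x. g (t / \<Theta> x) \<partial>N) / F t" by simp
    finally have "b \<le> (\<integral>x. g (t / \<Theta> x) \<partial>N) / F t" using elim by simp
    then show ?case using F_pos[of t] by (simp add: le_divide_eq)
  qed
qed

text \<open>Each point leaves \<open>A t\<close> eventually, so the integrand is eventually 0 at
  every point while \<open>dominate\<close> still bounds it after division by \<open>F t\<close>.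
  This is what makes two simultaneous large jumps negligible.\<close>

lemma vanishing:
  assumes [measurable]: "g \<in> borel_measurable borel" and g: "\<And>s. 0 \<le> g s" "\<And>s. g s \<le> 1"
    and ev: "eventually (\<lambda>s. g s \<le> C * F s) at_top" and C: "0 \<le> C"
    and [measurable]: "\<And>t. A t \<in> sets N"
    and A: "\<And>x. eventually (\<lambda>t. x \<notin> A t) at_top"
  shows "((\<lambda>t. (\<integral>x. indicator (A t) x * g (t / \<Theta> x) \<partial>N) / F t) \<longlongrightarrow> 0) at_top"
proof -
  obtain T1 where T1: "\<And>s. T1 \<le> s \<Longrightarrow> g s \<le> C * F s"
    using ev by (auto simp: eventually_at_top_linorder)
  have "((\<lambda>t. \<integral>x. indicator (A t) x * g (t / \<Theta> x) / F t \<partial>N) \<longlongrightarrow> (\<integral>x. 0 \<partial>N)) at_top"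
  proof (rule limit[where g = g and C = C and D = 1 and ?T1.0 = T1])
    show "AE x in N. ((\<lambda>t. indicator (A t) x * g (t / \<Theta> x) / F t) \<longlongrightarrow> 0) at_top"
    proof (rule AE_I2)
      fix x
      show "((\<lambda>t. indicator (A t) x * g (t / \<Theta> x) / F t) \<longlongrightarrow> 0) at_top"
        by (rule tendsto_eventually) (use A[of x] in \<open>auto elim!: eventually_mono\<close>)
    qed
    show "\<bar>indicator (A t) x * g (t / \<Theta> x) / F t\<bar> \<le> g (t / \<Theta> x) / F t" for t x
      using g[of "t / \<Theta> x"] by (auto simp: indicator_def)
  qed (use C g T1 in auto)
  then show ?thesis by simp
qed

end

section \<open>A tail bound that reproduces itself under a random affine map\<close>

context regularly_varying_tail
begin

text \<open>The same \<open>C\<close> and \<open>T\<close> occur in the hypothesis on \<open>\<nu>\<close> and in the conclusion, so the bound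
  can be iterated along the partial sums of the perpetuity.\<close>

lemma affine_tail_uniform:
  assumes beta: "\<alpha> < \<beta>" and c: "c < 1" and C1: "0 \<le> C1"
  obtains C T where "0 \<le> C" "0 < T"
    "\<And>\<mu> \<nu> t. \<lbrakk>prob_space \<mu>; sets \<mu> = sets (borel :: (real \<times> real) measure);
       prob_space \<nu>; sets \<nu> = sets (borel :: real measure); AE w in \<mu>. 0 < snd w;
       (\<integral>w. snd w powr \<alpha> \<partial>\<mu>) \<le> c; integrable \<mu> (\<lambda>w. snd w powr \<alpha>);
       integrable \<mu> (\<lambda>w. snd w powr \<beta>); (\<integral>w. snd w powr \<beta> \<partial>\<mu>) \<le> D;
       \<And>s. T1 \<le> s \<Longrightarrow> measure \<mu> {w. s < \<bar>fst w\<bar>} \<le> C1 * F s;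
       \<And>s. T \<le> s \<Longrightarrow> measure \<nu> {s<..} \<le> C * F s; T \<le> t\<rbrakk>
     \<Longrightarrow> measure (\<mu> \<Otimes>\<^sub>M \<nu>) {z. t < \<bar>fst (fst z)\<bar> + snd (fst z) * snd z} \<le> C * F t"
proof -
  define D' where "D' = max D 0"
  define c' where "c' = max c 0"
  have D': "0 \<le> D'" "D \<le> D'" and c': "0 \<le> c'" "c' < 1" "c \<le> c'" using c by (auto simp: D'_def c'_def)
  \<comment> \<open>At \<open>e = 1\<close> the expression equals \<open>c' < 1\<close>, so by
    continuity some \<open>e < 1\<close> still keeps it below 1. The gap \<open>1 - e\<close> is
    used twice: as the share of \<open>t\<close> granted to the additive term and as the error
    \<delta> of \<open>uniform_rv\<close>.\<close>
  have "((\<lambda>e. c' * e powr - \<alpha> + (1 - e) * (1 + D' * e powr - \<beta>)) \<longlongrightarrow>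
      c' * 1 powr - \<alpha> + (1 - 1) * (1 + D' * 1 powr - \<beta>)) (at_left 1)"
    by (intro tendsto_intros) auto
  then have "eventually (\<lambda>e. c' * e powr - \<alpha> + (1 - e) * (1 + D' * e powr - \<beta>) < 1) (at_left 1)"
    using c' by (intro order_tendstoD(2)) auto
  moreover have "eventually (\<lambda>e::real. e \<in> {0<..<1}) (at_left 1)"
    by (rule eventually_at_left_real) simp
  ultimately have "eventually (\<lambda>e. c' * e powr - \<alpha> + (1 - e) * (1 + D' * e powr - \<beta>) < 1 \<and> e \<in> {0<..<1}) (at_left (1::real))"
    by eventually_elim simp
  then obtain e :: real where e: "0 < e" "e < 1"
    and e1: "c' * e powr - \<alpha> + (1 - e) * (1 + D' * e powr - \<beta>) < 1"
    using eventually_happens[of _ "at_left (1::real)"] by auto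
  define \<delta> where "\<delta> = 1 - e"
  \<comment> \<open>The event splits at \<open>\<delta> * t\<close> and \<open>e * t\<close>; the second part reproduces \<open>C * F t\<close> with a factor
    \<open>\<rho> < 1\<close>, the rest contributes \<open>A * F t\<close>, and \<open>C\<close> solves \<open>A + C * \<rho> = C\<close>.\<close>
  define \<rho> where "\<rho> = c' * e powr - \<alpha> + \<delta> * (1 + D' * e powr - \<beta>)"
  have d: "0 < \<delta>" and rho: "\<rho> < 1" using e e1 by (auto simp: \<delta>_def \<rho>_def)
  obtain T2 where T2: "0 < T2" and U: "\<And>t \<theta>. 0 < \<theta> \<Longrightarrow> T2 \<le> t \<Longrightarrow> T2 \<le> t / \<theta> \<Longrightarrow>
       F (t / \<theta>) \<le> F t * (\<theta> powr \<alpha> + \<delta> + \<delta> * \<theta> powr \<beta>)"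
    using uniform_rv[OF beta d] by metis
  obtain T3 where T3: "0 < T3" and
    low: "\<And>T. T3 \<le> T \<Longrightarrow> \<exists>C\<ge>0. \<forall>t\<ge>T. \<forall>\<theta>>0. t / \<theta> \<le> T \<longrightarrow> 1 \<le> C * \<theta> powr \<beta> * F t"
    using lower_power_bound[OF beta] by metis
  have "eventually (\<lambda>t. F (\<delta> * t) \<le> (\<delta> powr - \<alpha> + 1) * F t) at_top"
    by (rule eventually_le_scale[OF F_rv[OF d]]) (auto simp: F_pos)
  then obtain T4 where T4: "\<And>t. T4 \<le> t \<Longrightarrow> F (\<delta> * t) \<le> (\<delta> powr - \<alpha> + 1) * F t"
    by (auto simp: eventually_at_top_linorder)
  \<comment> \<open>The entry \<open>\<bar>T1\<bar> / \<delta>\<close> brings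
    \<open>\<delta> * t\<close> into the range of the hypothesis on the additive term. The constant
    \<open>E\<close> obtained next depends on \<open>T\<close> but not on \<open>C\<close>, so
    \<open>C\<close> can be chosen last without circularity.\<close>
  define T where "T = max (max T2 T3) (max T4 (\<bar>T1\<bar> / \<delta>))"
  have T: "T2 \<le> T" "T3 \<le> T" "T4 \<le> T" "\<bar>T1\<bar> / \<delta> \<le> T" by (auto simp: T_def)
  obtain E where E: "0 \<le> E"
    and low': "\<And>t \<theta>. T \<le> t \<Longrightarrow> 0 < \<theta> \<Longrightarrow> t / \<theta> \<le> T \<Longrightarrow> 1 \<le> E * \<theta> powr \<beta> * F t"
    using low[OF T(2)] by auto
  define A where "A = C1 * (\<delta> powr - \<alpha> + 1) + E * D' * e powr - \<beta>"
  have A: "0 \<le> A" unfolding A_def using C1 E D' by simp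
  define C where "C = A / (1 - \<rho>)"
  have C: "0 \<le> C" unfolding C_def using A rho by simp
  have CA: "A + C * \<rho> = C" unfolding C_def using rho by (simp add: field_simps)
  show ?thesis
  proof (rule that[OF C])
    show "0 < T" using T T2 by simp
    fix \<mu> :: "(real \<times> real) measure" and \<nu> :: "real measure" and t :: real
    assume mu: "prob_space \<mu>" and s1[measurable_cong]: "sets \<mu> = sets (borel :: (real \<times> real) measure)"
      and nu: "prob_space \<nu>" and s2[measurable_cong]: "sets \<nu> = sets (borel :: real measure)"
      and pos: "AE w in \<mu>. 0 < snd w" and ma: "(\<integral>w. snd w powr \<alpha> \<partial>\<mu>) \<le> c"
      and ia: "integrable \<mu> (\<lambda>w. snd w powr \<alpha>)"
      and ib: "integrable \<mu> (\<lambda>w. snd w powr \<beta>)" and mb: "(\<integral>w. snd w powr \<beta> \<partial>\<mu>) \<le> D"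
      and tq: "\<And>s. T1 \<le> s \<Longrightarrow> measure \<mu> {w. s < \<bar>fst w\<bar>} \<le> C1 * F s"
      and ty: "\<And>s. T \<le> s \<Longrightarrow> measure \<nu> {s<..} \<le> C * F s" and t: "T \<le> t"
    interpret mu: prob_space \<mu> by fact
    interpret nu: prob_space \<nu> by fact
    interpret pair_prob_space \<mu> \<nu> ..
    have sp: "space \<mu> = UNIV" "space \<nu> = UNIV"
      using sets_eq_imp_space_eq[OF s1] sets_eq_imp_space_eq[OF s2] by auto
    define S where "S = {z :: (real \<times> real) \<times> real. e * t < snd (fst z) * snd z}"
    have t0: "0 < t" using T T2 t by simp
    have meas: "{z \<in> space (\<mu> \<Otimes>\<^sub>M \<nu>). \<delta> * t < \<bar>fst (fst z)\<bar>} \<in> sets (\<mu> \<Otimes>\<^sub>M \<nu>)"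
      "{z \<in> space (\<mu> \<Otimes>\<^sub>M \<nu>). e * t < snd (fst z) * snd z} \<in> sets (\<mu> \<Otimes>\<^sub>M \<nu>)"
      "{z \<in> space (\<mu> \<Otimes>\<^sub>M \<nu>). t < \<bar>fst (fst z)\<bar> + snd (fst z) * snd z} \<in> sets (\<mu> \<Otimes>\<^sub>M \<nu>)"
      by measurable
    then have meas: "{z. \<delta> * t < \<bar>fst (fst z)\<bar>} \<in> sets (\<mu> \<Otimes>\<^sub>M \<nu>)"
      "S \<in> sets (\<mu> \<Otimes>\<^sub>M \<nu>)"
      "{z. t < \<bar>fst (fst z)\<bar> + snd (fst z) * snd z} \<in> sets (\<mu> \<Otimes>\<^sub>M \<nu>)"
      by (simp_all add: S_def space_pair_measure sp)
    have dt: "\<delta> * t + e * t = t" by (simp add: \<delta>_def algebra_simps)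
    have "measure (\<mu> \<Otimes>\<^sub>M \<nu>) {z. t < \<bar>fst (fst z)\<bar> + snd (fst z) * snd z}
        \<le> measure (\<mu> \<Otimes>\<^sub>M \<nu>) ({z. \<delta> * t < \<bar>fst (fst z)\<bar>} \<union> S)"
      using meas dt by (intro finite_measure_mono) (auto simp: S_def)
    also have "\<dots> \<le> measure (\<mu> \<Otimes>\<^sub>M \<nu>) {z. \<delta> * t < \<bar>fst (fst z)\<bar>} + measure (\<mu> \<Otimes>\<^sub>M \<nu>) S"
      using meas by (intro measure_Un_le)
    also have "measure (\<mu> \<Otimes>\<^sub>M \<nu>) {z. \<delta> * t < \<bar>fst (fst z)\<bar>} = measure \<mu> {w. \<delta> * t < \<bar>fst w\<bar>}"
    proof -
      have "measure (\<mu> \<Otimes>\<^sub>M \<nu>) {z. \<delta> * t < \<bar>fst (fst z)\<bar>}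
          = (\<integral>w. indicator {w. \<delta> * t < \<bar>fst w\<bar>} w \<partial>\<mu>)"
        unfolding measure_pair_slice(2)[OF mu nu meas(1)]
        using nu.prob_space
        by (intro Bochner_Integration.integral_cong) (auto simp: vimage_def sp indicator_def)
      then show ?thesis by (simp add: sp)
    qed
    also have "\<dots> \<le> C1 * (\<delta> powr - \<alpha> + 1) * F t"
    proof -
      have "\<bar>T1\<bar> \<le> \<delta> * T" using T(4) d by (simp add: field_simps)
      also have "\<dots> \<le> \<delta> * t" using t d by simp
      finally have "T1 \<le> \<delta> * t" by simp
      then have "measure \<mu> {w. \<delta> * t < \<bar>fst w\<bar>} \<le> C1 * F (\<delta> * t)" by (rule tq)
      also have "\<dots> \<le> C1 * ((\<delta> powr - \<alpha> + 1) * F t)"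
        using T t by (intro mult_left_mono[OF _ C1] T4) auto
      finally show ?thesis by simp
    qed
    also have "measure (\<mu> \<Otimes>\<^sub>M \<nu>) S \<le> (E * D' * e powr - \<beta> + C * \<rho>) * F t"
    proof -
      \<comment> \<open>One majorant serves all multipliers: the \<open>C\<close> part is the
        assumed bound on \<nu> where \<open>t / \<theta>\<close> is at least \<open>T\<close>, for
        \<open>\<theta> = snd w / e\<close>, and the \<open>E\<close> part covers the rest through
        the trivial bound 1. Adding them avoids splitting the integral.\<close>
      define R where "R w = F t * (C * (e powr - \<alpha> * snd w powr \<alpha> + \<delta> + \<delta> * (e powr - \<beta> * snd w powr \<beta>))
            + E * (e powr - \<beta> * snd w powr \<beta>))" for w :: "real \<times> real"
      have intR: "integrable \<mu> R"
        unfolding R_def using ia ib by (intro Bochner_Integration.integrable_add integrable_mult_right) auto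
      have "measure (\<mu> \<Otimes>\<^sub>M \<nu>) S = (\<integral>w. measure \<nu> (Pair w -` S) \<partial>\<mu>)"
        by (rule measure_pair_slice(2)[OF mu nu meas(2)])
      also have "\<dots> \<le> (\<integral>w. R w \<partial>\<mu>)"
      proof (rule integral_mono_AE[OF measure_pair_slice(1)[OF mu nu meas(2)] intR])
        show "AE w in \<mu>. measure \<nu> (Pair w -` S) \<le> R w"
          using pos
        proof eventually_elim
          case (elim w)
          define \<theta> where "\<theta> = snd w / e"
          have th: "0 < \<theta>" using elim e by (simp add: \<theta>_def)
          have pw: "\<theta> powr x = e powr - x * snd w powr x" for x
            using elim e by (simp add: \<theta>_def powr_divide powr_minus field_simps)
          have "Pair w -` S = {t / \<theta><..}"
            using elim e by (auto simp: S_def \<theta>_def field_simps)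
          moreover have "measure \<nu> {t / \<theta><..} \<le> R w"
          proof (cases "T \<le> t / \<theta>")
            case True
            then have "measure \<nu> {t / \<theta><..} \<le> C * F (t / \<theta>)" by (rule ty)
            also have "\<dots> \<le> C * (F t * (\<theta> powr \<alpha> + \<delta> + \<delta> * \<theta> powr \<beta>))"
              using True t T by (intro mult_left_mono[OF _ C] U th) auto
            also have "\<dots> + 0 \<le> C * (F t * (\<theta> powr \<alpha> + \<delta> + \<delta> * \<theta> powr \<beta>)) + F t * (E * \<theta> powr \<beta>)"
              using E by (intro add_left_mono) simp
            also have "\<dots> = R w" by (simp add: R_def pw algebra_simps)
            finally show ?thesis by simp
          next
            case False
            have "measure \<nu> {t / \<theta><..} \<le> 1" by simp
            also have "\<dots> \<le> E * \<theta> powr \<beta> * F t" using False t th by (intro low') auto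
            also have "0 + \<dots> \<le> C * (F t * (\<theta> powr \<alpha> + \<delta> + \<delta> * \<theta> powr \<beta>)) + E * \<theta> powr \<beta> * F t"
              using C d by (intro add_right_mono) (auto intro!: mult_nonneg_nonneg add_nonneg_nonneg)
            also have "\<dots> = R w" by (simp add: R_def pw algebra_simps)
            finally show ?thesis by simp
          qed
          ultimately show ?case by simp
        qed
      qed
      also have "(\<integral>w. R w \<partial>\<mu>) = F t * (C * (e powr - \<alpha> * (\<integral>w. snd w powr \<alpha> \<partial>\<mu>) + \<delta>
          + \<delta> * (e powr - \<beta> * (\<integral>w. snd w powr \<beta> \<partial>\<mu>))) + E * (e powr - \<beta> * (\<integral>w. snd w powr \<beta> \<partial>\<mu>)))"
        unfolding R_def using ia ib mu.prob_space by (simp add: Bochner_Integration.integral_add)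
      also have "\<dots> \<le> F t * (C * (e powr - \<alpha> * c' + \<delta> + \<delta> * (e powr - \<beta> * D')) + E * (e powr - \<beta> * D'))"
        using ma mb c' D' d C E
        by (intro mult_left_mono add_mono order_refl) (auto intro: order_trans)
      also have "\<dots> = (E * D' * e powr - \<beta> + C * \<rho>) * F t"
        by (simp add: \<rho>_def algebra_simps)
      finally show ?thesis .
    qed
    also have "C1 * (\<delta> powr - \<alpha> + 1) * F t + (E * D' * e powr - \<beta> + C * \<rho>) * F t = (A + C * \<rho>) * F t"
      by (simp add: A_def algebra_simps)
    finally show "measure (\<mu> \<Otimes>\<^sub>M \<nu>) {z. t < \<bar>fst (fst z)\<bar> + snd (fst z) * snd z} \<le> C * F t"
      unfolding CA by simp
  qed
qed

end

section \<open>One big jump in \<open>Q + M Y\<close> with \<open>Y\<close> independent of the pair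
  \<open>(Q, M)\<close>\<close>

locale affine_tail = regularly_varying_tail F \<alpha> B + mu: prob_space \<mu> + nu: prob_space \<nu>
  for F :: "real \<Rightarrow> real" and \<alpha> B :: real and \<mu> :: "(real \<times> real) measure" and \<nu> :: "real measure" +
  fixes \<beta> q :: real and C :: real
  assumes sets_\<mu> [measurable_cong]: "sets \<mu> = sets borel"
    and sets_\<nu> [measurable_cong]: "sets \<nu> = sets borel"
    and pos: "AE w in \<mu>. 0 < snd w"
    and beta: "\<alpha> < \<beta>" and int_beta: "integrable \<mu> (\<lambda>w. snd w powr \<beta>)"
    and tail_q: "((\<lambda>t. measure \<mu> {w. t < fst w} / F t) \<longlongrightarrow> q) at_top"
    and C: "0 \<le> C" and tail_y: "eventually (\<lambda>t. measure \<nu> {y. t < \<bar>y\<bar>} \<le> C * F t) at_top"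
begin

sublocale pair_prob_space \<mu> \<nu> ..

lemma space_\<mu> [simp]: "space \<mu> = UNIV" and space_\<nu> [simp]: "space \<nu> = UNIV"
  using sets_eq_imp_space_eq[OF sets_\<mu>] sets_eq_imp_space_eq[OF sets_\<nu>] by auto

text \<open>A factor in the threshold is absorbed into the multiplier, since for positive
  \<open>M\<close> the event \<open>c * t < M * Y\<close> is \<open>t / (M / c) < Y\<close>.
  Breiman's lemma is therefore used with \<open>M / c\<close> as the random scale.\<close>

lemma scaled: "0 < c \<Longrightarrow> breiman F \<alpha> B \<mu> (\<lambda>w. snd w / c) \<beta>"
proof
  assume c: "0 < c"
  show "AE w in \<mu>. 0 < snd w / c" using pos by eventually_elim (use c in simp)
  have "integrable \<mu> (\<lambda>w. snd w powr \<beta> / c powr \<beta>)" using int_beta by simp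
  moreover have "AE w in \<mu>. snd w powr \<beta> / c powr \<beta> = (snd w / c) powr \<beta>"
    using pos by eventually_elim (use c in \<open>simp add: powr_divide\<close>)
  ultimately show "integrable \<mu> (\<lambda>w. (snd w / c) powr \<beta>)"
    by (subst integrable_cong_AE[where g = "\<lambda>w. snd w powr \<beta> / c powr \<beta>"]) auto
qed (auto simp: beta)

lemma scaled_moment:
  "0 < c \<Longrightarrow> (\<integral>w. (snd w / c) powr \<alpha> \<partial>\<mu>) = c powr - \<alpha> * (\<integral>w. snd w powr \<alpha> \<partial>\<mu>)"
proof -
  assume c: "0 < c"
  have "(\<integral>w. (snd w / c) powr \<alpha> \<partial>\<mu>) = (\<integral>w. c powr - \<alpha> * snd w powr \<alpha> \<partial>\<mu>)"
    by (rule integral_cong_AE) (use pos c in \<open>auto elim!: eventually_mono simp: powr_divide powr_minus field_simps\<close>)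
  then show ?thesis by simp
qed

lemma sets_events:
  assumes "{z \<in> space (\<mu> \<Otimes>\<^sub>M \<nu>). p z} \<in> sets (\<mu> \<Otimes>\<^sub>M \<nu>)"
  shows "{z. p z} \<in> sets (\<mu> \<Otimes>\<^sub>M \<nu>)"
  using assms by (simp add: space_pair_measure)

lemma sets_affine_events [measurable]:
  "{z. s < fst (fst z)} \<in> sets (\<mu> \<Otimes>\<^sub>M \<nu>)"
  "{z. s < snd (fst z) * snd z} \<in> sets (\<mu> \<Otimes>\<^sub>M \<nu>)"
  "{z. s < fst (fst z) + snd (fst z) * snd z} \<in> sets (\<mu> \<Otimes>\<^sub>M \<nu>)"
  "{z. s < \<bar>fst (fst z)\<bar> \<and> s < \<bar>snd (fst z) * snd z\<bar>} \<in> sets (\<mu> \<Otimes>\<^sub>M \<nu>)"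
proof -
  show "{z. s < fst (fst z)} \<in> sets (\<mu> \<Otimes>\<^sub>M \<nu>)" by (rule sets_events) measurable
  show "{z. s < snd (fst z) * snd z} \<in> sets (\<mu> \<Otimes>\<^sub>M \<nu>)" by (rule sets_events) measurable
  show "{z. s < fst (fst z) + snd (fst z) * snd z} \<in> sets (\<mu> \<Otimes>\<^sub>M \<nu>)" by (rule sets_events) measurable
  show "{z. s < \<bar>fst (fst z)\<bar> \<and> s < \<bar>snd (fst z) * snd z\<bar>} \<in> sets (\<mu> \<Otimes>\<^sub>M \<nu>)" by (rule sets_events) measurable
qed

definition tail where "tail s = measure \<nu> {s<..}"
definition tail_abs where "tail_abs s = measure \<nu> {y. s < \<bar>y\<bar>}"

lemma sets_tail_abs [measurable]: "{y. s < \<bar>y\<bar>} \<in> sets \<nu>"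
proof -
  have "{y \<in> space \<nu>. s < \<bar>y\<bar>} \<in> sets \<nu>" by measurable
  then show ?thesis by simp
qed

lemma tail_props: "tail \<in> borel_measurable borel" "0 \<le> tail s" "tail s \<le> 1"
  and tail_abs_props: "tail_abs \<in> borel_measurable borel" "0 \<le> tail_abs s" "tail_abs s \<le> 1"
  unfolding tail_def tail_abs_def
  by (auto intro!: antimono_borel_measurable nu.finite_measure_mono)

lemma prod_tail:
  assumes "0 < c"
  shows "measure (\<mu> \<Otimes>\<^sub>M \<nu>) {z. c * t < snd (fst z) * snd z} = (\<integral>w. tail (t / (snd w / c)) \<partial>\<mu>)"
proof -
  have S: "{z. c * t < snd (fst z) * snd z} \<in> sets (\<mu> \<Otimes>\<^sub>M \<nu>)" by (rule sets_events) measurable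
  note [measurable] = tail_props(1)
  have *: "Pair w -` {z. c * t < snd (fst z) * snd z} = {t / (snd w / c)<..}" if "0 < snd w" for w :: "real \<times> real"
    using that assms by (auto simp: field_simps)
  show ?thesis
    unfolding measure_pair_slice(2)[OF mu.prob_space_axioms nu.prob_space_axioms S]
  proof (rule integral_cong_AE)
    show "AE w in \<mu>. measure \<nu> (Pair w -` {z. c * t < snd (fst z) * snd z}) = tail (t / (snd w / c))"
      using pos by eventually_elim (simp only: * tail_def)
  qed (auto intro!: borel_measurable_integrable[OF measure_pair_slice(1)[OF _ _ S]] mu.prob_space_axioms nu.prob_space_axioms)
qed

text \<open>The two entries of a pair may depend on each other, so this event is no product. Given
  the pair \<open>w\<close> it requires \<open>e * t < \<bar>fst w\<bar>\<close>, which fails for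
  every fixed \<open>w\<close> once \<open>t\<close> is large; \<open>vanishing\<close> then
  applies, with only the independence of \<open>Y\<close> being used.\<close>

lemma joint_vanish:
  assumes e: "0 < e"
  shows "((\<lambda>t. measure (\<mu> \<Otimes>\<^sub>M \<nu>) {z. e * t < \<bar>fst (fst z)\<bar> \<and> e * t < \<bar>snd (fst z) * snd z\<bar>} / F t) \<longlongrightarrow> 0) at_top"
proof -
  interpret b: breiman F \<alpha> B \<mu> "\<lambda>w. snd w / e" \<beta> by (rule scaled[OF e])
  note [measurable] = tail_abs_props(1)
  define A where "A t = {w :: real \<times> real. e * t < \<bar>fst w\<bar>}" for t
  have A[measurable]: "A t \<in> sets \<mu>" for t
  proof -
    have "{w \<in> space \<mu>. e * t < \<bar>fst w\<bar>} \<in> sets \<mu>" by measurable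
    then show ?thesis by (simp add: A_def)
  qed
  have "((\<lambda>t. (\<integral>w. indicator (A t) w * tail_abs (t / (snd w / e)) \<partial>\<mu>) / F t) \<longlongrightarrow> 0) at_top"
  proof (rule b.vanishing[where C = C])
    show "eventually (\<lambda>t. w \<notin> A t) at_top" for w
      using eventually_ge_at_top[of "\<bar>fst w\<bar> / e"]
      by eventually_elim (use e in \<open>auto simp: A_def field_simps\<close>)
  qed (use tail_abs_props C tail_y in \<open>auto simp: tail_abs_def\<close>)
  moreover have "measure (\<mu> \<Otimes>\<^sub>M \<nu>) {z. e * t < \<bar>fst (fst z)\<bar> \<and> e * t < \<bar>snd (fst z) * snd z\<bar>}
      = (\<integral>w. indicator (A t) w * tail_abs (t / (snd w / e)) \<partial>\<mu>)" for t
  proof -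
    let ?S = "{z :: (real \<times> real) \<times> real. e * t < \<bar>fst (fst z)\<bar> \<and> e * t < \<bar>snd (fst z) * snd z\<bar>}"
    have S: "?S \<in> sets (\<mu> \<Otimes>\<^sub>M \<nu>)" by (rule sets_events) measurable
    have *: "measure \<nu> (Pair w -` ?S) = indicator (A t) w * tail_abs (t / (snd w / e))" if "0 < snd w" for w :: "real \<times> real"
    proof (cases "w \<in> A t")
      case True
      then have "Pair w -` ?S = {y. t / (snd w / e) < \<bar>y\<bar>}"
        using that e by (auto simp: A_def abs_mult field_simps)
      then show ?thesis using True by (simp add: tail_abs_def)
    next
      case False
      then have "Pair w -` ?S = {}" by (auto simp: A_def)
      then have "measure \<nu> (Pair w -` ?S) = 0" by (simp only: measure_empty)
      then show ?thesis using False by simp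
    qed
    show ?thesis
      unfolding measure_pair_slice(2)[OF mu.prob_space_axioms nu.prob_space_axioms S]
      proof (rule integral_cong_AE)
      show "AE w in \<mu>. measure \<nu> (Pair w -` ?S) = indicator (A t) w * tail_abs (t / (snd w / e))"
        using pos by eventually_elim (simp only: *)
    qed (auto intro!: borel_measurable_integrable[OF measure_pair_slice(1)[OF _ _ S]] mu.prob_space_axioms nu.prob_space_axioms)
  qed
  ultimately show ?thesis by simp
qed

lemma fst_tail: "measure (\<mu> \<Otimes>\<^sub>M \<nu>) {z. s < fst (fst z)} = measure \<mu> {w. s < fst w}"
proof -
  have S: "{z. s < fst (fst z)} \<in> sets (\<mu> \<Otimes>\<^sub>M \<nu>)" by (rule sets_events) measurable
  have "measure (\<mu> \<Otimes>\<^sub>M \<nu>) {z. s < fst (fst z)} = (\<integral>w. indicator {w. s < fst w} w \<partial>\<mu>)"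
    unfolding measure_pair_slice(2)[OF mu.prob_space_axioms nu.prob_space_axioms S]
    using nu.prob_space
    by (intro Bochner_Integration.integral_cong) (auto simp: vimage_def indicator_def)
  then show ?thesis by simp
qed

lemma tail_q_scaled:
  assumes c: "0 < c"
  shows "((\<lambda>t. measure \<mu> {w. c * t < fst w} / F t) \<longlongrightarrow> c powr - \<alpha> * q) at_top"
proof -
  have "filterlim (\<lambda>t. c * t) at_top at_top"
    using c filterlim_tendsto_pos_mult_at_top[OF tendsto_const, of c "\<lambda>t. t" at_top]
    by (auto simp: filterlim_ident)
  from filterlim_compose[OF tail_q this]
  have "((\<lambda>t. F (c * t) / F t * (measure \<mu> {w. c * t < fst w} / F (c * t))) \<longlongrightarrow> c powr - \<alpha> * q) at_top"
    by (intro tendsto_mult F_rv c)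
  moreover have "F (c * t) \<noteq> 0" for t using F_pos[of "c * t"] by simp
  ultimately show ?thesis by simp
qed

text \<open>If \<open>Q + M Y\<close> exceeds \<open>t\<close>, then one summand exceeds
  \<open>c * t\<close>, or else both exceed \<open>(1 - c) * t\<close> in absolute value. The last
  event is negligible, and taking \<open>c\<close> close to 1 makes the factor
  \<open>c powr - \<alpha>\<close> harmless. The three events share the slack
  \<open>b - (q + a * m) * c powr - \<alpha>\<close> equally, which gives \<open>r\<close>.\<close>

lemma affine_upper:
  assumes a: "0 \<le> a" and ev: "eventually (\<lambda>s. measure \<nu> {s<..} \<le> a * F s) at_top"
    and b: "q + a * (\<integral>w. snd w powr \<alpha> \<partial>\<mu>) < b"
  shows "eventually (\<lambda>t. measure (\<mu> \<Otimes>\<^sub>M \<nu>) {z. t < fst (fst z) + snd (fst z) * snd z} \<le> b * F t) at_top"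
proof -
  define m where "m = (\<integral>w. snd w powr \<alpha> \<partial>\<mu>)"
  have "((\<lambda>c. (q + a * m) * c powr - \<alpha>) \<longlongrightarrow> (q + a * m) * 1 powr - \<alpha>) (at_left 1)"
    by (intro tendsto_intros) auto
  then have "eventually (\<lambda>c. (q + a * m) * c powr - \<alpha> < b) (at_left 1)"
    using b by (intro order_tendstoD(2)) (auto simp: m_def)
  moreover have "eventually (\<lambda>e::real. e \<in> {0<..<1}) (at_left 1)"
    by (rule eventually_at_left_real) simp
  ultimately have "eventually (\<lambda>c. (q + a * m) * c powr - \<alpha> < b \<and> c \<in> {0<..<1}) (at_left (1::real))"
    by eventually_elim simp
  then obtain c :: real where c: "0 < c" "c < 1" and cb: "(q + a * m) * c powr - \<alpha> < b"
    using eventually_happens[of _ "at_left (1::real)"] by auto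
  define r where "r = (b - (q + a * m) * c powr - \<alpha>) / 3"
  have r: "0 < r" using cb by (simp add: r_def)
  interpret br: breiman F \<alpha> B \<mu> "\<lambda>w. snd w / c" \<beta> by (rule scaled[OF c(1)])
  have "eventually (\<lambda>t. measure \<mu> {w. c * t < fst w} \<le> (c powr - \<alpha> * q + r) * F t) at_top"
    by (rule eventually_le_scale[OF tail_q_scaled[OF c(1)]]) (use r F_pos in auto)
  moreover have "eventually (\<lambda>t. (\<integral>w. tail (t / (snd w / c)) \<partial>\<mu>) \<le> (a * m * c powr - \<alpha> + r) * F t) at_top"
    using ev a r by (intro br.upper[OF tail_props]) (auto simp: tail_def scaled_moment[OF c(1)] m_def[symmetric])
  moreover have "eventually (\<lambda>t. measure (\<mu> \<Otimes>\<^sub>M \<nu>) {z. (1 - c) * t < \<bar>fst (fst z)\<bar> \<and> (1 - c) * t < \<bar>snd (fst z) * snd z\<bar>} \<le> r * F t) at_top"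
    using c by (intro eventually_le_scale[OF joint_vanish]) (use r F_pos in auto)
  ultimately show ?thesis
  proof eventually_elim
    case (elim t)
    let ?A = "{z :: (real \<times> real) \<times> real. c * t < fst (fst z)}"
    let ?B = "{z :: (real \<times> real) \<times> real. c * t < snd (fst z) * snd z}"
    let ?J = "{z :: (real \<times> real) \<times> real. (1 - c) * t < \<bar>fst (fst z)\<bar> \<and> (1 - c) * t < \<bar>snd (fst z) * snd z\<bar>}"
    have "measure (\<mu> \<Otimes>\<^sub>M \<nu>) {z. t < fst (fst z) + snd (fst z) * snd z} \<le> measure (\<mu> \<Otimes>\<^sub>M \<nu>) (?A \<union> ?B \<union> ?J)"
    proof (rule finite_measure_mono)
      have "t = c * t + (1 - c) * t" by (simp add: algebra_simps)
      then show "{z. t < fst (fst z) + snd (fst z) * snd z} \<subseteq> ?A \<union> ?B \<union> ?J" by auto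
    qed measurable
    also have "\<dots> \<le> measure (\<mu> \<Otimes>\<^sub>M \<nu>) (?A \<union> ?B) + measure (\<mu> \<Otimes>\<^sub>M \<nu>) ?J"
      by (rule measure_Un_le) measurable
    also have "measure (\<mu> \<Otimes>\<^sub>M \<nu>) (?A \<union> ?B) \<le> measure (\<mu> \<Otimes>\<^sub>M \<nu>) ?A + measure (\<mu> \<Otimes>\<^sub>M \<nu>) ?B"
      by (rule measure_Un_le) measurable
    also have "measure (\<mu> \<Otimes>\<^sub>M \<nu>) ?A \<le> (c powr - \<alpha> * q + r) * F t" unfolding fst_tail by (rule elim)
    also have "measure (\<mu> \<Otimes>\<^sub>M \<nu>) ?B \<le> (a * m * c powr - \<alpha> + r) * F t"
      unfolding prod_tail[OF c(1)] by (rule elim)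
    also have "measure (\<mu> \<Otimes>\<^sub>M \<nu>) ?J \<le> r * F t" by (rule elim)
    also have "(c powr - \<alpha> * q + r) * F t + (a * m * c powr - \<alpha> + r) * F t + r * F t = b * F t"
      by (simp add: r_def field_simps)
    finally show ?case by simp
  qed
qed

text \<open>Now \<open>c > 1\<close>: a summand above \<open>c * t\<close> forces the sum above
  \<open>t\<close> unless the other summand is very negative, an event contained in
  \<open>?J\<close>. The overlap \<open>?A \<inter> ?B\<close> is counted twice on the left; it lies
  in \<open>?J\<close> as well, and removing it from \<open>?J\<close> in the covering of
  \<open>?A \<union> ?B\<close> cancels it exactly, so \<open>?J\<close> is paid for only
  once.\<close>

lemma affine_lower:
  assumes ev: "eventually (\<lambda>s. a * F s \<le> measure \<nu> {s<..}) at_top"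
    and b: "b < q + a * (\<integral>w. snd w powr \<alpha> \<partial>\<mu>)"
  shows "eventually (\<lambda>t. b * F t \<le> measure (\<mu> \<Otimes>\<^sub>M \<nu>) {z. t < fst (fst z) + snd (fst z) * snd z}) at_top"
proof -
  define m where "m = (\<integral>w. snd w powr \<alpha> \<partial>\<mu>)"
  \<comment> \<open>In the iteration the lower bound \<open>a\<close> may be negative. As tails are
    nonnegative it can be raised to 0, which gives the sign that Breiman's lower bound
    requires.\<close>
  define a' where "a' = max a 0"
  have m: "0 \<le> m" unfolding m_def by (rule integral_nonneg_AE) auto
  have a': "0 \<le> a'" by (simp add: a'_def)
  have "a * m \<le> a' * m" using m by (intro mult_right_mono) (auto simp: a'_def)
  then have b': "b < q + a' * m" using b by (simp add: m_def)
  have ev': "eventually (\<lambda>s. a' * F s \<le> tail s) at_top"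
    using ev by eventually_elim (auto simp: a'_def max_def tail_def)
  have "((\<lambda>c. (q + a' * m) * c powr - \<alpha>) \<longlongrightarrow> (q + a' * m) * 1 powr - \<alpha>) (at_right 1)"
    by (intro tendsto_intros) auto
  then have "eventually (\<lambda>c. b < (q + a' * m) * c powr - \<alpha>) (at_right 1)"
    using b' by (intro order_tendstoD(1)) auto
  moreover have "eventually (\<lambda>e::real. e \<in> {1<..<2}) (at_right 1)"
    by (rule eventually_at_right_real) simp
  ultimately have "eventually (\<lambda>c. b < (q + a' * m) * c powr - \<alpha> \<and> c \<in> {1<..<2}) (at_right (1::real))"
    by eventually_elim simp
  then obtain c :: real where c: "1 < c" and cb: "b < (q + a' * m) * c powr - \<alpha>"
    using eventually_happens[of _ "at_right (1::real)"] by auto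
  have c0: "0 < c" using c by simp
  define r where "r = ((q + a' * m) * c powr - \<alpha> - b) / 3"
  have r: "0 < r" using cb by (simp add: r_def)
  interpret br: breiman F \<alpha> B \<mu> "\<lambda>w. snd w / c" \<beta> by (rule scaled[OF c0])
  have "eventually (\<lambda>t. (c powr - \<alpha> * q - r) * F t \<le> measure \<mu> {w. c * t < fst w}) at_top"
    by (rule eventually_ge_scale[OF tail_q_scaled[OF c0]]) (use r F_pos in auto)
  moreover have "eventually (\<lambda>t. (a' * m * c powr - \<alpha> - r) * F t \<le> (\<integral>w. tail (t / (snd w / c)) \<partial>\<mu>)) at_top"
    using ev' a' r by (intro br.lower[OF tail_props]) (auto simp: scaled_moment[OF c0] m_def[symmetric])
  moreover have "eventually (\<lambda>t. measure (\<mu> \<Otimes>\<^sub>M \<nu>) {z. (c - 1) * t < \<bar>fst (fst z)\<bar> \<and> (c - 1) * t < \<bar>snd (fst z) * snd z\<bar>} \<le> r * F t) at_top"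
    using c by (intro eventually_le_scale[OF joint_vanish]) (use r F_pos in auto)
  ultimately show ?thesis
    using eventually_gt_at_top[of 0]
  proof eventually_elim
    case (elim t)
    let ?A = "{z :: (real \<times> real) \<times> real. c * t < fst (fst z)}"
    let ?B = "{z :: (real \<times> real) \<times> real. c * t < snd (fst z) * snd z}"
    let ?E = "{z :: (real \<times> real) \<times> real. t < fst (fst z) + snd (fst z) * snd z}"
    let ?J = "{z :: (real \<times> real) \<times> real. (c - 1) * t < \<bar>fst (fst z)\<bar> \<and> (c - 1) * t < \<bar>snd (fst z) * snd z\<bar>}"
    have ct: "(c - 1) * t < c * t" "t < c * t" "0 < (c - 1) * t" using elim(4) c by auto
    have tt: "c * t = t + (c - 1) * t" by (simp add: algebra_simps)
    have "measure (\<mu> \<Otimes>\<^sub>M \<nu>) ?A + measure (\<mu> \<Otimes>\<^sub>M \<nu>) ?B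
        = measure (\<mu> \<Otimes>\<^sub>M \<nu>) (?A \<union> ?B) + measure (\<mu> \<Otimes>\<^sub>M \<nu>) (?A \<inter> ?B)"
    proof -
      have "measure (\<mu> \<Otimes>\<^sub>M \<nu>) (?A \<union> ?B) = measure (\<mu> \<Otimes>\<^sub>M \<nu>) ?A + measure (\<mu> \<Otimes>\<^sub>M \<nu>) (?B - ?A)"
        by (rule finite_measure_Union') (intro sets_affine_events)+
      moreover have "measure (\<mu> \<Otimes>\<^sub>M \<nu>) (?B - ?A) = measure (\<mu> \<Otimes>\<^sub>M \<nu>) ?B - measure (\<mu> \<Otimes>\<^sub>M \<nu>) (?A \<inter> ?B)"
        unfolding Int_commute[of ?A ?B] by (rule finite_measure_Diff') (intro sets_affine_events)+
      ultimately show ?thesis by linarith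
    qed
    moreover have "measure (\<mu> \<Otimes>\<^sub>M \<nu>) (?A \<union> ?B) \<le> measure (\<mu> \<Otimes>\<^sub>M \<nu>) (?E \<union> (?J - (?A \<inter> ?B)))"
    proof (rule finite_measure_mono)
      \<comment> \<open>If \<open>u < a\<close> but \<open>a + p \<le> t\<close>, then
        \<open>p \<le> t - a < - v\<close>. So both terms exceed \<open>v\<close> in absolute value,
        and \<open>p\<close>, being negative, is not above \<open>u\<close>; the case
        \<open>u < p\<close> is symmetric.\<close>
      have key: "t < a + p \<or> v < \<bar>a\<bar> \<and> v < \<bar>p\<bar> \<and> \<not> (u < a \<and> u < p)"
        if "u < a \<or> u < p" "u = t + v" "0 < v" for a p u v :: real
        using that elim(4) by arith
      show "?A \<union> ?B \<subseteq> ?E \<union> (?J - (?A \<inter> ?B))"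
        using key[OF _ tt ct(3)] by blast
    qed (intro sets.Un sets.Diff sets.Int sets_affine_events)+
    moreover have "measure (\<mu> \<Otimes>\<^sub>M \<nu>) (?E \<union> (?J - (?A \<inter> ?B))) \<le> measure (\<mu> \<Otimes>\<^sub>M \<nu>) ?E + measure (\<mu> \<Otimes>\<^sub>M \<nu>) (?J - (?A \<inter> ?B))"
      by (intro measure_Un_le sets.Diff sets.Int sets_affine_events)
    moreover have "measure (\<mu> \<Otimes>\<^sub>M \<nu>) (?J - (?A \<inter> ?B)) = measure (\<mu> \<Otimes>\<^sub>M \<nu>) ?J - measure (\<mu> \<Otimes>\<^sub>M \<nu>) (?A \<inter> ?B)"
    proof (rule finite_measure_Diff)
      have key: "v < \<bar>a\<bar> \<and> v < \<bar>p\<bar>" if "u < a" "u < p" "v < u" for a p u v :: real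
        using that by arith
      show "?A \<inter> ?B \<subseteq> ?J" using key[OF _ _ ct(1)] by blast
    qed (intro sets.Un sets.Diff sets.Int sets_affine_events)+
    ultimately have "measure (\<mu> \<Otimes>\<^sub>M \<nu>) ?A + measure (\<mu> \<Otimes>\<^sub>M \<nu>) ?B \<le> measure (\<mu> \<Otimes>\<^sub>M \<nu>) ?E + measure (\<mu> \<Otimes>\<^sub>M \<nu>) ?J"
      by linarith
    moreover have "(c powr - \<alpha> * q - r) * F t \<le> measure (\<mu> \<Otimes>\<^sub>M \<nu>) ?A" unfolding fst_tail by (rule elim)
    moreover have "(a' * m * c powr - \<alpha> - r) * F t \<le> measure (\<mu> \<Otimes>\<^sub>M \<nu>) ?B"
      unfolding prod_tail[OF c0] by (rule elim)
    moreover have "measure (\<mu> \<Otimes>\<^sub>M \<nu>) ?J \<le> r * F t" by (rule elim)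
    moreover have "b * F t = (c powr - \<alpha> * q - r) * F t + (a' * m * c powr - \<alpha> - r) * F t - r * F t"
      by (simp add: r_def field_simps)
    ultimately show ?case by linarith
  qed
qed

end

section \<open>Markov chains in an independent environment\<close>

text \<open>Unlike \<open>indep_var\<close>, this allows the two random variables to have different value types.\<close>

definition (in prob_space) indep_rv :: "'b measure \<Rightarrow> ('a \<Rightarrow> 'b) \<Rightarrow> 'c measure \<Rightarrow> ('a \<Rightarrow> 'c) \<Rightarrow> bool" where
  "indep_rv S Y T Z \<longleftrightarrow> random_variable S Y \<and> random_variable T Z \<and>
     (\<forall>U\<in>sets S. \<forall>V\<in>sets T. prob (Y -` U \<inter> Z -` V \<inter> space M) = prob (Y -` U \<inter> space M) * prob (Z -` V \<inter> space M))"

section \<open>Independence of two random elements through product laws\<close>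

context prob_space
begin

lemma indep_rv_rv:
  assumes "indep_rv S Y T Z"
  shows "random_variable S Y" "random_variable T Z"
  using assms by (auto simp: indep_rv_def)

lemma indep_rv_compose:
  assumes ind: "indep_rv S Y T Z" and f: "f \<in> measurable S S'" and g: "g \<in> measurable T T'"
  shows "indep_rv S' (\<lambda>x. f (Y x)) T' (\<lambda>x. g (Z x))"
  unfolding indep_rv_def
proof (intro conjI ballI)
  note rv[measurable] = indep_rv_rv[OF ind] f g
  show "random_variable S' (\<lambda>x. f (Y x))" "random_variable T' (\<lambda>x. g (Z x))" by measurable
  fix U V assume U: "U \<in> sets S'" and V: "V \<in> sets T'"
  have eq: "(\<lambda>x. f (Y x)) -` U \<inter> space M = Y -` (f -` U \<inter> space S) \<inter> space M"
    "(\<lambda>x. g (Z x)) -` V \<inter> space M = Z -` (g -` V \<inter> space T) \<inter> space M"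
    using measurable_space[OF rv(1)] measurable_space[OF rv(2)] by auto
  have eq2: "(\<lambda>x. f (Y x)) -` U \<inter> (\<lambda>x. g (Z x)) -` V \<inter> space M
      = Y -` (f -` U \<inter> space S) \<inter> Z -` (g -` V \<inter> space T) \<inter> space M"
    using eq by blast
  show "prob ((\<lambda>x. f (Y x)) -` U \<inter> (\<lambda>x. g (Z x)) -` V \<inter> space M) =
      prob ((\<lambda>x. f (Y x)) -` U \<inter> space M) * prob ((\<lambda>x. g (Z x)) -` V \<inter> space M)"
    unfolding eq eq2
    using ind measurable_sets[OF f U] measurable_sets[OF g V] unfolding indep_rv_def by blast
qed

lemma indep_rv_of_indep_var:
  assumes "indep_var S Y T Z"
  shows "indep_rv S Y T Z"
  unfolding indep_rv_def
proof (intro conjI ballI)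
  show "random_variable S Y" "random_variable T Z"
    using indep_var_rv1[OF assms] indep_var_rv2[OF assms] .
  fix U V assume "U \<in> sets S" "V \<in> sets T"
  moreover have "(\<lambda>x. (Y x, Z x)) -` (U \<times> V) \<inter> space M = Y -` U \<inter> Z -` V \<inter> space M" by auto
  ultimately show "prob (Y -` U \<inter> Z -` V \<inter> space M) = prob (Y -` U \<inter> space M) * prob (Z -` V \<inter> space M)"
    using indep_varD[OF assms, of U V] by simp
qed

lemma indep_rv_of_indep_set:
  assumes "indep_set (sets (vimage_algebra (space M) Y S)) (sets (vimage_algebra (space M) Z T))"
    and "random_variable S Y" "random_variable T Z"
  shows "indep_rv S Y T Z"
  unfolding indep_rv_def
proof (intro conjI ballI)
  fix U V assume UV: "U \<in> sets S" "V \<in> sets T"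
  have eq: "Y -` U \<inter> Z -` V \<inter> space M = (Y -` U \<inter> space M) \<inter> (Z -` V \<inter> space M)" by auto
  show "prob (Y -` U \<inter> Z -` V \<inter> space M) = prob (Y -` U \<inter> space M) * prob (Z -` V \<inter> space M)"
    unfolding eq by (rule indep_setD[OF assms(1)]) (use UV in_vimage_algebra in auto)
qed (use assms in auto)

lemma indep_rv_distr:
  assumes ind: "indep_rv S Y T Z"
  shows "distr M S Y \<Otimes>\<^sub>M distr M T Z = distr M (S \<Otimes>\<^sub>M T) (\<lambda>x. (Y x, Z x))"
proof (rule pair_measure_eqI)
  note rv[measurable] = indep_rv_rv[OF ind]
  interpret Y: prob_space "distr M S Y" by (rule prob_space_distr) measurable
  interpret Z: prob_space "distr M T Z" by (rule prob_space_distr) measurable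
  show "sigma_finite_measure (distr M S Y)" "sigma_finite_measure (distr M T Z)" by unfold_locales
  show "sets (distr M S Y \<Otimes>\<^sub>M distr M T Z) = sets (distr M (S \<Otimes>\<^sub>M T) (\<lambda>x. (Y x, Z x)))"
    by (simp cong: sets_pair_measure_cong)
  fix U V assume "U \<in> sets (distr M S Y)" "V \<in> sets (distr M T Z)"
  then have UV[measurable]: "U \<in> sets S" "V \<in> sets T" by auto
  have eq: "(\<lambda>x. (Y x, Z x)) -` (U \<times> V) \<inter> space M = Y -` U \<inter> Z -` V \<inter> space M" by auto
  show "emeasure (distr M S Y) U * emeasure (distr M T Z) V
      = emeasure (distr M (S \<Otimes>\<^sub>M T) (\<lambda>x. (Y x, Z x))) (U \<times> V)"
    using ind UV by (simp add: emeasure_distr eq emeasure_eq_measure indep_rv_def ennreal_mult)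
qed

lemma indep_rvI:
  assumes [measurable]: "random_variable S Y" "random_variable T Z"
    and eq: "distr M S Y \<Otimes>\<^sub>M distr M T Z = distr M (S \<Otimes>\<^sub>M T) (\<lambda>x. (Y x, Z x))"
  shows "indep_rv S Y T Z"
  unfolding indep_rv_def
proof (intro conjI ballI)
  interpret Z: prob_space "distr M T Z" by (rule prob_space_distr) measurable
  fix U V assume [measurable]: "U \<in> sets S" "V \<in> sets T"
  have [simp]: "(\<lambda>x. (Y x, Z x)) -` (U \<times> V) \<inter> space M = Y -` U \<inter> Z -` V \<inter> space M" by auto
  have "emeasure (distr M S Y \<Otimes>\<^sub>M distr M T Z) (U \<times> V) = emeasure (distr M S Y) U * emeasure (distr M T Z) V"
    by (rule Z.emeasure_pair_measure_Times) auto
  then have "ennreal (prob (Y -` U \<inter> Z -` V \<inter> space M)) = ennreal (prob (Y -` U \<inter> space M) * prob (Z -` V \<inter> space M))"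
    unfolding eq by (simp add: emeasure_distr emeasure_eq_measure ennreal_mult)
  then show "prob (Y -` U \<inter> Z -` V \<inter> space M) = prob (Y -` U \<inter> space M) * prob (Z -` V \<inter> space M)"
    by (simp add: ennreal_inj)
qed auto

end

text \<open>Under these hypotheses \<open>A\<close>, \<open>Y\<close>, \<open>Z\<close> are mutually
  independent, so the grouping can be changed. The proof computes the joint law on a rectangle
  \<open>U \<times> V\<close> by slicing at the value of \<open>A\<close>, where the slice is the
  rectangle of \<open>U\<close> and a section of \<open>V\<close>.\<close>

lemma (in prob_space) indep_rv_rotate:
  assumes indA: "indep_rv SA A (SB \<Otimes>\<^sub>M SC) (\<lambda>x. (Y x, Z x))" and indYZ: "indep_rv SB Y SC Z"
  shows "indep_rv SB Y (SA \<Otimes>\<^sub>M SC) (\<lambda>x. (A x, Z x))"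
proof -
  have [measurable]: "random_variable SA A" "random_variable SB Y" "random_variable SC Z"
    using indep_rv_rv[OF indA] indep_rv_rv[OF indYZ] by auto
  define LA LB LC where "LA = distr M SA A" and "LB = distr M SB Y" and "LC = distr M SC Z"
  interpret LA: prob_space LA unfolding LA_def by (rule prob_space_distr) measurable
  interpret LB: prob_space LB unfolding LB_def by (rule prob_space_distr) measurable
  interpret LC: prob_space LC unfolding LC_def by (rule prob_space_distr) measurable
  interpret BC: pair_prob_space LB LC ..
  have [measurable_cong]: "sets LA = sets SA" "sets LB = sets SB" "sets LC = sets SC"
    by (auto simp: LA_def LB_def LC_def)
  have BC: "LB \<Otimes>\<^sub>M LC = distr M (SB \<Otimes>\<^sub>M SC) (\<lambda>x. (Y x, Z x))"
    unfolding LB_def LC_def by (rule indep_rv_distr[OF indYZ])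
  have ABC: "LA \<Otimes>\<^sub>M (LB \<Otimes>\<^sub>M LC) = distr M (SA \<Otimes>\<^sub>M (SB \<Otimes>\<^sub>M SC)) (\<lambda>x. (A x, (Y x, Z x)))"
    unfolding LA_def BC by (rule indep_rv_distr[OF indA])
  have "indep_rv SA A SC Z"
    using indep_rv_compose[OF indA measurable_ident_sets[OF refl] measurable_snd] by simp
  then have AC: "LA \<Otimes>\<^sub>M LC = distr M (SA \<Otimes>\<^sub>M SC) (\<lambda>x. (A x, Z x))"
    unfolding LA_def LC_def by (rule indep_rv_distr)
  have "LB \<Otimes>\<^sub>M (LA \<Otimes>\<^sub>M LC) = distr M (SB \<Otimes>\<^sub>M (SA \<Otimes>\<^sub>M SC)) (\<lambda>x. (Y x, (A x, Z x)))"
  proof (rule pair_measure_eqI)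
    interpret AC: pair_prob_space LA LC ..
    show "sigma_finite_measure LB" "sigma_finite_measure (LA \<Otimes>\<^sub>M LC)" by unfold_locales
    show "sets (LB \<Otimes>\<^sub>M (LA \<Otimes>\<^sub>M LC)) = sets (distr M (SB \<Otimes>\<^sub>M (SA \<Otimes>\<^sub>M SC)) (\<lambda>x. (Y x, (A x, Z x))))"
      by (simp cong: sets_pair_measure_cong add: \<open>sets LA = sets SA\<close> \<open>sets LB = sets SB\<close> \<open>sets LC = sets SC\<close>)
    fix U V assume [measurable]: "U \<in> sets LB" "V \<in> sets (LA \<Otimes>\<^sub>M LC)"
    then have [measurable]: "U \<in> sets SB" "V \<in> sets (SA \<Otimes>\<^sub>M SC)"
      by (auto simp: \<open>sets LB = sets SB\<close> cong: sets_pair_measure_cong[OF \<open>sets LA = sets SA\<close> \<open>sets LC = sets SC\<close>])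
    let ?S = "{z \<in> space (LA \<Otimes>\<^sub>M (LB \<Otimes>\<^sub>M LC)). fst (snd z) \<in> U \<and> (fst z, snd (snd z)) \<in> V}"
    have S: "?S \<in> sets (LA \<Otimes>\<^sub>M (LB \<Otimes>\<^sub>M LC))" by measurable
    have "emeasure (distr M (SB \<Otimes>\<^sub>M (SA \<Otimes>\<^sub>M SC)) (\<lambda>x. (Y x, (A x, Z x)))) (U \<times> V)
        = emeasure M {x \<in> space M. Y x \<in> U \<and> (A x, Z x) \<in> V}"
      by (subst emeasure_distr) (auto intro!: arg_cong[where f = "emeasure M"])
    also have "\<dots> = emeasure (LA \<Otimes>\<^sub>M (LB \<Otimes>\<^sub>M LC)) ?S"
      unfolding ABC using S[unfolded ABC]
      by (subst emeasure_distr)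
         (auto intro!: arg_cong[where f = "emeasure M"] simp: space_pair_measure
           dest: measurable_space[OF \<open>random_variable SA A\<close>] measurable_space[OF \<open>random_variable SB Y\<close>]
             measurable_space[OF \<open>random_variable SC Z\<close>])
    also have "\<dots> = (\<integral>\<^sup>+a. emeasure (LB \<Otimes>\<^sub>M LC) (Pair a -` ?S) \<partial>LA)"
      by (rule BC.emeasure_pair_measure_alt[OF S])
    also have "\<dots> = (\<integral>\<^sup>+a. emeasure LB U * emeasure LC (Pair a -` V) \<partial>LA)"
    proof (rule nn_integral_cong)
      fix a assume a: "a \<in> space LA"
      have "Pair a -` ?S = U \<times> (Pair a -` V)"
        using a sets.sets_into_space[OF \<open>U \<in> sets LB\<close>] sets.sets_into_space[OF \<open>V \<in> sets (LA \<Otimes>\<^sub>M LC)\<close>]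
        by (auto simp: space_pair_measure)
      moreover have "Pair a -` V \<in> sets LC" by (rule sets_Pair1) fact
      ultimately show "emeasure (LB \<Otimes>\<^sub>M LC) (Pair a -` ?S) = emeasure LB U * emeasure LC (Pair a -` V)"
        using \<open>U \<in> sets LB\<close> by (simp add: LC.emeasure_pair_measure_Times)
    qed
    also have "\<dots> = emeasure LB U * (\<integral>\<^sup>+a. emeasure LC (Pair a -` V) \<partial>LA)"
      by (rule nn_integral_cmult) (rule LC.measurable_emeasure_Pair, fact)
    also have "\<dots> = emeasure LB U * emeasure (LA \<Otimes>\<^sub>M LC) V"
      by (subst LC.emeasure_pair_measure_alt) simp_all
    finally show "emeasure LB U * emeasure (LA \<Otimes>\<^sub>M LC) V =
      emeasure (distr M (SB \<Otimes>\<^sub>M (SA \<Otimes>\<^sub>M SC)) (\<lambda>x. (Y x, (A x, Z x)))) (U \<times> V)" by simp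
  qed
  then show ?thesis
    by (intro indep_rvI) (use AC in \<open>simp_all add: LB_def\<close>)
qed

section \<open>The chain and its coefficient array, read backwards from a time
  \<open>n\<close>\<close>

locale mc_env = prob_space P
  for P :: "'a measure" +
  fixes X :: "int \<Rightarrow> 'a \<Rightarrow> 'd::countable"
    and Q M :: "int \<Rightarrow> 'd \<Rightarrow> 'a \<Rightarrow> real"
    and \<pi> :: "'d \<Rightarrow> real" and p :: "'d \<Rightarrow> 'd \<Rightarrow> real"
  assumes X_meas [measurable]: "\<And>n. X n \<in> measurable P (count_space UNIV)"
    and stoch: "stochastic_matrix p"
    and irred: "irreducible_matrix p"
    and path_prob: "\<And>n path. path \<noteq> [] \<Longrightarrow>
      prob {\<omega> \<in> space P. \<forall>l < length path. X (n + int l) \<omega> = path ! l}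
        = \<pi> (hd path) * (\<Prod>l < length path - 1. p (path ! l) (path ! Suc l))"
    and indep_XW: "indep_rv (PiM UNIV (\<lambda>_. count_space UNIV)) (\<lambda>\<omega> n. X n \<omega>)
      (PiM UNIV (\<lambda>_. borel)) (\<lambda>\<omega> ni. (Q (fst ni) (snd ni) \<omega>, M (fst ni) (snd ni) \<omega>))"
    and indep_W: "indep_vars (\<lambda>_. borel) (\<lambda>ni \<omega>. (Q (fst ni) (snd ni) \<omega>, M (fst ni) (snd ni) \<omega>)) UNIV"
    and ident_W: "\<And>n i. distr P borel (\<lambda>\<omega>. (Q n i \<omega>, M n i \<omega>)) = distr P borel (\<lambda>\<omega>. (Q 0 i \<omega>, M 0 i \<omega>))"
begin

definition W :: "int \<Rightarrow> 'd \<Rightarrow> 'a \<Rightarrow> real \<times> real" where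
  "W n i \<omega> = (Q n i \<omega>, M n i \<omega>)"

definition \<mu> :: "'d \<Rightarrow> (real \<times> real) measure" where
  "\<mu> i = distr P borel (W 0 i)"

lemma W_meas [measurable]: "W n i \<in> borel_measurable P"
  using indep_W unfolding indep_vars_def W_def by (auto dest: spec[of _ "(n, i)"])

lemma distr_W: "distr P borel (W n i) = \<mu> i"
  using ident_W[of n i] unfolding \<mu>_def W_def .

abbreviation SS :: "(nat \<Rightarrow> 'd) measure" where "SS \<equiv> PiM UNIV (\<lambda>_. count_space UNIV)"
abbreviation WW :: "(nat \<times> 'd \<Rightarrow> real \<times> real) measure" where "WW \<equiv> PiM UNIV (\<lambda>_. borel)"

text \<open>Position \<open>k\<close> holds time \<open>n - k\<close>. With this indexing
  \<open>past 0\<close> and \<open>past (- 1)\<close> take values in one space, so a shift of time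
  means evaluating the same functional at another argument.\<close>

definition past :: "int \<Rightarrow> 'a \<Rightarrow> nat \<Rightarrow> 'd" where
  "past n \<omega> = (\<lambda>k. X (n - int k) \<omega>)"

text \<open>The coefficients of all states are kept, not only those of the visited ones; this keeps
  the array independent of the chain. The induced coefficients are picked out later by evaluating at
  \<open>(k, past n \<omega> k)\<close>.\<close>

definition env :: "int \<Rightarrow> 'a \<Rightarrow> nat \<times> 'd \<Rightarrow> real \<times> real" where
  "env n \<omega> = (\<lambda>kd. W (n - int (fst kd)) (snd kd) \<omega>)"

lemma past_meas [measurable]: "past n \<in> measurable P SS"
  unfolding past_def by (rule measurable_PiM_single') auto

lemma env_meas [measurable]: "env n \<in> measurable P WW"
  unfolding env_def by (rule measurable_PiM_single') auto

text \<open>Passing to \<open>env n\<close> reindexes the product measure of the array along the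
  injection sending \<open>(k, d)\<close> to \<open>(n - k, d)\<close>, and the marginals do not
  depend on time. The resulting law is free of \<open>n\<close>, which is the stationarity of the
  environment.\<close>

lemma distr_env: "distr P WW (env n) = (\<Pi>\<^sub>M kd\<in>UNIV. \<mu> (snd kd))"
proof -
  let ?f = "\<lambda>kd :: nat \<times> 'd. (n - int (fst kd), snd kd)"
  let ?L = "\<lambda>ni. distr P borel (\<lambda>\<omega>. (Q (fst ni) (snd ni) \<omega>, M (fst ni) (snd ni) \<omega>))"
  have Wall: "(\<lambda>\<omega> ni. (Q (fst ni) (snd ni) \<omega>, M (fst ni) (snd ni) \<omega>)) \<in> measurable P (PiM UNIV (\<lambda>_. borel))"
    using indep_rv_rv(2)[OF indep_XW] .
  have L: "distr P (PiM UNIV (\<lambda>_. borel)) (\<lambda>\<omega> ni. (Q (fst ni) (snd ni) \<omega>, M (fst ni) (snd ni) \<omega>)) = PiM UNIV ?L"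
  proof -
    have "random_variable borel (\<lambda>\<omega>. (Q (fst ni) (snd ni) \<omega>, M (fst ni) (snd ni) \<omega>))" for ni
      using W_meas[of "fst ni" "snd ni"] by (simp add: W_def[abs_def])
    from indep_vars_iff_distr_eq_PiM[OF _ this, of UNIV "\<lambda>ni. ni"] indep_W
    show ?thesis by (simp add: restrict_UNIV)
  qed
  have pr: "prob_space (?L ni)" for ni
    by (rule prob_space_distr) (use W_meas[of "fst ni" "snd ni"] in \<open>simp add: W_def[abs_def]\<close>)
  have eq1: "distr (PiM UNIV ?L) (\<Pi>\<^sub>M kd\<in>UNIV. ?L (?f kd)) (\<lambda>\<omega>. \<lambda>kd\<in>UNIV. \<omega> (?f kd)) = (\<Pi>\<^sub>M kd\<in>UNIV. ?L (?f kd))"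
    by (rule distr_PiM_reindex) (auto intro: pr inj_onI simp: prod_eq_iff)
  have eq2: "(\<Pi>\<^sub>M kd\<in>UNIV. ?L (?f kd)) = (\<Pi>\<^sub>M kd\<in>UNIV. \<mu> (snd kd))"
    using distr_W by (intro PiM_cong) (auto simp: W_def[abs_def])
  have eq3: "distr (PiM UNIV ?L) (\<Pi>\<^sub>M kd\<in>UNIV. \<mu> (snd kd)) (\<lambda>\<omega>. \<lambda>kd\<in>UNIV. \<omega> (?f kd)) = distr P WW (env n)"
    unfolding L[symmetric]
  proof (subst distr_distr[OF _ Wall])
    show "distr P (\<Pi>\<^sub>M kd\<in>UNIV. \<mu> (snd kd)) ((\<lambda>\<omega>. \<lambda>kd\<in>UNIV. \<omega> (?f kd)) \<circ> (\<lambda>\<omega> ni. (Q (fst ni) (snd ni) \<omega>, M (fst ni) (snd ni) \<omega>))) = distr P WW (env n)"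
      by (rule distr_cong) (auto simp: env_def W_def comp_def \<mu>_def intro!: sets_PiM_cong)
    have "(\<lambda>\<omega>. \<lambda>kd\<in>UNIV. \<omega> (?f kd)) \<in> measurable (PiM UNIV (\<lambda>_. borel)) WW"
      by (rule measurable_restrict) auto
    also have "measurable (PiM UNIV (\<lambda>_. borel)) WW = measurable (PiM UNIV (\<lambda>_. borel)) (\<Pi>\<^sub>M kd\<in>UNIV. \<mu> (snd kd))"
      by (rule measurable_cong_sets) (auto simp: \<mu>_def intro!: sets_PiM_cong)
    finally show "(\<lambda>\<omega>. \<lambda>kd\<in>UNIV. \<omega> (?f kd)) \<in> measurable (PiM UNIV (\<lambda>_. borel)) (\<Pi>\<^sub>M kd\<in>UNIV. \<mu> (snd kd))" .
  qed
  show ?thesis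
    using eq1 unfolding eq2 eq3 .
qed

text \<open>The two sides depend on the disjoint index sets of time 0 with state \<open>i\<close>
  and of all times up to -1.\<close>

lemma indep_W0_env: "indep_rv borel (W 0 i) WW (env (- 1))"
proof -
  let ?A = "{(0 :: int, i)}" and ?B = "{..-1 :: int} \<times> (UNIV :: 'd set)"
  let ?r = "\<lambda>A \<omega>. restrict (\<lambda>ni. (Q (fst ni) (snd ni) \<omega>, M (fst ni) (snd ni) \<omega>)) A"
  have "indep_var (PiM ?A (\<lambda>_. borel)) (?r ?A) (PiM ?B (\<lambda>_. borel)) (?r ?B)"
    by (rule indep_var_restrict[OF indep_W]) auto
  note ind = indep_rv_of_indep_var[OF this]
  have m1: "(\<lambda>f. f (0, i)) \<in> measurable (PiM ?A (\<lambda>_. borel)) (borel :: (real \<times> real) measure)"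
    by (rule measurable_component_singleton) simp
  have m2: "(\<lambda>f kd. f (- 1 - int (fst kd), snd kd)) \<in> measurable (PiM ?B (\<lambda>_. borel)) WW"
  proof (rule measurable_PiM_single')
    fix kd :: "nat \<times> 'd"
    show "(\<lambda>f. f (- 1 - int (fst kd), snd kd)) \<in> measurable (PiM ?B (\<lambda>_. borel)) (borel :: (real \<times> real) measure)"
      by (rule measurable_component_singleton) simp
  qed simp
  from indep_rv_compose[OF ind m1 m2]
  have "indep_rv borel (\<lambda>\<omega>. ?r ?A \<omega> (0, i)) WW (\<lambda>\<omega> kd. ?r ?B \<omega> (- 1 - int (fst kd), snd kd))"
    .
  then show ?thesis
    by (simp add: W_def[abs_def] env_def[abs_def])
qed

definition Xall :: "'a \<Rightarrow> int \<Rightarrow> 'd" where "Xall \<omega> = (\<lambda>n. X n \<omega>)"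

lemma indep_X_env2: "indep_rv (PiM UNIV (\<lambda>_. count_space UNIV)) Xall
    (borel \<Otimes>\<^sub>M WW) (\<lambda>\<omega>. (W 0 i \<omega>, env n \<omega>))"
proof -
  have "(\<lambda>f. (f (0, i), \<lambda>kd. f (n - int (fst kd), snd kd))) \<in> measurable (PiM UNIV (\<lambda>_. borel)) (borel \<Otimes>\<^sub>M WW)"
    by (intro measurable_Pair measurable_PiM_single') auto
  from indep_rv_compose[OF indep_XW measurable_ident_sets[OF refl] this]
  show ?thesis
    by (simp add: W_def[abs_def] env_def[abs_def] Xall_def[abs_def])
qed

text \<open>This is the independence behind the recursion: the previous value of the perpetuity is a
  function of the chain and of \<open>env (- 1)\<close>, and the condition \<open>X 0 = i\<close>
  concerns the chain alone. The chain is independent of the whole array, and rotating the grouping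
  moves the coefficients at time 0 to the other side.\<close>

lemma indep_W0: "indep_rv borel (W 0 i) (PiM UNIV (\<lambda>_. count_space UNIV) \<Otimes>\<^sub>M WW) (\<lambda>\<omega>. (Xall \<omega>, env (- 1) \<omega>))"
  by (rule indep_rv_rotate[OF indep_X_env2 indep_W0_env])

lemma indep_X_env: "indep_rv (PiM UNIV (\<lambda>_. count_space UNIV)) Xall WW (env n)"
  using indep_rv_compose[OF indep_X_env2 measurable_ident_sets[OF refl] measurable_snd] by simp

end

context prob_space
begin

text \<open>Fubini for an independent pair, with the second entry frozen. It reduces identities on
  joint events to events of the first entry alone; the companion below freezes the first
  entry.\<close>

lemma indep_rv_slice_snd:
  assumes ind: "indep_rv S Y T Z" and E: "E \<in> sets (S \<Otimes>\<^sub>M T)"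
  shows "emeasure M {x \<in> space M. (Y x, Z x) \<in> E}
    = (\<integral>\<^sup>+z. emeasure M {x \<in> space M. (Y x, z) \<in> E} \<partial>distr M T Z)"
proof -
  note rv[measurable] = indep_rv_rv[OF ind]
  interpret Y: prob_space "distr M S Y" by (rule prob_space_distr) measurable
  interpret Z: prob_space "distr M T Z" by (rule prob_space_distr) measurable
  interpret YZ: pair_prob_space "distr M S Y" "distr M T Z" ..
  have E': "E \<in> sets (distr M S Y \<Otimes>\<^sub>M distr M T Z)" using E by (simp cong: sets_pair_measure_cong)
  have "emeasure M {x \<in> space M. (Y x, Z x) \<in> E} = emeasure (distr M (S \<Otimes>\<^sub>M T) (\<lambda>x. (Y x, Z x))) E"
    using E by (subst emeasure_distr) (auto intro!: arg_cong[where f = "emeasure M"])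
  also have "\<dots> = (\<integral>\<^sup>+z. emeasure (distr M S Y) ((\<lambda>y. (y, z)) -` E) \<partial>distr M T Z)"
    unfolding indep_rv_distr[OF ind, symmetric] by (rule YZ.emeasure_pair_measure_alt2[OF E'])
  also have "\<dots> = (\<integral>\<^sup>+z. emeasure M {x \<in> space M. (Y x, z) \<in> E} \<partial>distr M T Z)"
    using sets_Pair2[OF E]
    by (intro nn_integral_cong, subst emeasure_distr) (auto intro!: arg_cong[where f = "emeasure M"])
  finally show ?thesis .
qed

lemma indep_rv_slice_fst:
  assumes ind: "indep_rv S Y T Z" and E: "E \<in> sets (S \<Otimes>\<^sub>M T)"
  shows "emeasure M {x \<in> space M. (Y x, Z x) \<in> E}
    = (\<integral>\<^sup>+y. emeasure M {x \<in> space M. (y, Z x) \<in> E} \<partial>distr M S Y)"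
proof -
  note rv[measurable] = indep_rv_rv[OF ind]
  interpret Y: prob_space "distr M S Y" by (rule prob_space_distr) measurable
  interpret Z: prob_space "distr M T Z" by (rule prob_space_distr) measurable
  have E': "E \<in> sets (distr M S Y \<Otimes>\<^sub>M distr M T Z)" using E by (simp cong: sets_pair_measure_cong)
  have "emeasure M {x \<in> space M. (Y x, Z x) \<in> E} = emeasure (distr M (S \<Otimes>\<^sub>M T) (\<lambda>x. (Y x, Z x))) E"
    using E by (subst emeasure_distr) (auto intro!: arg_cong[where f = "emeasure M"])
  also have "\<dots> = (\<integral>\<^sup>+y. emeasure (distr M T Z) (Pair y -` E) \<partial>distr M S Y)"
    unfolding indep_rv_distr[OF ind, symmetric] by (rule Z.emeasure_pair_measure_alt[OF E'])
  also have "\<dots> = (\<integral>\<^sup>+y. emeasure M {x \<in> space M. (y, Z x) \<in> E} \<partial>distr M S Y)"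
    using sets_Pair1[OF E]
    by (intro nn_integral_cong, subst emeasure_distr) (auto intro!: arg_cong[where f = "emeasure M"])
  finally show ?thesis .
qed

end

section \<open>The law of the past of the chain, from finite paths to all events\<close>

context mc_env
begin

definition path_weight :: "'d list \<Rightarrow> real" where
  "path_weight a = \<pi> (hd a) * (\<Prod>l < length a - 1. p (a ! l) (a ! Suc l))"

lemma path_weight_snoc:
  assumes "a \<noteq> []"
  shows "path_weight (a @ [i]) = path_weight a * p (last a) i"
proof -
  obtain k where k: "length a = Suc k" using assms by (cases a) auto
  have "(\<Prod>l < Suc k. p ((a @ [i]) ! l) ((a @ [i]) ! Suc l))
      = (\<Prod>l < k. p ((a @ [i]) ! l) ((a @ [i]) ! Suc l)) * p ((a @ [i]) ! k) ((a @ [i]) ! Suc k)"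
    by simp
  also have "(\<Prod>l < k. p ((a @ [i]) ! l) ((a @ [i]) ! Suc l)) = (\<Prod>l < k. p (a ! l) (a ! Suc l))"
    using k by (intro prod.cong) (auto simp: nth_append)
  also have "(a @ [i]) ! k = last a" using assms k by (simp add: nth_append last_conv_nth)
  also have "(a @ [i]) ! Suc k = i" using k by (simp add: nth_append)
  finally show ?thesis using assms k by (simp add: path_weight_def)
qed

text \<open>Windows run forward in time, as the formula for path probabilities does, whereas
  \<open>past\<close> runs backwards.\<close>

definition window :: "nat \<Rightarrow> int \<Rightarrow> 'a \<Rightarrow> 'd list" where
  "window m n \<omega> = map (\<lambda>l. X (n + int l) \<omega>) [0..<m]"

lemma window_eq_iff: "window m n \<omega> = a \<longleftrightarrow> length a = m \<and> (\<forall>l < length a. X (n + int l) \<omega> = a ! l)"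
  by (auto simp: window_def list_eq_iff_nth_eq)

lemma length_window [simp]: "length (window m n \<omega>) = m"
  by (simp add: window_def)

lemma window_nth: "l < m \<Longrightarrow> window m n \<omega> ! l = X (n + int l) \<omega>"
  by (simp add: window_def)

lemma window_Suc: "window (Suc m) n \<omega> = window m n \<omega> @ [X (n + int m) \<omega>]"
  by (simp add: window_def)

lemma window_meas [measurable]: "window m n \<in> measurable P (count_space UNIV)"
proof (subst measurable_count_space_eq_countable)
  have "window m n -` {a} \<inter> space P \<in> sets P" for a
  proof -
    have "{\<omega> \<in> space P. length a = m \<and> (\<forall>l < length a. X (n + int l) \<omega> = a ! l)} \<in> sets P"
      by measurable
    also have "{\<omega> \<in> space P. length a = m \<and> (\<forall>l < length a. X (n + int l) \<omega> = a ! l)} = window m n -` {a} \<inter> space P"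
      by (auto simp: window_eq_iff window_nth)
    finally show ?thesis .
  qed
  then show "window m n \<in> space P \<rightarrow> UNIV \<and> (\<forall>a\<in>UNIV. window m n -` {a} \<inter> space P \<in> sets P)" by auto
qed auto

lemma prob_window:
  assumes "a \<noteq> []" shows "prob {\<omega> \<in> space P. window (length a) n \<omega> = a} = path_weight a"
  using path_prob[OF assms, of n] by (simp add: window_eq_iff path_weight_def)

lemma prob_X: "prob {\<omega> \<in> space P. X n \<omega> = i} = \<pi> i"
  using path_prob[of "[i]" n] by simp

lemma prob_X2: "prob {\<omega> \<in> space P. X n \<omega> = i \<and> X (n + 1) \<omega> = j} = \<pi> i * p i j"
proof -
  have "{\<omega> \<in> space P. X n \<omega> = i \<and> X (n + 1) \<omega> = j}
      = {\<omega> \<in> space P. \<forall>l < length [i, j]. X (n + int l) \<omega> = [i, j] ! l}"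
    by (auto simp: less_Suc_eq nth_Cons')
  then show ?thesis using path_prob[of "[i, j]" n] by simp
qed

lemma p_nonneg: "0 \<le> p i j" using stoch by (simp add: stochastic_matrix_def)

lemma pi_nonneg: "0 \<le> \<pi> i" using prob_X[of 0 i] measure_nonneg[of P] by metis

text \<open>The probabilities of \<open>X 0 = j\<close> over all \<open>j\<close> add up to 1, so
  some \<open>\<pi> j\<close> is positive, and positivity is carried along a path of positive
  transitions to any \<open>i\<close>. It makes every conditioning on \<open>X 0 = i\<close>
  meaningful.\<close>

lemma pi_pos: "0 < \<pi> i"
proof -
  have "\<exists>j. 0 < \<pi> j"
  proof (rule ccontr)
    assume "\<not> (\<exists>j. 0 < \<pi> j)"
    then have z: "\<pi> j = 0" for j using pi_nonneg[of j] by (auto simp: not_less antisym)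
    have "emeasure P (\<Union>j\<in>UNIV. {\<omega> \<in> space P. X 0 \<omega> = j}) = (\<integral>\<^sup>+j. emeasure P {\<omega> \<in> space P. X 0 \<omega> = j} \<partial>count_space UNIV)"
      by (rule emeasure_UN_countable) (auto simp: disjoint_family_on_def)
    also have "\<dots> = 0" by (simp add: emeasure_eq_measure prob_X z)
    also have "(\<Union>j\<in>UNIV. {\<omega> \<in> space P. X 0 \<omega> = j}) = space P" by auto
    finally show False by (simp add: emeasure_space_1)
  qed
  then obtain j where j: "0 < \<pi> j" ..
  have step: "0 < \<pi> l" if "0 < \<pi> k" "0 < p k l" for k l
  proof -
    have "0 < \<pi> k * p k l" using that by simp
    also have "\<dots> = prob {\<omega> \<in> space P. X 0 \<omega> = k \<and> X (0 + 1) \<omega> = l}" by (rule prob_X2[symmetric])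
    also have "\<dots> \<le> prob {\<omega> \<in> space P. X 1 \<omega> = l}" by (intro finite_measure_mono) auto
    finally show ?thesis by (simp add: prob_X)
  qed
  obtain path where path: "path \<noteq> []" "hd path = j" "last path = i"
    "\<And>l. Suc l < length path \<Longrightarrow> 0 < p (path ! l) (path ! Suc l)"
    using irred unfolding irreducible_matrix_def by metis
  have "l < length path \<Longrightarrow> 0 < \<pi> (path ! l)" for l
  proof (induction l)
    case 0
    then show ?case using path j by (simp add: hd_conv_nth)
  next
    case (Suc l)
    then show ?case using step[of "path ! l" "path ! Suc l"] path(4) by simp
  qed
  from this[of "length path - 1"] show ?thesis using path by (simp add: last_conv_nth)
qed

text \<open>For a single list \<open>a\<close> ending in \<open>j\<close>, appending
  \<open>i\<close> multiplies the path weight by \<open>p j i\<close>, and path weights do not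
  depend on the starting time. The two windows cover the times \<open>-m\<close> to
  \<open>-1\<close> and \<open>1-m\<close> to \<open>0\<close>; as \<open>m\<close> is positive,
  their last entries are \<open>X (- 1)\<close> and \<open>X 0\<close>.\<close>

lemma window_law:
  assumes m: "0 < m"
  shows "emeasure P {\<omega> \<in> space P. X 0 \<omega> = i \<and> X (- 1) \<omega> = j \<and> window m (- int m) \<omega> \<in> S}
    = ennreal (p j i) * emeasure P {\<omega> \<in> space P. X 0 \<omega> = j \<and> window m (1 - int m) \<omega> \<in> S}"
proof -
  have last1: "X (- 1) \<omega> = last (window m (- int m) \<omega>)" for \<omega>
    using m by (subst last_conv_nth) (auto simp: window_nth simp flip: length_0_conv)
  have last0: "X 0 \<omega> = last (window m (1 - int m) \<omega>)" for \<omega>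
    using m by (subst last_conv_nth) (auto simp: window_nth simp flip: length_0_conv)
  have sing: "emeasure P {\<omega> \<in> space P. X 0 \<omega> = i \<and> X (- 1) \<omega> = j \<and> window m (- int m) \<omega> = a}
    = ennreal (p j i) * emeasure P {\<omega> \<in> space P. X 0 \<omega> = j \<and> window m (1 - int m) \<omega> = a}" for a
  proof (cases "length a = m \<and> last a = j")
    case True
    then have a: "a \<noteq> []" "length a = m" "last a = j" using m by auto
    have "{\<omega> \<in> space P. X 0 \<omega> = i \<and> X (- 1) \<omega> = j \<and> window m (- int m) \<omega> = a}
        = {\<omega> \<in> space P. window (length (a @ [i])) (- int m) \<omega> = a @ [i]}"
      using a by (auto simp: window_Suc last1)
    moreover have "{\<omega> \<in> space P. X 0 \<omega> = j \<and> window m (1 - int m) \<omega> = a}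
        = {\<omega> \<in> space P. window (length a) (1 - int m) \<omega> = a}"
      using a by (auto simp: last0)
    ultimately show ?thesis
      using a prob_window[of "a @ [i]" "- int m"] prob_window[of a "1 - int m"]
      by (simp add: emeasure_eq_measure path_weight_snoc ennreal_mult'[symmetric] p_nonneg mult.commute
        del: length_append)
  next
    case False
    then have "{\<omega> \<in> space P. X 0 \<omega> = i \<and> X (- 1) \<omega> = j \<and> window m (- int m) \<omega> = a} = {}"
      "{\<omega> \<in> space P. X 0 \<omega> = j \<and> window m (1 - int m) \<omega> = a} = {}"
      using last1 last0 by auto
    then show ?thesis by (simp only: emeasure_empty mult_zero_right)
  qed
  have "emeasure P {\<omega> \<in> space P. X 0 \<omega> = i \<and> X (- 1) \<omega> = j \<and> window m (- int m) \<omega> \<in> S}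
      = emeasure P (\<Union>a\<in>S. {\<omega> \<in> space P. X 0 \<omega> = i \<and> X (- 1) \<omega> = j \<and> window m (- int m) \<omega> = a})"
    by (intro arg_cong[where f = "emeasure P"]) auto
  also have "\<dots> = (\<integral>\<^sup>+a. emeasure P {\<omega> \<in> space P. X 0 \<omega> = i \<and> X (- 1) \<omega> = j \<and> window m (- int m) \<omega> = a} \<partial>count_space S)"
    by (rule emeasure_UN_countable) (auto simp: disjoint_family_on_def)
  also have "\<dots> = (\<integral>\<^sup>+a. ennreal (p j i) * emeasure P {\<omega> \<in> space P. X 0 \<omega> = j \<and> window m (1 - int m) \<omega> = a} \<partial>count_space S)"
    by (simp only: sing)
  also have "\<dots> = ennreal (p j i) * (\<integral>\<^sup>+a. emeasure P {\<omega> \<in> space P. X 0 \<omega> = j \<and> window m (1 - int m) \<omega> = a} \<partial>count_space S)"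
    by (rule nn_integral_cmult) auto
  also have "(\<integral>\<^sup>+a. emeasure P {\<omega> \<in> space P. X 0 \<omega> = j \<and> window m (1 - int m) \<omega> = a} \<partial>count_space S)
      = emeasure P (\<Union>a\<in>S. {\<omega> \<in> space P. X 0 \<omega> = j \<and> window m (1 - int m) \<omega> = a})"
    by (rule emeasure_UN_countable[symmetric]) (auto simp: disjoint_family_on_def)
  also have "(\<Union>a\<in>S. {\<omega> \<in> space P. X 0 \<omega> = j \<and> window m (1 - int m) \<omega> = a})
      = {\<omega> \<in> space P. X 0 \<omega> = j \<and> window m (1 - int m) \<omega> \<in> S}" by auto
  finally show ?thesis .
qed

text \<open>Both sides are finite measures in \<open>A\<close>. Cylinder sets depend on finitely
  many coordinates, hence on a window, where \<open>window_law\<close> gives equality; cylinders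
  determine a measure on the sequence space.\<close>

lemma past_law:
  assumes A: "A \<in> sets SS"
  shows "emeasure P {\<omega> \<in> space P. X 0 \<omega> = i \<and> X (- 1) \<omega> = j \<and> past (- 1) \<omega> \<in> A}
    = ennreal (p j i) * emeasure P {\<omega> \<in> space P. X 0 \<omega> = j \<and> past 0 \<omega> \<in> A}"
proof -
  define E1 where "E1 = {\<omega> \<in> space P. X 0 \<omega> = i \<and> X (- 1) \<omega> = j}"
  define E0 where "E0 = {\<omega> \<in> space P. X 0 \<omega> = j}"
  have [measurable]: "E1 \<in> sets P" "E0 \<in> sets P" unfolding E1_def E0_def by measurable
  define N1 where "N1 = distr (density P (indicator E1)) SS (past (- 1))"
  define N0 where "N0 = scale_measure (ennreal (p j i)) (distr (density P (indicator E0)) SS (past 0))"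
  have past_meas': "past n \<in> measurable (density P f) SS" for n f
    using past_meas[of n] by (simp cong: measurable_cong_sets)
  have N1: "emeasure N1 B = emeasure P {\<omega> \<in> space P. X 0 \<omega> = i \<and> X (- 1) \<omega> = j \<and> past (- 1) \<omega> \<in> B}"
    if [measurable]: "B \<in> sets SS" for B
  proof -
    have [measurable]: "past (- 1) -` B \<inter> space P \<in> sets P" by measurable
    have "emeasure N1 B = emeasure P (E1 \<inter> (past (- 1) -` B \<inter> space P))"
      unfolding N1_def using past_meas' that
      by (subst emeasure_distr) (auto simp: emeasure_restricted)
    also have "E1 \<inter> (past (- 1) -` B \<inter> space P) = {\<omega> \<in> space P. X 0 \<omega> = i \<and> X (- 1) \<omega> = j \<and> past (- 1) \<omega> \<in> B}"
      by (auto simp: E1_def)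
    finally show ?thesis .
  qed
  have N0: "emeasure N0 B = ennreal (p j i) * emeasure P {\<omega> \<in> space P. X 0 \<omega> = j \<and> past 0 \<omega> \<in> B}"
    if [measurable]: "B \<in> sets SS" for B
  proof -
    have [measurable]: "past 0 -` B \<inter> space P \<in> sets P" by measurable
    have "emeasure (distr (density P (indicator E0)) SS (past 0)) B = emeasure P (E0 \<inter> (past 0 -` B \<inter> space P))"
      using past_meas' that
      by (subst emeasure_distr) (auto simp: emeasure_restricted)
    also have "E0 \<inter> (past 0 -` B \<inter> space P) = {\<omega> \<in> space P. X 0 \<omega> = j \<and> past 0 \<omega> \<in> B}"
      by (auto simp: E0_def)
    finally show ?thesis by (simp add: N0_def)
  qed
  have "N1 = N0"
  proof (rule measure_eqI_PiM_infinite)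
    show "sets N1 = sets SS" "sets N0 = sets SS" by (simp_all add: N1_def N0_def)
    show "finite_measure N1"
    proof
      have "UNIV \<in> sets SS" using sets.top[of SS] by (simp add: space_PiM)
      then show "emeasure N1 (space N1) \<noteq> \<infinity>"
        using N1[of UNIV] by (simp add: N1_def space_PiM emeasure_eq_measure)
    qed
    fix A :: "nat \<Rightarrow> 'd set" and J :: "nat set" assume J: "finite J"
    let ?C = "prod_emb UNIV (\<lambda>_. count_space UNIV) J (Pi\<^sub>E J A)"
    have C: "?C \<in> sets SS" by (rule sets_PiM_I) (use J in auto)
    have C_iff: "x \<in> ?C \<longleftrightarrow> (\<forall>k\<in>J. x k \<in> A k)" for x
      by (auto simp: prod_emb_def PiE_iff)
    define m where "m = Suc (Max (insert 0 J))"
    have m: "0 < m" "\<And>k. k \<in> J \<Longrightarrow> k < m"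
      using J by (auto simp: m_def less_Suc_eq_le)
    \<comment> \<open>Reversal of time: position \<open>m - 1 - k\<close> of a window holds
      coordinate \<open>k\<close> of the past. The choice of \<open>m\<close> makes every
      \<open>k\<close> in \<open>J\<close> smaller than \<open>m\<close>, also when \<open>J\<close>
      is empty.\<close>
    define S where "S = {xs :: 'd list. \<forall>k\<in>J. xs ! (m - 1 - k) \<in> A k}"
    have w1: "window m (- int m) \<omega> ! (m - 1 - k) = past (- 1) \<omega> k" if "k \<in> J" for k \<omega>
      using m(2)[OF that] by (simp add: window_nth past_def of_nat_diff algebra_simps)
    have w0: "window m (1 - int m) \<omega> ! (m - 1 - k) = past 0 \<omega> k" if "k \<in> J" for k \<omega>
      using m(2)[OF that] by (simp add: window_nth past_def of_nat_diff algebra_simps)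
    have "past (- 1) \<omega> \<in> ?C \<longleftrightarrow> window m (- int m) \<omega> \<in> S"
      "past 0 \<omega> \<in> ?C \<longleftrightarrow> window m (1 - int m) \<omega> \<in> S" for \<omega>
      unfolding C_iff S_def using w1 w0 by auto
    then show "emeasure N1 ?C = emeasure N0 ?C"
      unfolding N1[OF C] N0[OF C] using window_law[OF m(1), of i j S] by simp
  qed
  then show ?thesis using N1[OF A] N0[OF A] by simp
qed

text \<open>Freeze the environment, use \<open>past_law\<close> on the section of \<open>E\<close>,
  and integrate back: \<open>env (- 1)\<close> and \<open>env 0\<close> have the same law, and each
  is independent of the chain.\<close>

lemma past_env_law:
  assumes E: "E \<in> sets (SS \<Otimes>\<^sub>M WW)"
  shows "emeasure P {\<omega> \<in> space P. X 0 \<omega> = i \<and> X (- 1) \<omega> = j \<and> (past (- 1) \<omega>, env (- 1) \<omega>) \<in> E}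
    = ennreal (p j i) * emeasure P {\<omega> \<in> space P. X 0 \<omega> = j \<and> (past 0 \<omega>, env 0 \<omega>) \<in> E}"
proof -
  note [measurable] = E
  let ?T = "count_space UNIV \<Otimes>\<^sub>M (count_space UNIV \<Otimes>\<^sub>M SS)"
  have V: "(\<lambda>x. (x 0, x (- 1), (\<lambda>k. x (n - int k)))) \<in> measurable (PiM UNIV (\<lambda>_. count_space UNIV)) ?T" for n
    by (intro measurable_Pair measurable_PiM_single') auto
  have ind: "indep_rv ?T (\<lambda>\<omega>. (X 0 \<omega>, X (- 1) \<omega>, past n \<omega>)) WW (env n)" for n
    using indep_rv_compose[OF indep_X_env V measurable_ident_sets[OF refl], of n n]
    by (simp add: Xall_def past_def)
  let ?E1 = "{z \<in> space (?T \<Otimes>\<^sub>M WW). fst (fst z) = i \<and> fst (snd (fst z)) = j \<and> (snd (snd (fst z)), snd z) \<in> E}"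
  let ?E0 = "{z \<in> space (?T \<Otimes>\<^sub>M WW). fst (fst z) = j \<and> (snd (snd (fst z)), snd z) \<in> E}"
  have E1: "?E1 \<in> sets (?T \<Otimes>\<^sub>M WW)" and E0: "?E0 \<in> sets (?T \<Otimes>\<^sub>M WW)" by measurable
  have sp: "space (?T \<Otimes>\<^sub>M WW) = UNIV" by (auto simp: space_pair_measure space_PiM)
  have "emeasure P {\<omega> \<in> space P. X 0 \<omega> = i \<and> X (- 1) \<omega> = j \<and> (past (- 1) \<omega>, env (- 1) \<omega>) \<in> E}
      = (\<integral>\<^sup>+v. emeasure P {\<omega> \<in> space P. X 0 \<omega> = i \<and> X (- 1) \<omega> = j \<and> (past (- 1) \<omega>, v) \<in> E} \<partial>distr P WW (env (- 1)))"
    using indep_rv_slice_snd[OF ind E1] unfolding sp by simp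
  also have "\<dots> = (\<integral>\<^sup>+v. ennreal (p j i) * emeasure P {\<omega> \<in> space P. X 0 \<omega> = j \<and> (past 0 \<omega>, v) \<in> E} \<partial>distr P WW (env 0))"
    unfolding distr_env
  proof (rule nn_integral_cong)
    fix v :: "nat \<times> 'd \<Rightarrow> real \<times> real"
    have "(\<lambda>x. (x, v)) -` E \<in> sets SS" by (rule sets_Pair2[OF E])
    from past_law[OF this, of i j]
    show "emeasure P {\<omega> \<in> space P. X 0 \<omega> = i \<and> X (- 1) \<omega> = j \<and> (past (- 1) \<omega>, v) \<in> E}
       = ennreal (p j i) * emeasure P {\<omega> \<in> space P. X 0 \<omega> = j \<and> (past 0 \<omega>, v) \<in> E}" by simp
  qed
  also have "\<dots> = ennreal (p j i) * (\<integral>\<^sup>+v. emeasure P {\<omega> \<in> space P. X 0 \<omega> = j \<and> (past 0 \<omega>, v) \<in> E} \<partial>distr P WW (env 0))"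
  proof (rule nn_integral_cmult)
    interpret Y: prob_space "distr P SS (past 0)" by (rule prob_space_distr) measurable
    \<comment> \<open>Restricting \<open>P\<close> to \<open>X 0 = j\<close> turns the integrand
      into the measure of a section, so its measurability in \<open>v\<close> is an instance of
      \<open>measurable_emeasure\<close>.\<close>
    define D where "D = density P (indicator {\<omega> \<in> space P. X 0 \<omega> = j})"
    have *: "emeasure P {\<omega> \<in> space P. X 0 \<omega> = j \<and> (past 0 \<omega>, v) \<in> E} =
        emeasure D {\<omega> \<in> space D. (past 0 \<omega>, v) \<in> E}" for v
    proof -
      have v: "(\<lambda>x. (x, v)) -` E \<in> sets SS" by (rule sets_Pair2[OF E])
      have "{\<omega> \<in> space P. (past 0 \<omega>, v) \<in> E} = past 0 -` ((\<lambda>x. (x, v)) -` E) \<inter> space P" by auto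
      also have "\<dots> \<in> sets P" using v by measurable
      finally show ?thesis unfolding D_def
        by (subst space_density, subst emeasure_restricted) (auto intro!: arg_cong[where f = "emeasure P"])
    qed
    interpret D: finite_measure D
      by (rule finite_measureI) (simp add: D_def emeasure_restricted emeasure_eq_measure)
    have "(\<lambda>v. emeasure D {\<omega> \<in> space D. (past 0 \<omega>, v) \<in> E}) \<in> borel_measurable WW"
    proof (rule D.measurable_emeasure)
      have "{x \<in> space (WW \<Otimes>\<^sub>M D). (past 0 (snd x), fst x) \<in> E} \<in> sets (WW \<Otimes>\<^sub>M D)"
        unfolding D_def by measurable
      also have "{x \<in> space (WW \<Otimes>\<^sub>M D). (past 0 (snd x), fst x) \<in> E}
          = {x \<in> space (WW \<Otimes>\<^sub>M D). snd x \<in> {\<omega> \<in> space D. (past 0 \<omega>, fst x) \<in> E}}"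
        by (auto simp: space_pair_measure)
      finally show "{x \<in> space (WW \<Otimes>\<^sub>M D). snd x \<in> {\<omega> \<in> space D. (past 0 \<omega>, fst x) \<in> E}} \<in> sets (WW \<Otimes>\<^sub>M D)" .
    qed auto
    then show "(\<lambda>v. emeasure P {\<omega> \<in> space P. X 0 \<omega> = j \<and> (past 0 \<omega>, v) \<in> E}) \<in> borel_measurable (distr P WW (env 0))"
      unfolding * by simp
  qed
  also have "(\<integral>\<^sup>+v. emeasure P {\<omega> \<in> space P. X 0 \<omega> = j \<and> (past 0 \<omega>, v) \<in> E} \<partial>distr P WW (env 0))
      = emeasure P {\<omega> \<in> space P. X 0 \<omega> = j \<and> (past 0 \<omega>, env 0 \<omega>) \<in> E}"
    using indep_rv_slice_snd[OF ind E0] unfolding sp by simp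
  finally show ?thesis .
qed

end

section \<open>Conditioning on the present state and one step of the recursion\<close>

context mc_env
begin

definition cond_law :: "'d \<Rightarrow> ('a \<Rightarrow> real) \<Rightarrow> real measure" where
  "cond_law i Y = distr (uniform_measure P {\<omega> \<in> space P. X 0 \<omega> = i}) borel Y"

lemma sets_cond_law [simp, measurable_cong]: "sets (cond_law i Y) = sets borel"
  by (simp add: cond_law_def)

lemma space_cond_law [simp]: "space (cond_law i Y) = UNIV"
  by (simp add: cond_law_def)

lemma prob_space_cond_law:
  assumes "Y \<in> borel_measurable P" shows "prob_space (cond_law i Y)"
  unfolding cond_law_def
proof (rule prob_space.prob_space_distr)
  show "prob_space (uniform_measure P {\<omega> \<in> space P. X 0 \<omega> = i})"
    using pi_pos[of i] by (intro prob_space_uniform_measure) (auto simp: emeasure_eq_measure prob_X)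
qed (use assms in simp)

lemma measure_cond_law:
  assumes [measurable]: "Y \<in> borel_measurable P" "B \<in> sets borel"
  shows "measure (cond_law i Y) B = prob {\<omega> \<in> space P. X 0 \<omega> = i \<and> Y \<omega> \<in> B} / \<pi> i"
proof -
  have *: "Y -` B \<inter> space P \<in> sets P" by measurable
  have "measure (cond_law i Y) B = measure (uniform_measure P {\<omega> \<in> space P. X 0 \<omega> = i}) (Y -` B \<inter> space P)"
    unfolding cond_law_def by (subst measure_distr) auto
  also have "\<dots> = prob ({\<omega> \<in> space P. X 0 \<omega> = i} \<inter> (Y -` B \<inter> space P)) / prob {\<omega> \<in> space P. X 0 \<omega> = i}"
    using pi_pos[of i] * by (subst measure_uniform_measure) (auto simp: emeasure_eq_measure prob_X)
  also have "{\<omega> \<in> space P. X 0 \<omega> = i} \<inter> (Y -` B \<inter> space P) = {\<omega> \<in> space P. X 0 \<omega> = i \<and> Y \<omega> \<in> B}" by auto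
  finally show ?thesis by (simp add: prob_X)
qed

lemma rev_trans_eq: "rev_trans P X i j = \<pi> j * p j i / \<pi> i"
  using prob_X2[of 0 j i] prob_X[of 1 i] by (simp add: rev_trans_def)

lemma rev_trans_nonneg: "0 \<le> rev_trans P X i j"
  by (simp add: rev_trans_def)

text \<open>Rows of the reversed matrix as probability mass functions, so that sums against
  \<open>H(i,j)\<close> become expectations and the integration theorems apply. They sum to 1
  because the events \<open>X 0 = j\<close> partition \<open>X 1 = i\<close>.\<close>

definition rev_pmf :: "'d \<Rightarrow> 'd pmf" where
  "rev_pmf i = embed_pmf (rev_trans P X i)"

lemma pmf_rev_pmf: "pmf (rev_pmf i) j = rev_trans P X i j"
  unfolding rev_pmf_def
proof (rule pmf_embed_pmf)
  have "(\<integral>\<^sup>+j. ennreal (rev_trans P X i j) \<partial>count_space UNIV)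
      = (\<integral>\<^sup>+j. emeasure P {\<omega> \<in> space P. X 0 \<omega> = j \<and> X 1 \<omega> = i} / ennreal (\<pi> i) \<partial>count_space UNIV)"
    using pi_pos[of i] by (simp add: rev_trans_def prob_X emeasure_eq_measure divide_ennreal)
  also have "\<dots> = (\<integral>\<^sup>+j. emeasure P {\<omega> \<in> space P. X 0 \<omega> = j \<and> X 1 \<omega> = i} \<partial>count_space UNIV) / ennreal (\<pi> i)"
    by (rule nn_integral_divide) auto
  also have "(\<integral>\<^sup>+j. emeasure P {\<omega> \<in> space P. X 0 \<omega> = j \<and> X 1 \<omega> = i} \<partial>count_space UNIV)
      = emeasure P (\<Union>j\<in>UNIV. {\<omega> \<in> space P. X 0 \<omega> = j \<and> X 1 \<omega> = i})"
    by (rule emeasure_UN_countable[symmetric]) (auto simp: disjoint_family_on_def)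
  also have "(\<Union>j\<in>UNIV. {\<omega> \<in> space P. X 0 \<omega> = j \<and> X 1 \<omega> = i}) = {\<omega> \<in> space P. X 1 \<omega> = i}" by auto
  also have "emeasure P {\<omega> \<in> space P. X 1 \<omega> = i} / ennreal (\<pi> i) = 1"
    using pi_pos[of i] by (simp add: emeasure_eq_measure prob_X divide_ennreal)
  finally show "(\<integral>\<^sup>+j. ennreal (rev_trans P X i j) \<partial>count_space UNIV) = 1" .
qed (rule rev_trans_nonneg)

text \<open>Bayes' formula: \<open>\<pi> j * p j i\<close> equals \<open>\<pi> i\<close> times the
  reversed transition from \<open>i\<close> to \<open>j\<close>, and by \<open>past_env_law\<close>
  the state at time 0 carries no further information about the past once the state at time -1 is
  \<open>j\<close>.\<close>

lemma cond_law_shift: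
  assumes G [measurable]: "G \<in> borel_measurable (SS \<Otimes>\<^sub>M WW)" and B [measurable]: "B \<in> sets borel"
  shows "measure (cond_law i (\<lambda>\<omega>. G (past (- 1) \<omega>, env (- 1) \<omega>))) B
    = (\<integral>j. measure (cond_law j (\<lambda>\<omega>. G (past 0 \<omega>, env 0 \<omega>))) B \<partial>rev_pmf i)"
proof -
  let ?E = "{z \<in> space (SS \<Otimes>\<^sub>M WW). G z \<in> B}"
  let ?f = "\<lambda>j. measure (cond_law j (\<lambda>\<omega>. G (past 0 \<omega>, env 0 \<omega>))) B"
  have sp: "space (SS \<Otimes>\<^sub>M WW) = UNIV" by (auto simp: space_pair_measure space_PiM)
  have E: "?E \<in> sets (SS \<Otimes>\<^sub>M WW)" by measurable
  have f: "0 \<le> ?f j" "?f j \<le> 1" for j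
    using prob_space.prob_le_1[OF prob_space_cond_law] by auto
  have int: "integrable (rev_pmf i) ?f"
    by (rule measure_pmf.integrable_const_bound[where B = 1]) (use f in auto)
  have meas1: "(\<lambda>\<omega>. G (past (- 1) \<omega>, env (- 1) \<omega>)) \<in> borel_measurable P" by measurable
  have meas0: "(\<lambda>\<omega>. G (past 0 \<omega>, env 0 \<omega>)) \<in> borel_measurable P" by measurable
  have "ennreal (prob {\<omega> \<in> space P. X 0 \<omega> = i \<and> G (past (- 1) \<omega>, env (- 1) \<omega>) \<in> B})
      = emeasure P (\<Union>j\<in>UNIV. {\<omega> \<in> space P. X 0 \<omega> = i \<and> X (- 1) \<omega> = j \<and> (past (- 1) \<omega>, env (- 1) \<omega>) \<in> ?E})"
    unfolding emeasure_eq_measure by (intro arg_cong[where f = "\<lambda>A. ennreal (prob A)"]) (auto simp: sp)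
  also have "\<dots> = (\<integral>\<^sup>+j. emeasure P {\<omega> \<in> space P. X 0 \<omega> = i \<and> X (- 1) \<omega> = j \<and> (past (- 1) \<omega>, env (- 1) \<omega>) \<in> ?E} \<partial>count_space UNIV)"
    by (rule emeasure_UN_countable) (auto simp: disjoint_family_on_def)
  also have "\<dots> = (\<integral>\<^sup>+j. ennreal (\<pi> i) * (ennreal (pmf (rev_pmf i) j) * ennreal (?f j)) \<partial>count_space UNIV)"
  proof (rule nn_integral_cong)
    fix j
    have "{\<omega> \<in> space P. X 0 \<omega> = j \<and> (past 0 \<omega>, env 0 \<omega>) \<in> ?E} = {\<omega> \<in> space P. X 0 \<omega> = j \<and> G (past 0 \<omega>, env 0 \<omega>) \<in> B}"
      by (auto simp: sp)
    then have "prob {\<omega> \<in> space P. X 0 \<omega> = j \<and> (past 0 \<omega>, env 0 \<omega>) \<in> ?E} = \<pi> j * ?f j"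
      using pi_pos[of j] by (simp add: measure_cond_law[OF meas0 B])
    then have "p j i * prob {\<omega> \<in> space P. X 0 \<omega> = j \<and> (past 0 \<omega>, env 0 \<omega>) \<in> ?E} = \<pi> i * (pmf (rev_pmf i) j * ?f j)"
      using pi_pos[of i] by (simp add: pmf_rev_pmf rev_trans_eq)
    then show "emeasure P {\<omega> \<in> space P. X 0 \<omega> = i \<and> X (- 1) \<omega> = j \<and> (past (- 1) \<omega>, env (- 1) \<omega>) \<in> ?E}
      = ennreal (\<pi> i) * (ennreal (pmf (rev_pmf i) j) * ennreal (?f j))"
      unfolding past_env_law[OF E] unfolding emeasure_eq_measure
      using p_nonneg[of j i] pi_nonneg[of i] by (simp flip: ennreal_mult')
  qed
  also have "\<dots> = ennreal (\<pi> i) * (\<integral>\<^sup>+j. ennreal (?f j) \<partial>rev_pmf i)"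
    unfolding nn_integral_measure_pmf by (rule nn_integral_cmult) auto
  also have "(\<integral>\<^sup>+j. ennreal (?f j) \<partial>rev_pmf i) = ennreal (\<integral>j. ?f j \<partial>rev_pmf i)"
    by (rule nn_integral_eq_integral[OF int]) auto
  finally have "prob {\<omega> \<in> space P. X 0 \<omega> = i \<and> G (past (- 1) \<omega>, env (- 1) \<omega>) \<in> B} = \<pi> i * (\<integral>j. ?f j \<partial>rev_pmf i)"
    using pi_nonneg[of i] by (simp add: ennreal_mult'[symmetric] integral_nonneg_AE)
  then show ?thesis
    unfolding measure_cond_law[OF meas1 B] using pi_pos[of i] by simp
qed

lemma sets_\<mu> [simp, measurable_cong]: "sets (\<mu> i) = sets borel"
  by (simp add: \<mu>_def)

lemma space_\<mu> [simp]: "space (\<mu> i) = UNIV"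
  by (simp add: \<mu>_def)

lemma prob_space_\<mu>: "prob_space (\<mu> i)"
  unfolding \<mu>_def by (rule prob_space_distr) measurable

text \<open>The pair \<open>W 0 i\<close> is independent of \<open>X 0\<close> together with the
  functional at time -1, so conditioning on \<open>X 0 = i\<close> leaves a product law. The map
  \<open>h\<close> is kept general because it is used with \<open>\<bar>Q\<bar> + M * y\<close> for
  partial sums and with \<open>Q + M * y\<close> for the series; the identity is demanded almost
  surely since signs and convergence are only known almost surely.\<close>

lemma cond_law_affine:
  assumes G [measurable]: "G \<in> borel_measurable (SS \<Otimes>\<^sub>M WW)" and h [measurable]: "h \<in> borel_measurable (borel \<Otimes>\<^sub>M borel)"
    and Y [measurable]: "Y \<in> borel_measurable P"
    and eq: "AE \<omega> in P. X 0 \<omega> = i \<longrightarrow> Y \<omega> = h (W 0 i \<omega>, G (past (- 1) \<omega>, env (- 1) \<omega>))"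
    and B [measurable]: "B \<in> sets borel"
  shows "measure (cond_law i Y) B = measure (\<mu> i \<Otimes>\<^sub>M cond_law i (\<lambda>\<omega>. G (past (- 1) \<omega>, env (- 1) \<omega>))) {z. h z \<in> B}"
proof -
  define Z where "Z \<omega> = G (past (- 1) \<omega>, env (- 1) \<omega>)" for \<omega>
  have Z [measurable]: "Z \<in> borel_measurable P" unfolding Z_def by measurable
  interpret nu: prob_space "cond_law i Z" by (rule prob_space_cond_law) fact
  have "(\<lambda>xv. (fst xv 0, G (\<lambda>k. fst xv (- 1 - int k), snd xv)))
      \<in> measurable (PiM UNIV (\<lambda>_. count_space UNIV) \<Otimes>\<^sub>M WW) (count_space UNIV \<Otimes>\<^sub>M borel)"
  proof (rule measurable_Pair)
    have "(\<lambda>xv. (\<lambda>k. fst xv (- 1 - int k))) \<in> measurable (PiM UNIV (\<lambda>_. count_space UNIV) \<Otimes>\<^sub>M WW) SS"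
      by (rule measurable_PiM_single') auto
    then show "(\<lambda>xv. G (\<lambda>k. fst xv (- 1 - int k), snd xv)) \<in> borel_measurable (PiM UNIV (\<lambda>_. count_space UNIV) \<Otimes>\<^sub>M WW)"
      by measurable
  qed measurable
  from indep_rv_compose[OF indep_W0 measurable_ident_sets[OF refl] this, of i]
  have ind: "indep_rv borel (W 0 i) (count_space UNIV \<Otimes>\<^sub>M borel) (\<lambda>\<omega>. (X 0 \<omega>, Z \<omega>))"
    by (simp add: Z_def Xall_def past_def[abs_def])
  let ?E = "{z \<in> space (borel \<Otimes>\<^sub>M (count_space UNIV \<Otimes>\<^sub>M borel)). fst (snd z) = i \<and> h (fst z, snd (snd z)) \<in> B}"
  have E: "?E \<in> sets (borel \<Otimes>\<^sub>M (count_space UNIV \<Otimes>\<^sub>M borel))" by measurable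
  have S: "{z. h z \<in> B} \<in> sets (\<mu> i \<Otimes>\<^sub>M cond_law i Z)"
  proof -
    have "{z \<in> space (borel \<Otimes>\<^sub>M borel). h z \<in> B} \<in> sets (borel \<Otimes>\<^sub>M borel)" by measurable
    then show ?thesis by (simp add: space_pair_measure cong: sets_pair_measure_cong)
  qed
  have "prob {\<omega> \<in> space P. X 0 \<omega> = i \<and> Y \<omega> \<in> B} = prob {\<omega> \<in> space P. X 0 \<omega> = i \<and> h (W 0 i \<omega>, Z \<omega>) \<in> B}"
    by (rule finite_measure_eq_AE) (use eq in \<open>auto elim!: eventually_mono simp: Z_def\<close>)
  then have "ennreal (prob {\<omega> \<in> space P. X 0 \<omega> = i \<and> Y \<omega> \<in> B})
      = emeasure P {\<omega> \<in> space P. (W 0 i \<omega>, (X 0 \<omega>, Z \<omega>)) \<in> ?E}"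
    by (simp add: emeasure_eq_measure space_pair_measure)
  also have "\<dots> = (\<integral>\<^sup>+w. emeasure P {\<omega> \<in> space P. (w, (X 0 \<omega>, Z \<omega>)) \<in> ?E} \<partial>\<mu> i)"
    unfolding \<mu>_def by (rule indep_rv_slice_fst[OF ind E])
  also have "\<dots> = (\<integral>\<^sup>+w. ennreal (\<pi> i) * emeasure (cond_law i Z) (Pair w -` {z. h z \<in> B}) \<partial>\<mu> i)"
  proof (rule nn_integral_cong)
    fix w
    have "Pair w -` {z. h z \<in> B} \<in> sets (cond_law i Z)" by (rule sets_Pair1[OF S])
    then have w: "{y. h (w, y) \<in> B} \<in> sets borel" by (simp add: vimage_def)
    have "prob {\<omega> \<in> space P. X 0 \<omega> = i \<and> Z \<omega> \<in> {y. h (w, y) \<in> B}} = \<pi> i * measure (cond_law i Z) {y. h (w, y) \<in> B}"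
      unfolding measure_cond_law[OF Z w] using pi_pos[of i] by simp
    then show "emeasure P {\<omega> \<in> space P. (w, (X 0 \<omega>, Z \<omega>)) \<in> ?E} = ennreal (\<pi> i) * emeasure (cond_law i Z) (Pair w -` {z. h z \<in> B})"
      using pi_nonneg[of i]
      by (simp add: emeasure_eq_measure nu.emeasure_eq_measure space_pair_measure vimage_def ennreal_mult')
  qed
  also have "\<dots> = ennreal (\<pi> i) * (\<integral>\<^sup>+w. emeasure (cond_law i Z) (Pair w -` {z. h z \<in> B}) \<partial>\<mu> i)"
    by (rule nn_integral_cmult) (rule nu.measurable_emeasure_Pair[OF S])
  also have "(\<integral>\<^sup>+w. emeasure (cond_law i Z) (Pair w -` {z. h z \<in> B}) \<partial>\<mu> i) = emeasure (\<mu> i \<Otimes>\<^sub>M cond_law i Z) {z. h z \<in> B}"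
    by (rule nu.emeasure_pair_measure_alt[OF S, symmetric])
  also have "\<dots> = ennreal (measure (\<mu> i \<Otimes>\<^sub>M cond_law i Z) {z. h z \<in> B})"
  proof -
    interpret mu: prob_space "\<mu> i" by (rule prob_space_\<mu>)
    interpret pp: pair_prob_space "\<mu> i" "cond_law i Z" ..
    show ?thesis by (rule pp.emeasure_eq_measure)
  qed
  finally have "prob {\<omega> \<in> space P. X 0 \<omega> = i \<and> Y \<omega> \<in> B} = \<pi> i * measure (\<mu> i \<Otimes>\<^sub>M cond_law i Z) {z. h z \<in> B}"
    using pi_nonneg[of i] by (simp flip: ennreal_mult')
  then show ?thesis
    unfolding measure_cond_law[OF Y B] Z_def[symmetric] using pi_pos[of i] by simp
qed

end

section \<open>Averaging contractions\<close>

lemma integrable_pmf_bounded: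
  fixes f :: "'d \<Rightarrow> real"
  assumes "\<And>j. \<bar>f j\<bar> \<le> b"
  shows "integrable (measure_pmf r) f"
  by (rule measure_pmf.integrable_const_bound[where B = b]) (use assms in auto)

lemma expectation_le:
  fixes f :: "'d \<Rightarrow> real"
  assumes "\<And>j. \<bar>f j\<bar> \<le> b" "\<And>j. f j \<le> a"
  shows "measure_pmf.expectation r f \<le> a"
proof -
  have "measure_pmf.expectation r f \<le> measure_pmf.expectation r (\<lambda>_. a)"
    using assms by (intro integral_mono integrable_pmf_bounded) auto
  then show ?thesis by simp
qed

text \<open>Bridge between the unordered sum over \<open>G\<close> in the theorem and the
  expectation operators of the proof; boundedness of \<open>f\<close> gives the absolute
  summability.\<close>

lemma infsum_pmf_bounded:
  fixes f :: "'d \<Rightarrow> real"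
  assumes "\<And>j. \<bar>f j\<bar> \<le> b"
  shows "(\<Sum>\<^sub>\<infinity>j. a * pmf r j * f j) = a * measure_pmf.expectation r f"
proof -
  have summable: "Infinite_Set_Sum.abs_summable_on (\<lambda>j. pmf r j * f j) UNIV"
  proof (rule abs_summable_on_comparison_test)
    show "Infinite_Set_Sum.abs_summable_on (\<lambda>j. b * pmf r j) UNIV"
      by (intro abs_summable_on_cmult_right pmf_abs_summable)
    show "norm (pmf r j * f j) \<le> norm (b * pmf r j)" for j
      using assms[of j] by (auto simp: abs_mult mult.commute intro!: mult_right_mono)
  qed
  have "(\<Sum>\<^sub>\<infinity>j. pmf r j * f j) = measure_pmf.expectation r f"
    unfolding pmf_expectation_eq_infsetsum
    by (rule infsetsum_infsum[symmetric]) (use summable in \<open>simp only: abs_summable_equivalent\<close>)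
  then show ?thesis
    by (simp add: mult.assoc infsum_cmult_right')
qed

section \<open>Bounded fixed points of \<open>f \<mapsto> q + m * E f\<close>\<close>

locale contraction =
  fixes r :: "'d \<Rightarrow> 'd pmf" and m :: "'d \<Rightarrow> real" and c :: real
  assumes m: "\<And>i. 0 \<le> m i" "\<And>i. m i \<le> c" and c: "0 \<le> c" "c < 1"
begin

abbreviation E :: "'d \<Rightarrow> ('d \<Rightarrow> real) \<Rightarrow> real" where "E i f \<equiv> measure_pmf.expectation (r i) f"

text \<open>Each use of the inequality improves a uniform bound by the factor \<open>c\<close>, so
  \<open>d\<close> lies below \<open>c ^ n * b\<close> for all \<open>n\<close>. This maximum
  principle stands in for the spectral radius: uniqueness and nonnegativity of fixed points are
  applications of it.\<close>

lemma subsolution_nonpos: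
  assumes b: "\<And>i. \<bar>d i\<bar> \<le> b" and sub: "\<And>i. d i \<le> m i * E i d"
  shows "d i \<le> 0"
proof -
  have b0: "0 \<le> b" using b[of i] by linarith
  have bound: "d i \<le> c ^ n * b" for n i
  proof (induction n arbitrary: i)
    case 0
    then show ?case using b[of i] by simp
  next
    case (Suc n)
    have "d i \<le> m i * E i d" by (rule sub)
    also have "\<dots> \<le> m i * (c ^ n * b)"
      using Suc.IH by (intro mult_left_mono expectation_le[OF b] m)
    also have "\<dots> \<le> c * (c ^ n * b)" using m b0 c by (intro mult_right_mono) auto
    finally show ?case by simp
  qed
  have "(\<lambda>n. c ^ n * b) \<longlonglongrightarrow> 0 * b" using c by (intro tendsto_intros) auto
  then have "(\<lambda>n. c ^ n * b) \<longlonglongrightarrow> 0" by simp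
  then show ?thesis by (rule LIMSEQ_le_const) (use bound in auto)
qed

lemma fixpoint_unique:
  assumes "\<And>i. \<bar>K i\<bar> \<le> b" "\<And>i. \<bar>K' i\<bar> \<le> b'"
    and "\<And>i. K i = q i + m i * E i K" "\<And>i. K' i = q i + m i * E i K'"
  shows "K = K'"
proof
  fix i
  have le: "K i \<le> K' i"
    if K: "\<And>i. \<bar>K i\<bar> \<le> b" "\<And>i. \<bar>K' i\<bar> \<le> b'"
      and eq: "\<And>i. K i = q i + m i * E i K" "\<And>i. K' i = q i + m i * E i K'" for K K' b b' i
  proof -
    have "K i - K' i \<le> 0"
    proof (rule subsolution_nonpos)
      show "\<bar>K i - K' i\<bar> \<le> b + b'" for i using K(1)[of i] K(2)[of i] by linarith
      show "K i - K' i \<le> m i * E i (\<lambda>i. K i - K' i)" for i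
      proof -
        have "E i (\<lambda>i. K i - K' i) = E i K - E i K'"
          by (intro Bochner_Integration.integral_diff integrable_pmf_bounded[OF K(1)] integrable_pmf_bounded[OF K(2)])
        then show ?thesis using eq(1)[of i] eq(2)[of i] by (simp add: right_diff_distrib)
      qed
    qed
    then show ?thesis by simp
  qed
  show "K i = K' i"
    by (rule antisym) (rule le[OF assms], rule le[OF assms(2,1,4,3)])
qed

lemma fixpoint_nonneg:
  assumes "\<And>i. \<bar>K i\<bar> \<le> b" "\<And>i. 0 \<le> q i" "\<And>i. K i = q i + m i * E i K"
  shows "0 \<le> K i"
proof -
  have "- K i \<le> 0"
  proof (rule subsolution_nonpos)
    show "- K i \<le> m i * E i (\<lambda>i. - K i)" for i
      using assms(2)[of i] assms(3)[of i] by simp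
  qed (use assms(1) in simp)
  then show ?thesis by simp
qed

text \<open>The iterates from 0 are the partial sums of the Neumann series of \<open>q\<close>. They
  increase as \<open>q\<close> is nonnegative, remain bounded, and converge pointwise; dominated
  convergence carries the limit through the expectation.\<close>

lemma fixpoint_exists:
  assumes q: "\<And>i. 0 \<le> q i" "\<And>i. q i \<le> Cq"
  obtains K b where "\<And>i. \<bar>K i\<bar> \<le> b" "\<And>i. K i = q i + m i * E i K"
proof -
  \<comment> \<open>The fixed point of \<open>x \<mapsto> Cq + c * x\<close>, hence a bound
    preserved by every iteration.\<close>
  define b where "b = Cq / (1 - c)"
  have "0 \<le> Cq" using q[of undefined] by linarith
  then have b0: "0 \<le> b" using c by (simp add: b_def)
  have b: "Cq + c * b = b" using c by (simp add: b_def field_simps)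
  define K where "K n = ((\<lambda>f i. q i + m i * E i f) ^^ n) (\<lambda>_. 0)" for n :: nat
  have K_Suc: "K (Suc n) i = q i + m i * E i (K n)" for n i by (simp add: K_def)
  have bound: "0 \<le> K n i \<and> K n i \<le> b" for n i
  proof (induction n arbitrary: i)
    case 0
    then show ?case using b0 by (simp add: K_def)
  next
    case (Suc n)
    have ab: "\<bar>K n j\<bar> \<le> b" for j using Suc.IH[of j] by simp
    have "0 \<le> E i (K n)" using Suc.IH by (intro integral_nonneg_AE) auto
    then have "0 \<le> m i * E i (K n)" using m by simp
    moreover have "m i * E i (K n) \<le> m i * b"
      using Suc.IH by (intro mult_left_mono expectation_le[OF ab] m) auto
    moreover have "m i * b \<le> c * b" using m b0 by (intro mult_right_mono)
    ultimately show ?case unfolding K_Suc using q[of i] b by linarith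
  qed
  have ab: "\<bar>K n j\<bar> \<le> b" for n j using bound[of n j] by simp
  have mono: "K n i \<le> K (Suc n) i" for n i
  proof (induction n arbitrary: i)
    case 0
    then show ?case using bound[of "Suc 0" i] by (simp add: K_def)
  next
    case (Suc n)
    have "E i (K n) \<le> E i (K (Suc n))"
      using Suc.IH by (intro integral_mono integrable_pmf_bounded[OF ab])
    then show ?case unfolding K_Suc[of "Suc n"] K_Suc[of n] using m by (simp add: mult_left_mono)
  qed
  have "convergent (\<lambda>n. K n i)" for i
  proof -
    have "incseq (\<lambda>n. K n i)" using mono by (auto simp: incseq_Suc_iff)
    moreover have "\<forall>n. K n i \<le> b" using bound by blast
    ultimately obtain l where "(\<lambda>n. K n i) \<longlonglongrightarrow> l" by (rule incseq_convergent)
    then show ?thesis by (auto simp: convergent_def)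
  qed
  then obtain L where L: "\<And>i. (\<lambda>n. K n i) \<longlonglongrightarrow> L i" unfolding convergent_def by metis
  have Lb: "\<bar>L i\<bar> \<le> b" for i
    by (rule LIMSEQ_le_const2[OF tendsto_rabs[OF L]]) (use ab in auto)
  have "L i = q i + m i * E i L" for i
  proof (rule LIMSEQ_unique)
    show "(\<lambda>n. K (Suc n) i) \<longlonglongrightarrow> L i" using L by (rule LIMSEQ_Suc)
    have "(\<lambda>n. E i (K n)) \<longlonglongrightarrow> E i L"
      by (rule integral_dominated_convergence[where w = "\<lambda>_. b"]) (use L ab in auto)
    then show "(\<lambda>n. K (Suc n) i) \<longlonglongrightarrow> q i + m i * E i L"
      unfolding K_Suc by (intro tendsto_intros)
  qed
  then show ?thesis using that[of L b] Lb by blast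
qed

end

section \<open>The tail of the perpetuity\<close>

locale mc_perpetuity = mc_env P X Q M \<pi> p + regularly_varying_tail F \<alpha> B
  for P :: "'a measure" and X :: "int \<Rightarrow> 'a \<Rightarrow> 'd::countable"
    and Q M :: "int \<Rightarrow> 'd \<Rightarrow> 'a \<Rightarrow> real" and \<pi> p F \<alpha> B +
  fixes q :: "'d \<Rightarrow> real" and \<beta> c D C1 T1 :: real
  assumes alpha_beta: "\<alpha> < \<beta>" and c_less: "c < 1"
    and M_pos: "\<And>i. AE w in \<mu> i. 0 < snd w"
    and int_alpha: "\<And>i. integrable (\<mu> i) (\<lambda>w. snd w powr \<alpha>)"
    and alpha_le: "\<And>i. (\<integral>w. snd w powr \<alpha> \<partial>\<mu> i) \<le> c"
    and int_beta: "\<And>i. integrable (\<mu> i) (\<lambda>w. snd w powr \<beta>)"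
    and beta_le: "\<And>i. (\<integral>w. snd w powr \<beta> \<partial>\<mu> i) \<le> D"
    and tail_q: "\<And>i. ((\<lambda>t. measure (\<mu> i) {w. t < fst w} / F t) \<longlongrightarrow> q i) at_top"
    and C1: "0 \<le> C1"
    and tail_abs_q: "\<And>i s. T1 \<le> s \<Longrightarrow> measure (\<mu> i) {w. s < \<bar>fst w\<bar>} \<le> C1 * F s"
begin

definition m :: "'d \<Rightarrow> real" where "m i = (\<integral>w. snd w powr \<alpha> \<partial>\<mu> i)"

lemma m_pos: "0 < m i"
proof -
  interpret mu: prob_space "\<mu> i" by (rule prob_space_\<mu>)
  have "(\<integral>w. 0 \<partial>\<mu> i) < (\<integral>w. snd w powr \<alpha> \<partial>\<mu> i)"
    by (rule mu.integral_less_AE_space)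
       (use int_alpha M_pos[of i] mu.emeasure_space_1 in \<open>auto elim!: eventually_mono\<close>)
  then show ?thesis by (simp add: m_def)
qed

sublocale contraction rev_pmf m c
proof
  fix i
  show "0 \<le> m i" "m i \<le> c" using m_pos[of i] alpha_le[of i] by (auto simp: m_def)
  then show "0 \<le> c" by simp
qed (rule c_less)

section \<open>The series as a functional of past and environment\<close>

definition pterm :: "(nat \<Rightarrow> 'd) \<times> (nat \<times> 'd \<Rightarrow> real \<times> real) \<Rightarrow> nat \<Rightarrow> real" where
  "pterm z k = fst (snd z (k, fst z k)) * (\<Prod>l<k. snd (snd z (l, fst z l)))"

text \<open>Partial sums of absolute values obey the affine recursion without any convergence issue,
  so their tails can be bounded by induction on \<open>N\<close>.\<close>

definition Rabs :: "nat \<Rightarrow> (nat \<Rightarrow> 'd) \<times> (nat \<times> 'd \<Rightarrow> real \<times> real) \<Rightarrow> real" where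
  "Rabs N z = (\<Sum>k<N. \<bar>pterm z k\<bar>)"

text \<open>As \<open>suminf\<close> is total, \<open>R\<close> is defined and measurable
  everywhere, but the recursion for it is justified only where the series converges
  absolutely.\<close>

definition R :: "(nat \<Rightarrow> 'd) \<times> (nat \<times> 'd \<Rightarrow> real \<times> real) \<Rightarrow> real" where
  "R z = (\<Sum>k. pterm z k)"

lemma coef_meas [measurable]: "(\<lambda>z. snd z (k, fst z k)) \<in> borel_measurable (SS \<Otimes>\<^sub>M WW)"
proof (rule measurable_compose_countable[where g = "\<lambda>z. fst z k" and f = "\<lambda>d z. snd z (k, d)"])
  show "(\<lambda>z. snd z (k, d)) \<in> borel_measurable (SS \<Otimes>\<^sub>M WW)" for d by measurable
  show "(\<lambda>z. fst z k) \<in> measurable (SS \<Otimes>\<^sub>M WW) (count_space UNIV)" by measurable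
qed

lemma pterm_meas [measurable]: "(\<lambda>z. pterm z k) \<in> borel_measurable (SS \<Otimes>\<^sub>M WW)"
  unfolding pterm_def by measurable

lemma Rabs_meas [measurable]: "Rabs N \<in> borel_measurable (SS \<Otimes>\<^sub>M WW)"
  unfolding Rabs_def by measurable

lemma R_meas [measurable]: "R \<in> borel_measurable (SS \<Otimes>\<^sub>M WW)"
  unfolding R_def by measurable

lemma perpetuity_eq: "perpetuity X Q M \<omega> = R (past 0 \<omega>, env 0 \<omega>)"
  by (simp add: perpetuity_def R_def pterm_def past_def env_def W_def)

lemma pterm_0: "pterm (past 0 \<omega>, env 0 \<omega>) 0 = fst (W 0 (X 0 \<omega>) \<omega>)"
  by (simp add: pterm_def past_def env_def)

lemma pterm_Suc:
  "pterm (past 0 \<omega>, env 0 \<omega>) (Suc k) = snd (W 0 (X 0 \<omega>) \<omega>) * pterm (past (- 1) \<omega>, env (- 1) \<omega>) k"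
proof -
  have shift: "- int (Suc l) = - 1 - int l" for l by simp
  then show ?thesis
    unfolding pterm_def past_def env_def prod.lessThan_Suc_shift
    by (simp add: shift del: of_nat_Suc)
qed

lemma Rabs_Suc:
  "Rabs (Suc N) (past 0 \<omega>, env 0 \<omega>)
    = \<bar>fst (W 0 (X 0 \<omega>) \<omega>)\<bar> + \<bar>snd (W 0 (X 0 \<omega>) \<omega>)\<bar> * Rabs N (past (- 1) \<omega>, env (- 1) \<omega>)"
  unfolding Rabs_def sum.lessThan_Suc_shift pterm_0 pterm_Suc
  by (simp add: abs_mult sum_distrib_left)

lemma AE_snd_W: "AE \<omega> in P. 0 < snd (W 0 i \<omega>)"
  using AE_distrD[OF W_meas M_pos[of i, unfolded \<mu>_def]] .

section \<open>Tail bounds uniform over the states, and convergence of the series\<close>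

definition law0 :: "((nat \<Rightarrow> 'd) \<times> (nat \<times> 'd \<Rightarrow> real \<times> real) \<Rightarrow> real) \<Rightarrow> 'd \<Rightarrow> real measure" where
  "law0 G i = cond_law i (\<lambda>\<omega>. G (past 0 \<omega>, env 0 \<omega>))"

text \<open>The condition is still \<open>X 0 = i\<close>, only the functional is moved back by one
  step: \<open>law1 R i\<close> is the law of the previous value of the perpetuity.\<close>

definition law1 :: "((nat \<Rightarrow> 'd) \<times> (nat \<times> 'd \<Rightarrow> real \<times> real) \<Rightarrow> real) \<Rightarrow> 'd \<Rightarrow> real measure" where
  "law1 G i = cond_law i (\<lambda>\<omega>. G (past (- 1) \<omega>, env (- 1) \<omega>))"

lemma law_basics:
  assumes [measurable]: "G \<in> borel_measurable (SS \<Otimes>\<^sub>M WW)"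
  shows "prob_space (law0 G i)" "prob_space (law1 G i)"
    "sets (law0 G i) = sets borel" "sets (law1 G i) = sets borel"
  unfolding law0_def law1_def by (auto intro!: prob_space_cond_law)

lemma measure_law0:
  assumes [measurable]: "G \<in> borel_measurable (SS \<Otimes>\<^sub>M WW)" and U: "U \<in> sets borel"
  shows "measure (law0 G i) U = prob {\<omega> \<in> space P. X 0 \<omega> = i \<and> G (past 0 \<omega>, env 0 \<omega>) \<in> U} / \<pi> i"
  unfolding law0_def by (rule measure_cond_law[OF _ U]) measurable

lemma law1_eq:
  assumes "G \<in> borel_measurable (SS \<Otimes>\<^sub>M WW)" and "U \<in> sets borel"
  shows "measure (law1 G i) U = E i (\<lambda>j. measure (law0 G j) U)"
  unfolding law0_def law1_def by (rule cond_law_shift[OF assms])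

lemma law1_le:
  assumes G: "G \<in> borel_measurable (SS \<Otimes>\<^sub>M WW)" and U: "U \<in> sets borel"
    and le: "\<And>j. measure (law0 G j) U \<le> a"
  shows "measure (law1 G i) U \<le> a"
  unfolding law1_eq[OF G U]
proof (rule expectation_le[where b = 1])
  show "\<bar>measure (law0 G j) U\<bar> \<le> 1" for j
    using prob_space.prob_le_1[OF law_basics(1)[OF G]] by simp
qed (rule le)

text \<open>Induction on \<open>N\<close>. The step turns a bound for all states into a bound for
  the mixture \<open>law1\<close>, and \<open>affine_tail_uniform\<close> returns it with unchanged
  \<open>C\<close> and \<open>T\<close>. At \<open>N = 0\<close> the sum is 0, which does not exceed
  a threshold \<open>t \<ge> T > 0\<close>.\<close>

lemma Rabs_tail:
  obtains C T where "0 \<le> C" "0 < T" "\<And>N i t. T \<le> t \<Longrightarrow> measure (law0 (Rabs N) i) {t<..} \<le> C * F t"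
proof -
  obtain C T where CT: "0 \<le> C" "0 < T" and step:
    "\<And>\<mu> \<nu> t. \<lbrakk>prob_space \<mu>; sets \<mu> = sets (borel :: (real \<times> real) measure);
       prob_space \<nu>; sets \<nu> = sets (borel :: real measure); AE w in \<mu>. 0 < snd w;
       (\<integral>w. snd w powr \<alpha> \<partial>\<mu>) \<le> c; integrable \<mu> (\<lambda>w. snd w powr \<alpha>);
       integrable \<mu> (\<lambda>w. snd w powr \<beta>); (\<integral>w. snd w powr \<beta> \<partial>\<mu>) \<le> D;
       \<And>s. T1 \<le> s \<Longrightarrow> measure \<mu> {w. s < \<bar>fst w\<bar>} \<le> C1 * F s;
       \<And>s. T \<le> s \<Longrightarrow> measure \<nu> {s<..} \<le> C * F s; T \<le> t\<rbrakk>
     \<Longrightarrow> measure (\<mu> \<Otimes>\<^sub>M \<nu>) {z. t < \<bar>fst (fst z)\<bar> + snd (fst z) * snd z} \<le> C * F t"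
    using affine_tail_uniform[OF alpha_beta c_less C1, of D T1] by blast
  have "measure (law0 (Rabs N) i) {t<..} \<le> C * F t" if "T \<le> t" for N i t
    using that
  proof (induction N arbitrary: i t)
    case 0
    have "measure (law0 (Rabs 0) i) {t<..} = 0"
      using 0 CT by (simp add: measure_law0) (simp add: Rabs_def)
    also have "\<dots> \<le> C * F t" using CT by simp
    finally show ?case .
  next
    case (Suc N)
    have "measure (law0 (Rabs (Suc N)) i) {t<..}
        = measure (\<mu> i \<Otimes>\<^sub>M law1 (Rabs N) i) {z. \<bar>fst (fst z)\<bar> + snd (fst z) * snd z \<in> {t<..}}"
      unfolding law0_def law1_def
    proof (rule cond_law_affine)
      show "AE \<omega> in P. X 0 \<omega> = i \<longrightarrow> Rabs (Suc N) (past 0 \<omega>, env 0 \<omega>)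
          = \<bar>fst (fst (W 0 i \<omega>, Rabs N (past (- 1) \<omega>, env (- 1) \<omega>)))\<bar>
            + snd (fst (W 0 i \<omega>, Rabs N (past (- 1) \<omega>, env (- 1) \<omega>)))
              * snd (W 0 i \<omega>, Rabs N (past (- 1) \<omega>, env (- 1) \<omega>))"
        using AE_snd_W[of i] by eventually_elim (auto simp: Rabs_Suc)
    qed measurable
    also have "\<dots> = measure (\<mu> i \<Otimes>\<^sub>M law1 (Rabs N) i) {z. t < \<bar>fst (fst z)\<bar> + snd (fst z) * snd z}"
      by simp
    also have "\<dots> \<le> C * F t"
      using Suc.IH Suc.prems
      by (intro step prob_space_\<mu> sets_\<mu> law_basics M_pos alpha_le int_alpha int_beta beta_le tail_abs_q law1_le) auto
    finally show ?case .
  qed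
  then show ?thesis using that[OF CT] by blast
qed

text \<open>The events grow with \<open>N\<close> and the bound is free of \<open>N\<close>, so
  continuity from below puts the existential quantifier inside the probability.\<close>

lemma sup_Rabs_tail:
  obtains C T where "0 \<le> C" "0 < T"
    "\<And>i t. T \<le> t \<Longrightarrow> prob {\<omega> \<in> space P. X 0 \<omega> = i \<and> (\<exists>N. t < Rabs N (past 0 \<omega>, env 0 \<omega>))} \<le> \<pi> i * (C * F t)"
proof -
  obtain C T where CT: "0 \<le> C" "0 < T" and tail: "\<And>N i t. T \<le> t \<Longrightarrow> measure (law0 (Rabs N) i) {t<..} \<le> C * F t"
    using Rabs_tail by blast
  have "prob {\<omega> \<in> space P. X 0 \<omega> = i \<and> (\<exists>N. t < Rabs N (past 0 \<omega>, env 0 \<omega>))} \<le> \<pi> i * (C * F t)" if t: "T \<le> t" for i t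
  proof -
    define A where "A N = {\<omega> \<in> space P. X 0 \<omega> = i \<and> t < Rabs N (past 0 \<omega>, env 0 \<omega>)}" for N
    have A: "range A \<subseteq> sets P" unfolding A_def by (intro image_subsetI) measurable
    have inc: "incseq A"
    proof (rule incseq_SucI)
      have "Rabs N z \<le> Rabs (Suc N) z" for N z by (simp add: Rabs_def)
      then show "A N \<le> A (Suc N)" for N
        unfolding A_def by (auto intro: less_le_trans)
    qed
    have "(\<lambda>N. prob (A N)) \<longlonglongrightarrow> prob (\<Union>N. A N)" by (rule finite_Lim_measure_incseq[OF A inc])
    moreover have "prob (A N) \<le> \<pi> i * (C * F t)" for N
      using tail[OF t, of N i] pi_pos[of i] by (simp add: measure_law0 A_def field_simps)
    ultimately have "prob (\<Union>N. A N) \<le> \<pi> i * (C * F t)" by (intro LIMSEQ_le_const2) auto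
    also have "(\<Union>N. A N) = {\<omega> \<in> space P. X 0 \<omega> = i \<and> (\<exists>N. t < Rabs N (past 0 \<omega>, env 0 \<omega>))}"
      by (auto simp: A_def)
    finally show ?thesis .
  qed
  then show ?thesis using that[OF CT] by blast
qed

text \<open>For large arguments doubling multiplies \<open>F\<close> by at most some
  \<open>r < 1\<close>, since the limit of the ratio is \<open>2 powr - \<alpha> < 1\<close>; hence
  \<open>F\<close> decays geometrically along powers of two.\<close>

lemma F_small:
  assumes "0 < e" obtains t where "t0 \<le> t" "F t < e"
proof -
  have "2 powr - \<alpha> < 2 powr (0::real)" using alpha_pos by (intro powr_less_mono) auto
  then have a: "2 powr - \<alpha> < (1::real)" by simp
  then obtain r :: real where r: "2 powr - \<alpha> < r" "r < 1" using dense by blast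
  have r0: "0 < r" using r(1) less_trans[of 0 "2 powr - \<alpha>" r] by simp
  have "eventually (\<lambda>t. F (2 * t) \<le> r * F t) at_top"
    by (rule eventually_le_scale[OF F_rv]) (use r F_pos in auto)
  then obtain T where T: "\<And>t. T \<le> t \<Longrightarrow> F (2 * t) \<le> r * F t" by (auto simp: eventually_at_top_linorder)
  define s where "s = max (max T t0) 1"
  have s: "T \<le> s" "t0 \<le> s" "1 \<le> s" by (auto simp: s_def)
  have ge: "s \<le> 2 ^ n * s" for n
    using mult_right_mono[of 1 "2 ^ n :: real" s] s by simp
  have it: "F (2 ^ n * s) \<le> r ^ n * F s" for n
  proof (induction n)
    case (Suc n)
    have "F (2 ^ Suc n * s) \<le> r * F (2 ^ n * s)" using T[of "2 ^ n * s"] ge[of n] s by (simp add: mult.assoc)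
    also have "\<dots> \<le> r * (r ^ n * F s)" using Suc r0 by (intro mult_left_mono) auto
    finally show ?case by simp
  qed simp
  have "(\<lambda>n. r ^ n * F s) \<longlonglongrightarrow> 0 * F s" using r r0 by (intro tendsto_intros) auto
  then have "eventually (\<lambda>n. r ^ n * F s < e) sequentially"
    using assms by (intro order_tendstoD(2)) auto
  then obtain n where "r ^ n * F s < e" by (auto simp: eventually_sequentially)
  then have "F (2 ^ n * s) < e" using it[of n] by simp
  moreover have "t0 \<le> 2 ^ n * s" using ge[of n] s by linarith
  ultimately show ?thesis using that by blast
qed

text \<open>Divergence means that the partial sums of absolute values exceed every level. By
  \<open>sup_Rabs_tail\<close> exceeding level \<open>t\<close> has probability at most a constant
  times \<open>F t\<close>, which becomes arbitrarily small.\<close>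

lemma AE_summable: "AE \<omega> in P. X 0 \<omega> = i \<longrightarrow> summable (\<lambda>k. \<bar>pterm (past 0 \<omega>, env 0 \<omega>) k\<bar>)"
proof -
  obtain C T where CT: "0 \<le> C" "0 < T" and tail:
    "\<And>i t. T \<le> t \<Longrightarrow> prob {\<omega> \<in> space P. X 0 \<omega> = i \<and> (\<exists>N. t < Rabs N (past 0 \<omega>, env 0 \<omega>))} \<le> \<pi> i * (C * F t)"
    using sup_Rabs_tail by blast
  let ?bad = "{\<omega> \<in> space P. X 0 \<omega> = i \<and> (\<forall>n::nat. \<exists>N. real n < Rabs N (past 0 \<omega>, env 0 \<omega>))}"
  have bad: "?bad \<in> sets P" by measurable
  have "prob ?bad \<le> 0"
  proof (rule field_le_epsilon)
    fix e :: real assume e: "0 < e"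
    \<comment> \<open>The summand 1 keeps the denominator positive when \<open>C\<close> is
      0.\<close>
    define e' where "e' = e / (\<pi> i * C + 1)"
    have d: "0 < \<pi> i * C + 1" using CT pi_nonneg[of i] by (simp add: add_nonneg_pos)
    then have "0 < e'" using e by (simp add: e'_def)
    then obtain t where t: "T \<le> t" "F t < e'" using F_small by blast
    have "prob ?bad \<le> prob {\<omega> \<in> space P. X 0 \<omega> = i \<and> (\<exists>N. t < Rabs N (past 0 \<omega>, env 0 \<omega>))}"
    proof (rule finite_measure_mono)
      obtain n :: nat where "t \<le> real n" using real_arch_simple by blast
      then show "?bad \<subseteq> {\<omega> \<in> space P. X 0 \<omega> = i \<and> (\<exists>N. t < Rabs N (past 0 \<omega>, env 0 \<omega>))}"
        using le_less_trans[of t "real n"] by blast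
    qed measurable
    also have "\<dots> \<le> \<pi> i * (C * F t)" by (rule tail[OF t(1)])
    also have "\<dots> \<le> \<pi> i * (C * e')"
      using t CT pi_nonneg[of i] by (intro mult_left_mono) auto
    also have "\<dots> = e * ((\<pi> i * C) / (\<pi> i * C + 1))" by (simp add: e'_def)
    also have "\<dots> \<le> e * 1" using e d by (intro mult_left_mono) (auto simp: divide_le_eq_1)
    finally show "prob ?bad \<le> 0 + e" by simp
  qed
  then have "prob ?bad = 0" using measure_nonneg[of P ?bad] by linarith
  then have "AE \<omega> in P. \<omega> \<notin> ?bad"
    using bad by (subst AE_iff_measurable[OF bad]) (auto simp: emeasure_eq_measure)
  then show ?thesis
  proof (rule AE_mp, intro AE_I2 impI)
    fix \<omega> assume "\<omega> \<in> space P" "\<omega> \<notin> ?bad" "X 0 \<omega> = i"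
    then obtain n :: nat where n: "\<And>N. Rabs N (past 0 \<omega>, env 0 \<omega>) \<le> real n" by (auto simp: not_less)
    then show "summable (\<lambda>k. \<bar>pterm (past 0 \<omega>, env 0 \<omega>) k\<bar>)"
      by (intro summableI_nonneg_bounded[where x = "real n"]) (auto simp: Rabs_def)
  qed
qed

text \<open>The terms from index 1 on are the multiplier times the terms of the shifted series. A
  nonzero multiplier lets summability of the former be transferred to the latter, after which it can
  be pulled out of the sum.\<close>

lemma R_eq_of_summable:
  assumes "summable (\<lambda>k. \<bar>pterm (past 0 \<omega>, env 0 \<omega>) k\<bar>)" and snd: "snd (W 0 (X 0 \<omega>) \<omega>) \<noteq> 0"
  shows "R (past 0 \<omega>, env 0 \<omega>)
    = fst (W 0 (X 0 \<omega>) \<omega>) + snd (W 0 (X 0 \<omega>) \<omega>) * R (past (- 1) \<omega>, env (- 1) \<omega>)"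
proof -
  define g where "g = pterm (past 0 \<omega>, env 0 \<omega>)"
  define g' where "g' = pterm (past (- 1) \<omega>, env (- 1) \<omega>)"
  have Suc: "g (Suc k) = snd (W 0 (X 0 \<omega>) \<omega>) * g' k" for k unfolding g_def g'_def by (rule pterm_Suc)
  have g: "summable g" using assms(1) unfolding g_def[symmetric] by (rule summable_rabs_cancel)
  then have "summable (\<lambda>k. g (Suc k))" by (simp only: summable_Suc_iff)
  then have g': "summable g'" using snd by (simp add: Suc)
  have "(\<Sum>k. g k) = (\<Sum>k. g (Suc k)) + g 0" using suminf_split_head[OF g] by simp
  also have "(\<Sum>k. g (Suc k)) = snd (W 0 (X 0 \<omega>) \<omega>) * (\<Sum>k. g' k)"
    unfolding Suc by (rule suminf_mult[OF g'])
  also have "g 0 = fst (W 0 (X 0 \<omega>) \<omega>)" unfolding g_def by (rule pterm_0)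
  finally show ?thesis unfolding R_def g_def g'_def by simp
qed

lemma AE_R_eq:
  "AE \<omega> in P. X 0 \<omega> = i \<longrightarrow>
     R (past 0 \<omega>, env 0 \<omega>) = fst (W 0 i \<omega>) + snd (W 0 i \<omega>) * R (past (- 1) \<omega>, env (- 1) \<omega>)"
  by (rule AE_mp[OF AE_conjI[OF AE_summable[of i] AE_snd_W[of i]]], intro AE_I2 impI)
     (use R_eq_of_summable in auto)

lemma R_tail_eq:
  "measure (law0 R i) {t<..} = measure (\<mu> i \<Otimes>\<^sub>M law1 R i) {z. t < fst (fst z) + snd (fst z) * snd z}"
proof -
  have "measure (law0 R i) {t<..} = measure (\<mu> i \<Otimes>\<^sub>M law1 R i) {z. fst (fst z) + snd (fst z) * snd z \<in> {t<..}}"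
    unfolding law0_def law1_def
  proof (rule cond_law_affine)
    show "AE \<omega> in P. X 0 \<omega> = i \<longrightarrow> R (past 0 \<omega>, env 0 \<omega>)
        = fst (fst (W 0 i \<omega>, R (past (- 1) \<omega>, env (- 1) \<omega>)))
          + snd (fst (W 0 i \<omega>, R (past (- 1) \<omega>, env (- 1) \<omega>))) * snd (W 0 i \<omega>, R (past (- 1) \<omega>, env (- 1) \<omega>))"
      using AE_R_eq[of i] by simp
  qed measurable
  then show ?thesis by simp
qed

lemma sets_abs_tail [measurable]: "{y :: real. t < \<bar>y\<bar>} \<in> sets borel"
proof -
  have "{y \<in> space borel. t < \<bar>y :: real\<bar>} \<in> sets borel" by measurable
  then show ?thesis by simp
qed

text \<open>Almost surely \<open>\<bar>R\<bar>\<close> is at most the sum of the absolute values, so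
  if it exceeds \<open>t\<close>, some finite partial sum already does.\<close>

lemma R_abs_tail:
  obtains C T where "0 \<le> C" "0 < T" "\<And>i t. T \<le> t \<Longrightarrow> measure (law0 R i) {y. t < \<bar>y\<bar>} \<le> C * F t"
proof -
  obtain C T where CT: "0 \<le> C" "0 < T" and tail:
    "\<And>i t. T \<le> t \<Longrightarrow> prob {\<omega> \<in> space P. X 0 \<omega> = i \<and> (\<exists>N. t < Rabs N (past 0 \<omega>, env 0 \<omega>))} \<le> \<pi> i * (C * F t)"
    using sup_Rabs_tail by blast
  have "measure (law0 R i) {y. t < \<bar>y\<bar>} \<le> C * F t" if t: "T \<le> t" for i t
  proof -
    have "prob {\<omega> \<in> space P. X 0 \<omega> = i \<and> t < \<bar>R (past 0 \<omega>, env 0 \<omega>)\<bar>}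
        \<le> prob {\<omega> \<in> space P. X 0 \<omega> = i \<and> (\<exists>N. t < Rabs N (past 0 \<omega>, env 0 \<omega>))}"
    proof (rule finite_measure_mono_AE)
      show "AE \<omega> in P. \<omega> \<in> {\<omega> \<in> space P. X 0 \<omega> = i \<and> t < \<bar>R (past 0 \<omega>, env 0 \<omega>)\<bar>}
          \<longrightarrow> \<omega> \<in> {\<omega> \<in> space P. X 0 \<omega> = i \<and> (\<exists>N. t < Rabs N (past 0 \<omega>, env 0 \<omega>))}"
        using AE_summable[of i]
      proof eventually_elim
        case (elim \<omega>)
        have "\<exists>N. t < Rabs N (past 0 \<omega>, env 0 \<omega>)" if "X 0 \<omega> = i" "t < \<bar>R (past 0 \<omega>, env 0 \<omega>)\<bar>"
        proof -
          have s: "summable (\<lambda>k. \<bar>pterm (past 0 \<omega>, env 0 \<omega>) k\<bar>)" using elim that by simp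
          have "\<bar>R (past 0 \<omega>, env 0 \<omega>)\<bar> \<le> (\<Sum>k. \<bar>pterm (past 0 \<omega>, env 0 \<omega>) k\<bar>)"
            unfolding R_def by (rule summable_rabs[OF s])
          then have "t < (\<Sum>k. \<bar>pterm (past 0 \<omega>, env 0 \<omega>) k\<bar>)" using that by simp
          with summable_LIMSEQ[OF s] have "eventually (\<lambda>N. t < (\<Sum>k<N. \<bar>pterm (past 0 \<omega>, env 0 \<omega>) k\<bar>)) sequentially"
            by (rule order_tendstoD(1))
          then show ?thesis by (auto simp: eventually_sequentially Rabs_def)
        qed
        then show ?case by auto
      qed
    qed measurable
    also have "\<dots> \<le> \<pi> i * (C * F t)" by (rule tail[OF t])
    finally show ?thesis using pi_pos[of i] by (simp add: measure_law0 field_simps)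
  qed
  then show ?thesis using that[OF CT] by blast
qed

section \<open>Sharp asymptotics by iterating one-sided bounds\<close>

text \<open>The thresholds hidden in \<open>ev\<close> depend on \<open>j\<close>, so the bounds
  cannot simply be averaged. The excess of \<open>f j t / F t\<close> over \<open>b j\<close> tends
  to 0 for each \<open>j\<close> and is bounded by \<open>C + b'\<close> thanks to the uniform crude
  bound, so dominated convergence over \<open>j\<close> applies.\<close>

lemma mixture_upper:
  fixes f :: "'d \<Rightarrow> real \<Rightarrow> real"
  assumes f: "\<And>j t. T \<le> t \<Longrightarrow> \<bar>f j t\<bar> \<le> C * F t" and b: "\<And>j. \<bar>b j\<bar> \<le> b'"
    and ev: "\<And>j e. 0 < e \<Longrightarrow> eventually (\<lambda>t. f j t \<le> (b j + e) * F t) at_top"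
    and e: "0 < e"
  shows "eventually (\<lambda>t. E i (\<lambda>j. f j t) \<le> (E i b + e) * F t) at_top"
proof -
  define h where "h t j = max 0 (f j t / F t - b j)" for t j
  have C0: "\<bar>f j t / F t\<bar> \<le> C" if "T \<le> t" for j t
    using f[OF that, of j] F_pos[of t] by (simp add: abs_divide divide_le_eq)
  have hb: "\<bar>h t j\<bar> \<le> C + b'" if "T \<le> t" for t j
    using C0[OF that, of j] b[of j] unfolding h_def by linarith
  have "((\<lambda>t. E i (h t)) \<longlongrightarrow> E i (\<lambda>_. 0)) at_top"
  proof (rule integral_dominated_convergence_at_top[where w = "\<lambda>_. C + b'"])
    show "\<forall>\<^sub>F t in at_top. AE j in measure_pmf (rev_pmf i). norm (h t j) \<le> C + b'"
      using eventually_ge_at_top[of T] by eventually_elim (use hb in auto)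
    have "((\<lambda>t. h t j) \<longlongrightarrow> 0) at_top" for j
    proof (rule tendstoI)
      fix e :: real assume e: "0 < e"
      have "eventually (\<lambda>t. f j t \<le> (b j + e / 2) * F t) at_top" using e by (intro ev) auto
      then show "eventually (\<lambda>t. dist (h t j) 0 < e) at_top"
      proof eventually_elim
        case (elim t)
        then have "f j t / F t \<le> b j + e / 2" using F_pos[of t] by (simp add: divide_le_eq)
        then show ?case using e by (simp add: h_def dist_real_def)
      qed
    qed
    then show "AE j in measure_pmf (rev_pmf i). ((\<lambda>t. h t j) \<longlongrightarrow> 0) at_top" by simp
  qed auto
  then have "eventually (\<lambda>t. E i (h t) < e) at_top"
    using e by (intro order_tendstoD(2)) auto
  then show ?thesis
    using eventually_ge_at_top[of T]
  proof eventually_elim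
    case (elim t)
    have "E i (\<lambda>j. f j t / F t) \<le> E i (\<lambda>j. b j + h t j)"
    proof (rule integral_mono)
      show "f j t / F t \<le> b j + h t j" for j by (simp add: h_def)
      show "integrable (measure_pmf (rev_pmf i)) (\<lambda>j. f j t / F t)"
        by (rule integrable_pmf_bounded[OF C0[OF elim(2)]])
      show "integrable (measure_pmf (rev_pmf i)) (\<lambda>j. b j + h t j)"
        by (intro Bochner_Integration.integrable_add integrable_pmf_bounded[OF b] integrable_pmf_bounded[OF hb[OF elim(2)]])
    qed
    also have "\<dots> = E i b + E i (h t)"
      by (intro Bochner_Integration.integral_add integrable_pmf_bounded[OF b] integrable_pmf_bounded[OF hb[OF elim(2)]])
    finally have "E i (\<lambda>j. f j t) / F t \<le> E i b + e" using elim(1) by simp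
    then show ?case using F_pos[of t] by (simp add: divide_le_eq)
  qed
qed

lemma mixture_lower:
  fixes f :: "'d \<Rightarrow> real \<Rightarrow> real"
  assumes f: "\<And>j t. T \<le> t \<Longrightarrow> \<bar>f j t\<bar> \<le> C * F t" and b: "\<And>j. \<bar>b j\<bar> \<le> b'"
    and ev: "\<And>j e. 0 < e \<Longrightarrow> eventually (\<lambda>t. (b j - e) * F t \<le> f j t) at_top"
    and e: "0 < e"
  shows "eventually (\<lambda>t. (E i b - e) * F t \<le> E i (\<lambda>j. f j t)) at_top"
proof -
  have "eventually (\<lambda>t. E i (\<lambda>j. - f j t) \<le> (E i (\<lambda>j. - b j) + e) * F t) at_top"
  proof (rule mixture_upper[where C = C and T = T and b' = b'])
    show "eventually (\<lambda>t. - f j t \<le> (- b j + e) * F t) at_top" if "0 < e" for j e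
      using ev[OF that, of j] by eventually_elim (simp add: algebra_simps)
  qed (use f b e in auto)
  then show ?thesis by eventually_elim (simp add: algebra_simps)
qed

lemma affine_tail_R:
  assumes "\<And>i t. T \<le> t \<Longrightarrow> measure (law0 R i) {y. t < \<bar>y\<bar>} \<le> C * F t" "0 \<le> C"
  shows "affine_tail F \<alpha> B (\<mu> i) (law1 R i) \<beta> (q i) C"
proof -
  interpret mu: prob_space "\<mu> i" by (rule prob_space_\<mu>)
  interpret nu: prob_space "law1 R i" by (rule law_basics) measurable
  show ?thesis
  proof
    show "\<forall>\<^sub>F t in at_top. measure (law1 R i) {y. t < \<bar>y\<bar>} \<le> C * F t"
      using eventually_ge_at_top[of T]
      by eventually_elim (intro law1_le assms(1) R_meas sets_abs_tail)
  qed (use M_pos alpha_beta int_beta tail_q assms(2) law_basics[OF R_meas] in auto)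
qed

text \<open>The upper error starts at \<open>C\<close>, from the crude bound and
  \<open>K \<ge> 0\<close>; the lower error starts at \<open>b\<close>, because \<open>K - b\<close>
  is at most 0 and tails are nonnegative. A given tolerance needs a fixed number \<open>n\<close> of
  passes, so combining finitely many eventual statements is enough.\<close>

lemma R_tail_limit:
  assumes K: "\<And>i. \<bar>K i\<bar> \<le> b" and K_eq: "\<And>i. K i = q i + m i * E i K" and q0: "\<And>i. 0 \<le> q i"
  shows "((\<lambda>t. measure (law0 R i) {t<..} / F t) \<longlongrightarrow> K i) at_top"
proof -
  obtain C T where CT: "0 \<le> C" "0 < T" and tail: "\<And>i t. T \<le> t \<Longrightarrow> measure (law0 R i) {y. t < \<bar>y\<bar>} \<le> C * F t"
    using R_abs_tail by blast
  have f: "\<bar>measure (law0 R j) {t<..}\<bar> \<le> C * F t" if "T \<le> t" for j t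
  proof -
    interpret nu: prob_space "law0 R j" by (rule law_basics) measurable
    have "measure (law0 R j) {t<..} \<le> measure (law0 R j) {y. t < \<bar>y\<bar>}"
      by (rule nu.finite_measure_mono) (auto simp: law_basics)
    then show ?thesis using tail[OF that, of j] by simp
  qed
  have K0: "0 \<le> K i" for i by (rule fixpoint_nonneg[OF K q0 K_eq])
  have b0: "0 \<le> b" using K[of i] by linarith
  have bn: "\<bar>K j + x\<bar> \<le> b + \<bar>x\<bar>" for j x using K[of j] by linarith
  have E_add: "E i (\<lambda>j. K j + x) = E i K + x" for i x
    using integrable_pmf_bounded[OF K, of "rev_pmf i"] by simp
  have law1: "measure (law1 R i) {s<..} = E i (\<lambda>j. measure (law0 R j) {s<..})" for i s
    by (rule law1_eq) auto
  \<comment> \<open>Each pass through the affine recursion shrinks the error of the current bound by the factor \<open>c\<close>.\<close>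
  have upper: "eventually (\<lambda>t. measure (law0 R i) {t<..} \<le> (K i + c ^ n * C + e) * F t) at_top" if "0 < e" for n i e
    using that
  proof (induction n arbitrary: i e)
    case 0
    show ?case using eventually_ge_at_top[of T]
    proof eventually_elim
      case (elim t)
      have "C * F t \<le> (K i + c ^ 0 * C + e) * F t" using K0[of i] 0 by (intro mult_right_mono) auto
      then show ?case using f[OF elim, of i] by simp
    qed
  next
    case (Suc n)
    interpret a: affine_tail F \<alpha> B "\<mu> i" "law1 R i" \<beta> "q i" C by (rule affine_tail_R[OF tail CT(1)])
    let ?a = "E i K + c ^ n * C + e"
    have ec: "0 \<le> c ^ n * C" using c CT by simp
    have "0 \<le> E i K" using K0 by (intro integral_nonneg_AE) auto
    then have a0: "0 \<le> ?a" using ec Suc.prems by simp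
    have ev: "eventually (\<lambda>t. measure (law1 R i) {t<..} \<le> ?a * F t) at_top"
      unfolding law1 E_add[symmetric]
    proof (rule mixture_upper[OF f])
      show "\<bar>K j + c ^ n * C\<bar> \<le> b + \<bar>c ^ n * C\<bar>" for j by (rule bn)
    qed (use Suc in auto)
    have "m i * (c ^ n * C) \<le> c * (c ^ n * C)" using m ec by (intro mult_right_mono)
    \<comment> \<open>The tolerance \<open>e\<close> is multiplied by \<open>m i < 1\<close> in the
      step; what is left over supplies the strict inequality demanded by
      \<open>affine_upper\<close>, so \<open>e\<close> need not grow with \<open>n\<close>.\<close>
    moreover have "m i * e < e" using m(2)[of i] c Suc.prems by simp
    ultimately have "q i + ?a * m i < K i + c ^ Suc n * C + e"
      unfolding K_eq[of i] by (simp add: algebra_simps)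
    then show ?case
      unfolding R_tail_eq m_def by (rule a.affine_upper[OF a0 ev])
  qed
  have lower: "eventually (\<lambda>t. (K i - c ^ n * b - e) * F t \<le> measure (law0 R i) {t<..}) at_top" if "0 < e" for n i e
    using that
  proof (induction n arbitrary: i e)
    case 0
    \<comment> \<open>The bound holds trivially at the start, as \<open>K i\<close> is at most
      \<open>b\<close>.\<close>
    have "(K i - c ^ 0 * b - e) * F t \<le> 0" for t
      using K[of i] 0 by (intro mult_nonpos_nonneg) auto
    then show ?case by (intro always_eventually allI) (rule order_trans, assumption, simp)
  next
    case (Suc n)
    interpret a: affine_tail F \<alpha> B "\<mu> i" "law1 R i" \<beta> "q i" C by (rule affine_tail_R[OF tail CT(1)])
    let ?a = "E i K + (- (c ^ n * b)) - e"
    have ec: "0 \<le> c ^ n * b" using c b0 by simp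
    have ev: "eventually (\<lambda>t. ?a * F t \<le> measure (law1 R i) {t<..}) at_top"
      unfolding law1 E_add[symmetric]
    proof (rule mixture_lower[OF f])
      show "\<bar>K j + (- (c ^ n * b))\<bar> \<le> b + \<bar>- (c ^ n * b)\<bar>" for j by (rule bn)
    qed (use Suc in auto)
    have "m i * (c ^ n * b) \<le> c * (c ^ n * b)" using m ec by (intro mult_right_mono)
    moreover have "m i * e < e" using m(2)[of i] c Suc.prems by simp
    ultimately have "K i - c ^ Suc n * b - e < q i + ?a * m i"
      unfolding K_eq[of i] by (simp add: algebra_simps)
    then show ?case
      unfolding R_tail_eq m_def by (rule a.affine_lower[OF ev])
  qed
  show ?thesis
  proof (rule tendstoI)
    fix e :: real assume e: "0 < e"
    have "(\<lambda>n. c ^ n * (C + b)) \<longlonglongrightarrow> 0 * (C + b)" using c by (intro tendsto_intros) auto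
    then have "eventually (\<lambda>n. c ^ n * (C + b) < e / 3) sequentially"
      using e by (intro order_tendstoD(2)) auto
    then obtain n where n: "c ^ n * (C + b) < e / 3" by (auto simp: eventually_sequentially)
    have "c ^ n * C \<le> c ^ n * (C + b)" "c ^ n * b \<le> c ^ n * (C + b)"
      using b0 CT c by (auto intro!: mult_left_mono)
    then have n: "c ^ n * C < e / 3" "c ^ n * b < e / 3" using n by linarith+
    have e3: "0 < e / 3" using e by simp
    show "eventually (\<lambda>t. dist (measure (law0 R i) {t<..} / F t) (K i) < e) at_top"
      using upper[OF e3, of i n] lower[OF e3, of i n]
    proof eventually_elim
      case (elim t)
      have "measure (law0 R i) {t<..} / F t \<le> K i + c ^ n * C + e / 3"
        "K i - c ^ n * b - e / 3 \<le> measure (law0 R i) {t<..} / F t"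
        using elim F_pos[of t] by (simp_all add: divide_le_eq le_divide_eq)
      then show ?case using n e unfolding dist_real_def by linarith
    qed
  qed
qed

text \<open>Positivity travels with the forward chain: if \<open>p k l\<close> is positive, the
  reversed chain goes from \<open>l\<close> to \<open>k\<close> with positive probability, so
  \<open>K l\<close> is at least the positive number \<open>m l\<close> times that probability times
  \<open>K k\<close>. Irreducibility joins a state with positive \<open>q\<close> to any
  other.\<close>

lemma fixpoint_pos:
  assumes K: "\<And>i. \<bar>K i\<bar> \<le> b" and K_eq: "\<And>i. K i = q i + m i * E i K" and q0: "\<And>i. 0 \<le> q i" and qj: "0 < q j"
  shows "0 < K i"
proof -
  have K0: "0 \<le> K i" for i by (rule fixpoint_nonneg[OF K q0 K_eq])
  have E0: "0 \<le> E i K" for i using K0 by (intro integral_nonneg_AE) auto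
  have base: "0 < K j" using K_eq[of j] qj E0[of j] m(1)[of j] by (simp add: add_pos_nonneg)
  have step: "0 < K l" if "0 < K k" "0 < p k l" for k l
  proof -
    have "0 < pmf (rev_pmf l) k" using that(2) pi_pos[of k] pi_pos[of l] by (simp add: pmf_rev_pmf rev_trans_eq)
    then have "0 < pmf (rev_pmf l) k * K k" using that by simp
    also have "\<dots> = E l (\<lambda>j. indicator {k} j * K k)"
      by (simp add: measure_pmf_single)
    also have "\<dots> \<le> E l K"
    proof (rule integral_mono)
      show "integrable (measure_pmf (rev_pmf l)) (\<lambda>j. indicator {k} j * K k)"
        by (rule integrable_pmf_bounded[where b = "\<bar>K k\<bar>"]) (auto simp: indicator_def)
      show "indicator {k} j * K k \<le> K j" for j using K0[of j] by (auto simp: indicator_def)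
    qed (rule integrable_pmf_bounded[OF K])
    finally have "0 < m l * E l K" using m_pos[of l] by simp
    then show ?thesis using K_eq[of l] q0[of l] by linarith
  qed
  obtain path where path: "path \<noteq> []" "hd path = j" "last path = i"
    "\<And>l. Suc l < length path \<Longrightarrow> 0 < p (path ! l) (path ! Suc l)"
    using irred unfolding irreducible_matrix_def by metis
  have "l < length path \<Longrightarrow> 0 < K (path ! l)" for l
  proof (induction l)
    case 0
    then show ?case using path base by (simp add: hd_conv_nth)
  next
    case (Suc l)
    then show ?case using step[of "path ! l" "path ! Suc l"] path(4) by simp
  qed
  from this[of "length path - 1"] show ?thesis using path by (simp add: last_conv_nth)
qed

end

text \<open>Inverting \<open>I - G\<close> is phrased as unique solvability within
  \<open>Bb\<close>, so that no operator theory enters; the asymptotics are stated for every bounded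
  solution, hence for that one.\<close>

theorem theorem1:
  fixes P :: "'a measure"
    and X :: "int \<Rightarrow> 'a \<Rightarrow> 'd::countable"
    and Q M :: "int \<Rightarrow> 'd \<Rightarrow> 'a \<Rightarrow> real"
    and \<alpha> :: real and L :: "real \<Rightarrow> real" and q1 qm1 :: "'d \<Rightarrow> real"
  assumes P: "prob_space P"
    and MC: "stationary_irreducible_MC P X"
    and indep_X_QM: "prob_space.indep_set P
          (sets (vimage_algebra (space P) (\<lambda>\<omega> n. X n \<omega>)
             (Pi\<^sub>M (UNIV :: int set) (\<lambda>_. (count_space UNIV :: 'd measure)))))
          (sets (vimage_algebra (space P)
             (\<lambda>\<omega> ni. (Q (fst ni) (snd ni) \<omega>, M (fst ni) (snd ni) \<omega>))
             (Pi\<^sub>M (UNIV :: (int \<times> 'd) set) (\<lambda>_. (borel :: (real \<times> real) measure)))))"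
    and indep_QM: "prob_space.indep_vars P (\<lambda>_. borel)
          (\<lambda>ni \<omega>. (Q (fst ni) (snd ni) \<omega>, M (fst ni) (snd ni) \<omega>)) UNIV"
    and ident_QM: "\<And>n i. distr P borel (\<lambda>\<omega>. (Q n i \<omega>, M n i \<omega>))
                          = distr P borel (\<lambda>\<omega>. (Q 0 i \<omega>, M 0 i \<omega>))"
    and alpha_pos: "\<alpha> > 0"
    (* (A1) *)
    and L_sv: "slowly_varying L"
    and q_nonneg: "\<And>i. q1 i \<ge> 0" "\<And>i. qm1 i \<ge> 0"
    and A1_pos: "uniform_limit UNIV
          (\<lambda>t i. measure P {\<omega> \<in> space P. Q 0 i \<omega> > t} / (t powr (-\<alpha>) * L t)) q1 at_top"
    and A1_neg: "uniform_limit UNIV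
          (\<lambda>t i. measure P {\<omega> \<in> space P. - Q 0 i \<omega> > t} / (t powr (-\<alpha>) * L t)) qm1 at_top"
    and A1_sum: "\<exists>j. q1 j > 0"
    and A1_bdd: "\<exists>C. \<forall>j. max (q1 j) (qm1 j) \<le> C"
    (* (A2) *)
    and A2: "\<exists>\<beta>>\<alpha>. \<exists>C. \<forall>i. integrable P (\<lambda>\<omega>. \<bar>M 0 i \<omega>\<bar> powr \<beta>)
                         \<and> (\<integral>\<omega>. \<bar>M 0 i \<omega>\<bar> powr \<beta> \<partial>P) \<le> C"
    (* (A3) *)
    and A3: "\<exists>c<1. \<forall>i. (\<integral>\<omega>. \<bar>M 0 i \<omega>\<bar> powr \<alpha> \<partial>P) \<le> c"
    (* (A4) *)
    and A4: "uniform_limit UNIV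
          (\<lambda>\<epsilon> i. measure P {\<omega> \<in> space P. M 1 i \<omega> \<le> \<epsilon>})
          (\<lambda>i. measure P {\<omega> \<in> space P. M 1 i \<omega> \<le> 0}) (at_right 0)"
    (* positivity of the multiplicative coefficients *)
    and M_pos: "\<And>i. measure P {\<omega> \<in> space P. M 0 i \<omega> > 0} = 1"
  defines "G \<equiv> (\<lambda>i j. (\<integral>\<omega>. \<bar>M 0 i \<omega>\<bar> powr \<alpha> \<partial>P) * rev_trans P X i j)"
  shows "(\<exists>!K. K \<in> Bb \<and> (\<forall>i. K i - (\<Sum>\<^sub>\<infinity>j. G i j * K j) = q1 i))
     \<and> (\<forall>K. K \<in> Bb \<and> (\<forall>i. K i - (\<Sum>\<^sub>\<infinity>j. G i j * K j) = q1 i) \<longrightarrow>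
           (\<forall>i. (\<lambda>t. measure P {\<omega> \<in> space P. perpetuity X Q M \<omega> > t \<and> X 0 \<omega> = i}
                        / measure P {\<omega> \<in> space P. X 0 \<omega> = i})
                  \<sim>[at_top] (\<lambda>t. K i * t powr (-\<alpha>) * L t)))"
proof -
  interpret prob_space P by (rule P)
  obtain \<pi> p where stoch: "stochastic_matrix p" and irr: "irreducible_matrix p"
    and path: "\<And>n path. path \<noteq> [] \<Longrightarrow>
      prob {\<omega> \<in> space P. \<forall>l < length path. X (n + int l) \<omega> = path ! l}
        = \<pi> (hd path) * (\<Prod>l < length path - 1. p (path ! l) (path ! Suc l))"
    and X [measurable]: "\<And>n. X n \<in> measurable P (count_space UNIV)"
    using MC unfolding stationary_irreducible_MC_def by blast
  have QM: "random_variable borel (\<lambda>\<omega>. (Q (fst ni) (snd ni) \<omega>, M (fst ni) (snd ni) \<omega>))" for ni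
    using indep_QM unfolding indep_vars_def by auto
  interpret mc_env P X Q M \<pi> p
  proof (unfold_locales, goal_cases)
    case 5
    show ?case
      by (rule indep_rv_of_indep_set[OF indep_X_QM]) (auto intro!: measurable_PiM_single' QM)
  qed (use X stoch irr path indep_QM ident_QM in auto)
  have Q_meas [measurable]: "Q n i \<in> borel_measurable P" and M_meas [measurable]: "M n i \<in> borel_measurable P" for n i
    using measurable_compose[OF W_meas[of n i] measurable_fst_borel]
      measurable_compose[OF W_meas[of n i] measurable_snd_borel] by (simp_all add: W_def)

  obtain \<beta> D where \<beta>: "\<alpha> < \<beta>" and beta_int: "\<And>i. integrable P (\<lambda>\<omega>. \<bar>M 0 i \<omega>\<bar> powr \<beta>)"
    and beta_le: "\<And>i. (\<integral>\<omega>. \<bar>M 0 i \<omega>\<bar> powr \<beta> \<partial>P) \<le> D"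
    using A2 by blast
  obtain c where c: "c < 1" and alpha_le: "\<And>i. (\<integral>\<omega>. \<bar>M 0 i \<omega>\<bar> powr \<alpha> \<partial>P) \<le> c"
    using A3 by blast
  obtain Cq where "\<And>j. max (q1 j) (qm1 j) \<le> Cq" using A1_bdd by blast
  then have Cq: "q1 j \<le> Cq" "qm1 j \<le> Cq" for j by simp_all
  obtain j0 where j0: "0 < q1 j0" using A1_sum by blast
  have Cq0: "0 \<le> Cq" using Cq(1)[of j0] j0 by linarith

  \<comment> \<open>\<open>L\<close> is not assumed measurable; the monotone \<open>F\<close> below is asymptotic to \<open>ell\<close> and replaces it.\<close>
  define ell where "ell t = t powr - \<alpha> * L t" for t
  define F where "F t = prob {\<omega> \<in> space P. Q 0 j0 \<omega> > t} / q1 j0" for t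
  have lim: "((\<lambda>t. prob {\<omega> \<in> space P. Q 0 i \<omega> > t} / ell t) \<longlongrightarrow> q1 i) at_top" for i
    unfolding ell_def by (rule tendsto_uniform_limitI[OF A1_pos]) simp
  have F_ell: "((\<lambda>t. F t / ell t) \<longlongrightarrow> 1) at_top"
    using tendsto_divide[OF lim[of j0] tendsto_const[of "q1 j0"]] j0 by (simp add: F_def mult.commute)
  have "eventually (\<lambda>t. 0 < F t / ell t) at_top"
    using order_tendstoD(1)[OF F_ell, of 0] by simp
  \<comment> \<open>The quotient is eventually positive and \<open>F\<close> is nonnegative, so both
    are eventually positive. The sign of \<open>L\<close> at infinity is obtained here.\<close>
  then have F_ell_pos: "eventually (\<lambda>t. 0 < F t \<and> 0 < ell t) at_top"
  proof eventually_elim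
    case (elim t)
    have "0 \<le> F t" using j0 by (simp add: F_def)
    then show ?case using elim by (auto simp: zero_less_divide_iff)
  qed
  have F_anti: "F t \<le> F s" if "s \<le> t" for s t
    unfolding F_def using that j0 by (intro divide_right_mono finite_measure_mono) auto
  have rvt: "regularly_varying_tail F \<alpha> (1 / q1 j0)"
  proof
    show "antimono F" using F_anti by (rule antimonoI)
    show "F t \<le> 1 / q1 j0" for t unfolding F_def using j0 by (intro divide_right_mono) auto
    \<comment> \<open>Positivity at arbitrarily large arguments spreads to all smaller ones by
      monotonicity.\<close>
    show "0 < F t" for t
    proof -
      have "eventually (\<lambda>s. 0 < F s \<and> t \<le> s) at_top"
        using F_ell_pos eventually_ge_at_top[of t] by eventually_elim simp
      then obtain s where "0 < F s" "t \<le> s"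
        using eventually_happens[of _ "at_top :: real filter"] by auto
      then show ?thesis using F_anti[of t s] by simp
    qed
    show "0 < \<alpha>" by (rule alpha_pos)
    fix a :: real assume a: "0 < a"
    have at: "filterlim (\<lambda>t. a * t) at_top at_top"
      using a filterlim_tendsto_pos_mult_at_top[OF tendsto_const, of a "\<lambda>t. t" at_top]
      by (auto simp: filterlim_ident)
    \<comment> \<open>Asymptotic equivalence reads the quotient 0/0 as 1; excluding simultaneous
      zeros turns it into an ordinary limit of quotients.\<close>
    have L_ne: "eventually (\<lambda>t. L (a * t) \<noteq> 0 \<or> L t \<noteq> 0) at_top"
      using F_ell_pos by eventually_elim (auto simp: ell_def)
    have "(\<lambda>t. L (a * t)) \<sim>[at_top] L" using L_sv a by (simp add: slowly_varying_def)
    then have L_lim: "((\<lambda>t. L (a * t) / L t) \<longlongrightarrow> 1) at_top"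
      using L_ne by (rule asymp_equivD_strong)
    \<comment> \<open>The ratio is routed through \<open>ell\<close>: from \<open>F (a * t)\<close>
      to \<open>ell (a * t)\<close>, then to \<open>ell t\<close> by slow variation, then back to
      \<open>F t\<close>.\<close>
    have "((\<lambda>t. F (a * t) / ell (a * t) * (a powr - \<alpha> * (L (a * t) / L t)) / (F t / ell t)) \<longlongrightarrow>
        1 * (a powr - \<alpha> * 1) / 1) at_top"
      by (intro tendsto_intros filterlim_compose[OF F_ell at] L_lim F_ell) simp
    moreover have "eventually (\<lambda>t. F (a * t) / ell (a * t) * (a powr - \<alpha> * (L (a * t) / L t)) / (F t / ell t)
        = F (a * t) / F t) at_top"
      using F_ell_pos eventually_compose_filterlim[OF F_ell_pos at] eventually_gt_at_top[of 0]
    proof eventually_elim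
      case (elim t)
      have "ell (a * t) = a powr - \<alpha> * t powr - \<alpha> * L (a * t)"
        using a elim by (simp add: ell_def powr_mult)
      moreover have "L t \<noteq> 0" "L (a * t) \<noteq> 0" using elim by (auto simp: ell_def)
      ultimately show ?case using elim a by (simp add: ell_def field_simps)
    qed
    ultimately have "((\<lambda>t. F (a * t) / F t) \<longlongrightarrow> 1 * (a powr - \<alpha> * 1) / 1) at_top"
      by (rule Lim_transform_eventually)
    then show "((\<lambda>t. F (a * t) / F t) \<longlongrightarrow> a powr - \<alpha>) at_top" by simp
  qed
  interpret rv: regularly_varying_tail F \<alpha> "1 / q1 j0" by (rule rvt)

  have \<mu>_events: "measure (\<mu> i) {w. A w} = prob {\<omega> \<in> space P. A (Q 0 i \<omega>, M 0 i \<omega>)}"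
    if "{w. A w} \<in> sets borel" for A i
    unfolding \<mu>_def using that
    by (subst measure_distr) (auto simp: W_def intro!: arg_cong[where f = prob])
  have sets_fst: "{w :: real \<times> real. t < fst w} \<in> sets borel" "{w :: real \<times> real. t < \<bar>fst w\<bar>} \<in> sets borel" for t
  proof -
    have "{w \<in> space borel. t < fst w} \<in> sets (borel :: (real \<times> real) measure)"
      "{w \<in> space borel. t < \<bar>fst w\<bar>} \<in> sets (borel :: (real \<times> real) measure)" by measurable
    then show "{w :: real \<times> real. t < fst w} \<in> sets borel" "{w :: real \<times> real. t < \<bar>fst w\<bar>} \<in> sets borel"
      by simp_all
  qed
  have M_AE: "AE \<omega> in P. 0 < M 0 i \<omega>" for i
    using M_pos[of i] by (subst (asm) prob_Collect_eq_1) auto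
  have \<mu>_pos: "AE w in \<mu> i. 0 < snd w" for i
    unfolding \<mu>_def using M_AE[of i] by (subst AE_distr_iff) (auto simp: W_def)
  have moment: "(\<integral>w. snd w powr s \<partial>\<mu> i) = (\<integral>\<omega>. \<bar>M 0 i \<omega>\<bar> powr s \<partial>P)"
    "integrable (\<mu> i) (\<lambda>w. snd w powr s) \<longleftrightarrow> integrable P (\<lambda>\<omega>. \<bar>M 0 i \<omega>\<bar> powr s)" for i s
  proof -
    have ae: "AE \<omega> in P. M 0 i \<omega> powr s = \<bar>M 0 i \<omega>\<bar> powr s" using M_AE[of i] by eventually_elim simp
    have "(\<integral>w. snd w powr s \<partial>\<mu> i) = (\<integral>\<omega>. M 0 i \<omega> powr s \<partial>P)"
      unfolding \<mu>_def by (subst integral_distr) (auto simp: W_def)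
    also have "\<dots> = (\<integral>\<omega>. \<bar>M 0 i \<omega>\<bar> powr s \<partial>P)" by (rule integral_cong_AE) (use ae in auto)
    finally show "(\<integral>w. snd w powr s \<partial>\<mu> i) = (\<integral>\<omega>. \<bar>M 0 i \<omega>\<bar> powr s \<partial>P)" .
    have "integrable (\<mu> i) (\<lambda>w. snd w powr s) \<longleftrightarrow> integrable P (\<lambda>\<omega>. M 0 i \<omega> powr s)"
      unfolding \<mu>_def by (subst integrable_distr_eq) (auto simp: W_def)
    also have "\<dots> \<longleftrightarrow> integrable P (\<lambda>\<omega>. \<bar>M 0 i \<omega>\<bar> powr s)" by (rule integrable_cong_AE) (use ae in auto)
    finally show "integrable (\<mu> i) (\<lambda>w. snd w powr s) \<longleftrightarrow> integrable P (\<lambda>\<omega>. \<bar>M 0 i \<omega>\<bar> powr s)" .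
  qed
  \<comment> \<open>A bound on a Bochner integral does not imply integrability, since the integral
    of a non-integrable function is 0. Integrability is therefore drawn from the \<beta>-moment
    through \<open>x powr \<alpha> \<le> 1 + x powr \<beta>\<close>.\<close>
  have alpha_int: "integrable P (\<lambda>\<omega>. \<bar>M 0 i \<omega>\<bar> powr \<alpha>)" for i
  proof (rule Bochner_Integration.integrable_bound)
    show "integrable P (\<lambda>\<omega>. 1 + \<bar>M 0 i \<omega>\<bar> powr \<beta>)" using beta_int[of i] by simp
    have "x powr \<alpha> \<le> 1 + x powr \<beta>" if "0 \<le> x" for x :: real
    proof (cases "1 \<le> x")
      case True
      then show ?thesis using powr_mono[of \<alpha> \<beta> x] \<beta> by simp
    next
      case False
      then show ?thesis using powr_mono2[of \<alpha> x 1] that alpha_pos by (simp add: add_increasing2)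
    qed
    then show "AE \<omega> in P. norm (\<bar>M 0 i \<omega>\<bar> powr \<alpha>) \<le> norm (1 + \<bar>M 0 i \<omega>\<bar> powr \<beta>)" by simp
  qed measurable
  have ell_F: "eventually (\<lambda>t. ell t \<le> 2 * F t) at_top"
  proof -
    have "eventually (\<lambda>t. 1 / 2 < F t / ell t) at_top" using order_tendstoD(1)[OF F_ell, of "1 / 2"] by simp
    then show ?thesis
      using F_ell_pos by eventually_elim (simp add: field_simps)
  qed
  \<comment> \<open>Uniform convergence within distance 1 bounds each one-sided tail by
    \<open>(Cq + 1) * ell t\<close> for all \<open>i\<close> at once. One factor 2 comes from the
    two signs, the other from \<open>ell t \<le> 2 * F t\<close>.\<close>
  have "eventually (\<lambda>t. \<forall>i. prob {\<omega> \<in> space P. t < \<bar>Q 0 i \<omega>\<bar>} \<le> 4 * (Cq + 1) * F t) at_top"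
    using uniform_limitD[OF A1_pos, of 1, simplified] uniform_limitD[OF A1_neg, of 1, simplified] ell_F F_ell_pos
  proof eventually_elim
    case (elim t)
    have ell: "t powr - \<alpha> * L t = ell t" "0 < ell t" using elim by (auto simp: ell_def)
    show ?case
    proof
      fix i
      have "prob {\<omega> \<in> space P. Q 0 i \<omega> > t} / ell t \<le> Cq + 1"
        using elim(1)[rule_format, of i] Cq(1)[of i] unfolding ell dist_real_def by linarith
      moreover have "prob {\<omega> \<in> space P. - Q 0 i \<omega> > t} / ell t \<le> Cq + 1"
        using elim(2)[rule_format, of i] Cq(2)[of i] unfolding ell dist_real_def by linarith
      ultimately have le: "prob {\<omega> \<in> space P. Q 0 i \<omega> > t} \<le> (Cq + 1) * ell t"
        "prob {\<omega> \<in> space P. - Q 0 i \<omega> > t} \<le> (Cq + 1) * ell t"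
        using ell(2) by (simp_all add: divide_le_eq)
      have "prob {\<omega> \<in> space P. t < \<bar>Q 0 i \<omega>\<bar>}
          \<le> prob ({\<omega> \<in> space P. Q 0 i \<omega> > t} \<union> {\<omega> \<in> space P. - Q 0 i \<omega> > t})"
        by (intro finite_measure_mono) (auto simp: abs_if split: if_splits)
      also have "\<dots> \<le> prob {\<omega> \<in> space P. Q 0 i \<omega> > t} + prob {\<omega> \<in> space P. - Q 0 i \<omega> > t}"
        by (rule measure_Un_le) measurable
      also have "\<dots> \<le> (2 * (Cq + 1)) * ell t" using le by (simp add: algebra_simps)
      also have "\<dots> \<le> (2 * (Cq + 1)) * (2 * F t)" using elim(3) Cq0 by (intro mult_left_mono) auto
      finally show "prob {\<omega> \<in> space P. t < \<bar>Q 0 i \<omega>\<bar>} \<le> 4 * (Cq + 1) * F t" by (simp add: algebra_simps)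
    qed
  qed
  then obtain T1 where T1: "\<And>t i. T1 \<le> t \<Longrightarrow> prob {\<omega> \<in> space P. t < \<bar>Q 0 i \<omega>\<bar>} \<le> 4 * (Cq + 1) * F t"
    unfolding eventually_at_top_linorder by blast
  interpret mp: mc_perpetuity P X Q M \<pi> p F \<alpha> "1 / q1 j0" q1 \<beta> c D "4 * (Cq + 1)" T1
  proof (unfold_locales, goal_cases)
    case (8 i)
    have "((\<lambda>t. prob {\<omega> \<in> space P. Q 0 i \<omega> > t} / ell t / (F t / ell t)) \<longlongrightarrow> q1 i / 1) at_top"
      by (intro tendsto_intros lim F_ell) simp
    moreover have "eventually (\<lambda>t. prob {\<omega> \<in> space P. Q 0 i \<omega> > t} / ell t / (F t / ell t)
        = prob {\<omega> \<in> space P. Q 0 i \<omega> > t} / F t) at_top"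
      using F_ell_pos by eventually_elim simp
    ultimately have "((\<lambda>t. prob {\<omega> \<in> space P. Q 0 i \<omega> > t} / F t) \<longlongrightarrow> q1 i / 1) at_top"
      by (rule Lim_transform_eventually)
    then show ?case
      by (simp add: \<mu>_events[OF sets_fst(1)])
  next
    case (10 i s)
    then show ?case using T1 by (simp add: \<mu>_events[OF sets_fst(2)])
  qed (use \<beta> c \<mu>_pos moment alpha_int beta_int alpha_le beta_le Cq0 in auto)

  have m_eq: "mp.m i = (\<integral>\<omega>. \<bar>M 0 i \<omega>\<bar> powr \<alpha> \<partial>P)" for i
    by (simp add: mp.m_def moment)
  have G_sum: "(\<Sum>\<^sub>\<infinity>j. G i j * K j) = mp.m i * mp.E i K" if "\<And>j. \<bar>K j\<bar> \<le> b" for K b i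
    using infsum_pmf_bounded[OF that, of "mp.m i" "rev_pmf i"] by (simp add: G_def m_eq pmf_rev_pmf)
  have Bb_bound: "\<exists>b. \<forall>j. \<bar>K j\<bar> \<le> b" if "K \<in> Bb" for K :: "'d \<Rightarrow> real"
    using that by (auto simp: Bb_def bounded_iff)
  obtain K b where K: "\<And>i. \<bar>K i\<bar> \<le> b" and K_eq: "\<And>i. K i = q1 i + mp.m i * mp.E i K"
    using mp.fixpoint_exists[where q = q1, OF q_nonneg(1) Cq(1)] by blast
  have unique: "K' = K" if "K' \<in> Bb" "\<And>i. K' i - (\<Sum>\<^sub>\<infinity>j. G i j * K' j) = q1 i" for K'
  proof -
    obtain b' where b': "\<And>j. \<bar>K' j\<bar> \<le> b'" using Bb_bound[OF \<open>K' \<in> Bb\<close>] by blast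
    have eq: "K' i = q1 i + mp.m i * mp.E i K'" for i
      using that(2)[of i] G_sum[OF b', of i] by simp
    show ?thesis by (rule mp.fixpoint_unique[OF b' K eq K_eq])
  qed
  have K_sol: "K \<in> Bb" "\<And>i. K i - (\<Sum>\<^sub>\<infinity>j. G i j * K j) = q1 i"
  proof -
    show "K \<in> Bb" using K by (auto simp: Bb_def bounded_iff)
    show "K i - (\<Sum>\<^sub>\<infinity>j. G i j * K j) = q1 i" for i using K_eq[of i] G_sum[OF K, of i] by simp
  qed
  have asymp: "(\<lambda>t. prob {\<omega> \<in> space P. perpetuity X Q M \<omega> > t \<and> X 0 \<omega> = i} / prob {\<omega> \<in> space P. X 0 \<omega> = i})
      \<sim>[at_top] (\<lambda>t. K i * t powr (-\<alpha>) * L t)" for i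
  proof (rule asymp_equivI')
    \<comment> \<open>Needed to divide by \<open>K i\<close>, so that the equivalence becomes a
      limit of quotients.\<close>
    have Ki: "0 < K i" by (rule mp.fixpoint_pos[OF K K_eq q_nonneg(1) j0])
    define f where "f t = prob {\<omega> \<in> space P. perpetuity X Q M \<omega> > t \<and> X 0 \<omega> = i} / prob {\<omega> \<in> space P. X 0 \<omega> = i}" for t
    have f: "f t = measure (mp.law0 mp.R i) {t<..}" for t
      unfolding f_def by (simp add: mp.measure_law0 mp.perpetuity_eq prob_X conj_commute)
    have "((\<lambda>t. f t / F t) \<longlongrightarrow> K i) at_top"
      unfolding f by (rule mp.R_tail_limit[OF K K_eq q_nonneg(1)])
    then have "((\<lambda>t. f t / F t * (F t / ell t) / K i) \<longlongrightarrow> K i * 1 / K i) at_top"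
      using Ki by (intro tendsto_intros F_ell) auto
    moreover have "eventually (\<lambda>t. f t / F t * (F t / ell t) / K i = f t / (K i * t powr (-\<alpha>) * L t)) at_top"
      using F_ell_pos by eventually_elim (simp add: ell_def mult_ac)
    ultimately have "((\<lambda>t. f t / (K i * t powr (-\<alpha>) * L t)) \<longlongrightarrow> K i * 1 / K i) at_top"
      by (rule Lim_transform_eventually)
    then show "((\<lambda>t. f t / (K i * t powr (-\<alpha>) * L t)) \<longlongrightarrow> 1) at_top"
      using Ki by simp
  qed
  show ?thesis
  proof (intro conjI allI impI)
    show "\<exists>!K. K \<in> Bb \<and> (\<forall>i. K i - (\<Sum>\<^sub>\<infinity>j. G i j * K j) = q1 i)"
      using K_sol unique by blast
    fix K' i assume "K' \<in> Bb \<and> (\<forall>i. K' i - (\<Sum>\<^sub>\<infinity>j. G i j * K' j) = q1 i)"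
    then have "K' = K" using unique by blast
    then show "(\<lambda>t. prob {\<omega> \<in> space P. perpetuity X Q M \<omega> > t \<and> X 0 \<omega> = i} / prob {\<omega> \<in> space P. X 0 \<omega> = i})
        \<sim>[at_top] (\<lambda>t. K' i * t powr (-\<alpha>) * L t)"
      using asymp by simp
  qed
qed

end
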